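(* There exist an interval $[a,b]$ and an admissible quadruple $(g,R,P,S)$ for the differential problem in $\mathbb{R}^2$ on $[a,b]$, with $R$ real analytic, $n_+(g)=1$ and $P=\{0\}$, having a unique $(P,S)$-focal instant (which is different from $b$), and whose Maslov index is $\mu(g,R,P,S)=-1$, while its focal index is $\mathrm{i}_{\rm foc}=0$.
   Context: **Quadruples.** An admissible quadruple for the differential problem in $\mathbb{R}^n$ (on $[a,b]$) is $(g,R,P,S)$ where: $g$ is a nondegenerate symmetric bilinear form on $\mathbb{R}^n$; $R:[a,b]\to\mathcal L(\mathbb{R}^n,\mathbb{R}^n)$ is continuous and each $R(t)$ is $g$-symmetric; $P\subset\mathbb{R}^n$ is a subspace on which $g$ is nondegenerate; $S$ is a symmetric bilinear form on $P$ (so $S=0$ if $P=\{0\}$), also regarded as the operator $S:P\to P$ with $S(v,w)=g(S[v],w)$. A $(P,S)$-solution is a map $J:[a,b]\to\mathbb{R}^n$ with $J''(t)=R(t)[J(t)]$, $J(a)\in P$, $J'(a)+S[J(a)]\in P^\perp$ ($\perp$ w.r.t. $g$); for $P=\{0\}$ this means $J''=RJ$ and $J(a)=0$. $\mathbb{J}$ is the space of $(P,S)$-solutions and $\mathbb{J}[t]=\{J(t):J\in\mathbb{J}\}$. An instant $t_0\in\,]a,b]$ is $(P,S)$-focal if some nonzero $J\in\mathbb J$ has $J(t_0)=0$. Its signature $\mathrm{sgn}(t_0)$ is the signature ($n_+-n_-$) of the restriction of $g$ to $\mathbb{J}[t_0]^\perp$. If there are finitely many focal instants, the focal index is $\mathrm{i}_{\rm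 foc}=\sum\mathrm{sgn}(t)$ over the focal instants $t\in\,]a,b]$. Here $n_\pm(B)$ is the maximal dimension of a subspace on which the symmetric bilinear form $B$ is positive/negative definite. **Lagrangian Grassmannian and Maslov index.** For a $2n$-dimensional symplectic space $(V,\omega)$, $\Lambda$ is the manifold of Lagrangian subspaces. There is a canonical identification $T_L\Lambda\cong\mathrm{B}_{\rm sym}(L,\mathbb{R})$ (symmetric bilinear forms on $L$): choose a Lagrangian $L_1$ complementary to $L$; Lagrangians $W$ transverse to $L_1$ are graphs of unique linear $T:L\to L_1$, $W\mapsto\omega(T\cdot,\cdot)|_L$ is a chart, and its differential at $L$ is the identification (independent of $L_1$). For $L_0\in\Lambda$, $\Lambda_k(L_0)=\{L:\dim(L\cap L_0)=k\}$, $\Lambda_{\ge1}(L_0)=\bigcup_{i\ge1}\Lambda_i(L_0)$. A tangent vector $B$ at $L\in\Lambda_1(L_0)$ (a codimension one submanifold) is transverse iff nonzero on the line $L\cap L_0$, and positive if positive definite there. $\mu_{L_0}:H_1(\Lambda,\Lambda_0(L_0))\to\mathbb{Z}$ is the unique isomorphism with value $1$ on the class of any smooth curve with endpoints outside $\Lambda_{\ge1}(L_0)$ meeting $\Lambda_{\ge1}(L_0)$ only once, in $\Lambda_1(L_0)$, transversally with positive tangent vector. For a continuous curve $\ell$ with endpoints outside $\Lambda_{\ge1}(L_0)$, $\mu_{L_0}(\ell)$ is the value on its class; if $\{t\in\,]a,b[\,:\ell(t)\in\Lambda_{\ge1}(L_0)\}\subset[c,d]\subset\,]a,b[$, then $\mu_{L_0}(\ell):=\mu_{L_0}(\ell|_{[c,d]})$.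 For a quadruple $(g,R,P,S)$ put $\omega[(x_1,x_2),(y_1,y_2)]=g(x_1,y_2)-g(x_2,y_1)$ on $\mathbb{R}^{2n}$, $\Psi(t)[(J(a),J'(a))]=(J(t),J'(t))$ for all solutions of $J''=RJ$, $\ell_0=\{(x,y):x\in P,\ y+S[x]\in P^\perp\}$, $L_0=\{0\}\oplus\mathbb{R}^n$, $\ell(t)=\Psi(t)[\ell_0]$. There are no $(P,S)$-focal instants near $a$; if $b$ is not $(P,S)$-focal, $\mu(g,R,P,S):=\mu_{L_0}(\ell)$. *)

theory Defs
  imports "HOL-Analysis.Analysis" "HOL-Homology.Homology"
begin

section \<open>Symmetric bilinear forms\<close>

definition sym_bilinear_on :: "'v::real_vector set \<Rightarrow> ('v \<Rightarrow> 'v \<Rightarrow> real) \<Rightarrow> bool" where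
  "sym_bilinear_on W B \<longleftrightarrow>
     (\<forall>x\<in>W. \<forall>y\<in>W. B x y = B y x) \<and>
     (\<forall>x\<in>W. \<forall>y\<in>W. \<forall>z\<in>W. B (x + y) z = B x z + B y z) \<and>
     (\<forall>c. \<forall>x\<in>W. \<forall>z\<in>W. B (c *\<^sub>R x) z = c * B x z)"

definition nondegenerate_on :: "'v::real_vector set \<Rightarrow> ('v \<Rightarrow> 'v \<Rightarrow> real) \<Rightarrow> bool" where
  "nondegenerate_on W B \<longleftrightarrow> (\<forall>x\<in>W. (\<forall>y\<in>W. B x y = 0) \<longrightarrow> x = 0)"

definition n_plus :: "('v::euclidean_space \<Rightarrow> 'v \<Rightarrow> real) \<Rightarrow> 'v set \<Rightarrow> nat" where
  "n_plus B W = Max {dim U | U. subspace U \<and> U \<subseteq> W \<and> (\<forall>x\<in>U. x \<noteq> 0 \<longrightarrow> B x x > 0)}"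

definition n_minus :: "('v::euclidean_space \<Rightarrow> 'v \<Rightarrow> real) \<Rightarrow> 'v set \<Rightarrow> nat" where
  "n_minus B W = Max {dim U | U. subspace U \<and> U \<subseteq> W \<and> (\<forall>x\<in>U. x \<noteq> 0 \<longrightarrow> B x x < 0)}"

definition form_signature :: "('v::euclidean_space \<Rightarrow> 'v \<Rightarrow> real) \<Rightarrow> 'v set \<Rightarrow> int" where
  "form_signature B W = int (n_plus B W) - int (n_minus B W)"

definition form_perp :: "('v \<Rightarrow> 'v \<Rightarrow> real) \<Rightarrow> 'v set \<Rightarrow> 'v set" where
  "form_perp B W = {y. \<forall>x\<in>W. B x y = 0}"

section \<open>Regularity\<close>

text \<open>At a boundary point of a closed interval the expansion is only required on the side
  belonging to the interval; this is the same as having a real analytic extension to an open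
  neighbourhood.\<close>

definition real_analytic_on :: "(real \<Rightarrow> 'b::real_normed_vector) \<Rightarrow> real set \<Rightarrow> bool" where
  "real_analytic_on f I \<longleftrightarrow>
     (\<forall>t0\<in>I. \<exists>r>0. \<exists>A :: nat \<Rightarrow> 'b.
        \<forall>t\<in>I. \<bar>t - t0\<bar> < r \<longrightarrow> (\<lambda>k. (t - t0) ^ k *\<^sub>R A k) sums f t)"

definition smooth_real_on :: "(real \<Rightarrow> real) \<Rightarrow> real set \<Rightarrow> bool" where
  "smooth_real_on f I \<longleftrightarrow>
     (\<exists>D :: nat \<Rightarrow> real \<Rightarrow> real.
        (\<forall>t\<in>I. D 0 t = f t) \<and>
        (\<forall>k. \<forall>t\<in>I. (D k has_real_derivative D (Suc k) t) (at t within I)))"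

section \<open>The Lagrangian Grassmannian\<close>

definition lagrangian :: "('v::euclidean_space \<Rightarrow> 'v \<Rightarrow> real) \<Rightarrow> 'v set \<Rightarrow> bool" where
  "lagrangian \<omega> L \<longleftrightarrow>
     subspace L \<and> (\<forall>x\<in>L. \<forall>y\<in>L. \<omega> x y = 0) \<and> 2 * dim L = DIM('v)"

text \<open>For subspaces of half dimension, having intersection \<open>{0}\<close> means being complementary.\<close>

definition lag_transverse :: "('v::euclidean_space \<Rightarrow> 'v \<Rightarrow> real) \<Rightarrow> 'v set \<Rightarrow> 'v set \<Rightarrow> bool" where
  "lag_transverse \<omega> L L1 \<longleftrightarrow> lagrangian \<omega> L \<and> lagrangian \<omega> L1 \<and> L \<inter> L1 = {0}"

text \<open>If \<open>W\<close> and \<open>L\<close> are both complementary to \<open>L1\<close>, then \<open>W\<close> is the graph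
  \<open>{u + T u | u. u \<in> L}\<close> of the linear map \<open>T = graph_map L1 W\<close> from \<open>L\<close> to \<open>L1\<close>.\<close>

definition graph_map :: "'v::real_vector set \<Rightarrow> 'v set \<Rightarrow> 'v \<Rightarrow> 'v" where
  "graph_map L1 W u = (THE y. y \<in> L1 \<and> u + y \<in> W)"

definition lag_chart ::
  "('v::euclidean_space \<Rightarrow> 'v \<Rightarrow> real) \<Rightarrow> 'v set \<Rightarrow> 'v set \<Rightarrow> 'v set \<Rightarrow> ('v \<times> 'v \<Rightarrow> real)" where
  "lag_chart \<omega> L L1 W = (\<lambda>(u, v)\<in>L \<times> L. \<omega> (graph_map L1 W u) v)"

text \<open>The vector space \<open>B_sym(L)\<close>, its elements being encoded as extensional functions on
  \<open>L \<times> L\<close>. On this finite-dimensional space the topology of pointwise convergence is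
  the usual vector space topology.\<close>

definition bsym_topology :: "'v::euclidean_space set \<Rightarrow> ('v \<times> 'v \<Rightarrow> real) topology" where
  "bsym_topology L =
     subtopology (powertop_real (L \<times> L))
       {restrict (\<lambda>(u, v). B u v) (L \<times> L) | B. sym_bilinear_on L B}"

text \<open>The manifold topology: the preimages of open sets under the charts are the basic open sets.
  The domain of the chart given by \<open>L, L1\<close> consists of the Lagrangians transverse to \<open>L1\<close>.\<close>

definition lag_topology :: "('v::euclidean_space \<Rightarrow> 'v \<Rightarrow> real) \<Rightarrow> 'v set topology" where
  "lag_topology \<omega> =
     topology_generated_by
       {{W. lag_transverse \<omega> W L1 \<and> lag_chart \<omega> L L1 W \<in> U} | L L1 U.
          lag_transverse \<omega> L L1 \<and> openin (bsym_topology L) U}"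

definition lag_stratum ::
  "('v::euclidean_space \<Rightarrow> 'v \<Rightarrow> real) \<Rightarrow> 'v set \<Rightarrow> nat \<Rightarrow> 'v set set" where
  "lag_stratum \<omega> L0 k = {L. lagrangian \<omega> L \<and> dim (L \<inter> L0) = k}"

definition lag_stratum_ge1 ::
  "('v::euclidean_space \<Rightarrow> 'v \<Rightarrow> real) \<Rightarrow> 'v set \<Rightarrow> 'v set set" where
  "lag_stratum_ge1 \<omega> L0 = (\<Union>k\<in>{1..}. lag_stratum \<omega> L0 k)"

text \<open>Evaluations at pairs \<open>(u, v)\<close> are linear functionals separating points of the
  finite-dimensional space \<open>B_sym(L)\<close>, so smoothness in a chart and derivatives
  in a chart can be tested on them.\<close>

definition lag_smooth_curve ::
  "('v::euclidean_space \<Rightarrow> 'v \<Rightarrow> real) \<Rightarrow> real \<Rightarrow> real \<Rightarrow> (real \<Rightarrow> 'v set) \<Rightarrow> bool" where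
  "lag_smooth_curve \<omega> c d \<gamma> \<longleftrightarrow>
     continuous_map (top_of_set {c..d}) (lag_topology \<omega>) \<gamma> \<and>
     (\<forall>L L1. lag_transverse \<omega> L L1 \<longrightarrow>
        (\<forall>u\<in>L. \<forall>v\<in>L.
           smooth_real_on (\<lambda>t. lag_chart \<omega> L L1 (\<gamma> t) (u, v))
             {t\<in>{c..d}. lag_transverse \<omega> (\<gamma> t) L1}))"

text \<open>\<open>B\<close> is the symmetric bilinear form on \<open>\<gamma> t\<close> corresponding to the
  tangent vector of \<open>\<gamma>\<close> at \<open>t\<close>. It does not depend on the complement \<open>L1\<close>.\<close>

definition lag_tangent ::
  "('v::euclidean_space \<Rightarrow> 'v \<Rightarrow> real) \<Rightarrow> real \<Rightarrow> real \<Rightarrow> (real \<Rightarrow> 'v set) \<Rightarrow> real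
     \<Rightarrow> ('v \<Rightarrow> 'v \<Rightarrow> real) \<Rightarrow> bool" where
  "lag_tangent \<omega> c d \<gamma> t B \<longleftrightarrow>
     (\<forall>L1. lag_transverse \<omega> (\<gamma> t) L1 \<longrightarrow>
        (\<forall>u\<in>\<gamma> t. \<forall>v\<in>\<gamma> t.
           ((\<lambda>s. lag_chart \<omega> (\<gamma> t) L1 (\<gamma> s) (u, v)) has_real_derivative B u v)
             (at t within {c..d})))"

section \<open>The Maslov index\<close>

text \<open>Transversality of the crossing is implied by positivity, the intersection being a line.\<close>

definition positive_crossing_curve ::
  "('v::euclidean_space \<Rightarrow> 'v \<Rightarrow> real) \<Rightarrow> 'v set \<Rightarrow> real \<Rightarrow> real \<Rightarrow> (real \<Rightarrow> 'v set) \<Rightarrow> bool" where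
  "positive_crossing_curve \<omega> L0 c d \<gamma> \<longleftrightarrow>
     c < d \<and> lag_smooth_curve \<omega> c d \<gamma> \<and>
     \<gamma> c \<notin> lag_stratum_ge1 \<omega> L0 \<and> \<gamma> d \<notin> lag_stratum_ge1 \<omega> L0 \<and>
     (\<exists>t\<in>{c..d}.
        (\<forall>s\<in>{c..d}. \<gamma> s \<in> lag_stratum_ge1 \<omega> L0 \<longleftrightarrow> s = t) \<and>
        \<gamma> t \<in> lag_stratum \<omega> L0 1 \<and>
        (\<exists>B. lag_tangent \<omega> c d \<gamma> t B \<and> (\<forall>u\<in>\<gamma> t \<inter> L0. u \<noteq> 0 \<longrightarrow> B u u > 0)))"

abbreviation maslov_homology_group ::
  "('v::euclidean_space \<Rightarrow> 'v \<Rightarrow> real) \<Rightarrow> 'v set \<Rightarrow> 'v set chain set monoid" where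
  "maslov_homology_group \<omega> L0 \<equiv>
     relative_homology_group 1 (lag_topology \<omega>) (lag_stratum \<omega> L0 0)"

text \<open>The singular 1-simplex running through \<open>\<gamma>\<close> from \<open>c\<close> to \<open>d\<close>;
  \<open>x 1\<close> is the second barycentric coordinate.\<close>

definition curve_simplex :: "real \<Rightarrow> real \<Rightarrow> (real \<Rightarrow> 'a) \<Rightarrow> (nat \<Rightarrow> real) \<Rightarrow> 'a" where
  "curve_simplex c d \<gamma> = (\<lambda>x\<in>standard_simplex 1. \<gamma> (c + x 1 * (d - c)))"

definition curve_class ::
  "('v::euclidean_space \<Rightarrow> 'v \<Rightarrow> real) \<Rightarrow> 'v set \<Rightarrow> real \<Rightarrow> real \<Rightarrow> (real \<Rightarrow> 'v set)
     \<Rightarrow> 'v set chain set" where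
  "curve_class \<omega> L0 c d \<gamma> =
     homologous_rel_set 1 (lag_topology \<omega>) (lag_stratum \<omega> L0 0)
       (frag_of (curve_simplex c d \<gamma>))"

text \<open>Extensionality only serves to make the isomorphism unique as a total function.\<close>

definition is_maslov_iso ::
  "('v::euclidean_space \<Rightarrow> 'v \<Rightarrow> real) \<Rightarrow> 'v set \<Rightarrow> ('v set chain set \<Rightarrow> int) \<Rightarrow> bool" where
  "is_maslov_iso \<omega> L0 \<mu> \<longleftrightarrow>
     \<mu> \<in> iso (maslov_homology_group \<omega> L0) integer_group \<and>
     \<mu> \<in> extensional (carrier (maslov_homology_group \<omega> L0)) \<and>
     (\<forall>c d \<gamma>. positive_crossing_curve \<omega> L0 c d \<gamma> \<longrightarrow> \<mu> (curve_class \<omega> L0 c d \<gamma>) = 1)"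

definition maslov_iso ::
  "('v::euclidean_space \<Rightarrow> 'v \<Rightarrow> real) \<Rightarrow> 'v set \<Rightarrow> 'v set chain set \<Rightarrow> int" where
  "maslov_iso \<omega> L0 = (THE \<mu>. is_maslov_iso \<omega> L0 \<mu>)"

text \<open>Maslov index of a continuous curve on \<open>[a,b]\<close> whose intersections with
  \<open>lag_stratum_ge1 \<omega> L0\<close> in the open interval stay away from \<open>a\<close> and \<open>b\<close>.
  The endpoints of the subinterval must not be intersections, in order that the
  restricted curve be a relative cycle.\<close>

definition curve_maslov_index ::
  "('v::euclidean_space \<Rightarrow> 'v \<Rightarrow> real) \<Rightarrow> 'v set \<Rightarrow> real \<Rightarrow> real \<Rightarrow> (real \<Rightarrow> 'v set) \<Rightarrow> int" where
  "curve_maslov_index \<omega> L0 a b \<gamma> =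
     (THE k. \<exists>c d. a < c \<and> c < d \<and> d < b \<and>
        {t\<in>{a<..<b}. \<gamma> t \<in> lag_stratum_ge1 \<omega> L0} \<subseteq> {c..d} \<and>
        \<gamma> c \<notin> lag_stratum_ge1 \<omega> L0 \<and> \<gamma> d \<notin> lag_stratum_ge1 \<omega> L0 \<and>
        k = maslov_iso \<omega> L0 (curve_class \<omega> L0 c d \<gamma>))"

section \<open>Admissible quadruples\<close>

text \<open>Only the values of \<open>S\<close> on \<open>P \<times> P\<close> are relevant.\<close>

definition admissible_quadruple ::
  "real \<Rightarrow> real \<Rightarrow> (real^'n \<Rightarrow> real^'n \<Rightarrow> real) \<Rightarrow> (real \<Rightarrow> (real^'n) \<Rightarrow>\<^sub>L (real^'n))
     \<Rightarrow> (real^'n) set \<Rightarrow> (real^'n \<Rightarrow> real^'n \<Rightarrow> real) \<Rightarrow> bool" where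
  "admissible_quadruple a b g R P S \<longleftrightarrow>
     sym_bilinear_on UNIV g \<and> nondegenerate_on UNIV g \<and>
     continuous_on {a..b} R \<and>
     (\<forall>t\<in>{a..b}. \<forall>x y. g (blinfun_apply (R t) x) y = g x (blinfun_apply (R t) y)) \<and>
     subspace P \<and> nondegenerate_on P g \<and>
     sym_bilinear_on P S"

definition form_operator ::
  "('v \<Rightarrow> 'v \<Rightarrow> real) \<Rightarrow> 'v set \<Rightarrow> ('v \<Rightarrow> 'v \<Rightarrow> real) \<Rightarrow> 'v \<Rightarrow> 'v" where
  "form_operator g P S v = (THE z. z \<in> P \<and> (\<forall>w\<in>P. S v w = g z w))"

definition ode_solution ::
  "real \<Rightarrow> real \<Rightarrow> (real \<Rightarrow> (real^'n) \<Rightarrow>\<^sub>L (real^'n)) \<Rightarrow> (real \<Rightarrow> real^'n) \<Rightarrow> (real \<Rightarrow> real^'n)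
     \<Rightarrow> bool" where
  "ode_solution a b R J J' \<longleftrightarrow>
     (\<forall>t\<in>{a..b}. (J has_vector_derivative J' t) (at t within {a..b}) \<and>
        (J' has_vector_derivative blinfun_apply (R t) (J t)) (at t within {a..b}))"

definition initial_space ::
  "(real^'n \<Rightarrow> real^'n \<Rightarrow> real) \<Rightarrow> (real^'n) set \<Rightarrow> (real^'n \<Rightarrow> real^'n \<Rightarrow> real)
     \<Rightarrow> ((real^'n) \<times> (real^'n)) set" where
  "initial_space g P S = {(x, y). x \<in> P \<and> y + form_operator g P S x \<in> form_perp g P}"

definition PS_solution ::
  "real \<Rightarrow> real \<Rightarrow> (real^'n \<Rightarrow> real^'n \<Rightarrow> real) \<Rightarrow> (real \<Rightarrow> (real^'n) \<Rightarrow>\<^sub>L (real^'n))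
     \<Rightarrow> (real^'n) set \<Rightarrow> (real^'n \<Rightarrow> real^'n \<Rightarrow> real) \<Rightarrow> (real \<Rightarrow> real^'n) \<Rightarrow> bool" where
  "PS_solution a b g R P S J \<longleftrightarrow>
     (\<exists>J'. ode_solution a b R J J' \<and> (J a, J' a) \<in> initial_space g P S)"

definition solution_values ::
  "real \<Rightarrow> real \<Rightarrow> (real^'n \<Rightarrow> real^'n \<Rightarrow> real) \<Rightarrow> (real \<Rightarrow> (real^'n) \<Rightarrow>\<^sub>L (real^'n))
     \<Rightarrow> (real^'n) set \<Rightarrow> (real^'n \<Rightarrow> real^'n \<Rightarrow> real) \<Rightarrow> real \<Rightarrow> (real^'n) set" where
  "solution_values a b g R P S t = {J t | J. PS_solution a b g R P S J}"

definition focal_instant ::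
  "real \<Rightarrow> real \<Rightarrow> (real^'n \<Rightarrow> real^'n \<Rightarrow> real) \<Rightarrow> (real \<Rightarrow> (real^'n) \<Rightarrow>\<^sub>L (real^'n))
     \<Rightarrow> (real^'n) set \<Rightarrow> (real^'n \<Rightarrow> real^'n \<Rightarrow> real) \<Rightarrow> real \<Rightarrow> bool" where
  "focal_instant a b g R P S t \<longleftrightarrow>
     a < t \<and> t \<le> b \<and>
     (\<exists>J. PS_solution a b g R P S J \<and> (\<exists>s\<in>{a..b}. J s \<noteq> 0) \<and> J t = 0)"

definition focal_signature ::
  "real \<Rightarrow> real \<Rightarrow> (real^'n \<Rightarrow> real^'n \<Rightarrow> real) \<Rightarrow> (real \<Rightarrow> (real^'n) \<Rightarrow>\<^sub>L (real^'n))
     \<Rightarrow> (real^'n) set \<Rightarrow> (real^'n \<Rightarrow> real^'n \<Rightarrow> real) \<Rightarrow> real \<Rightarrow> int" where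
  "focal_signature a b g R P S t =
     form_signature g (form_perp g (solution_values a b g R P S t))"

text \<open>Meaningful only when there are finitely many focal instants.\<close>

definition focal_index ::
  "real \<Rightarrow> real \<Rightarrow> (real^'n \<Rightarrow> real^'n \<Rightarrow> real) \<Rightarrow> (real \<Rightarrow> (real^'n) \<Rightarrow>\<^sub>L (real^'n))
     \<Rightarrow> (real^'n) set \<Rightarrow> (real^'n \<Rightarrow> real^'n \<Rightarrow> real) \<Rightarrow> int" where
  "focal_index a b g R P S =
     (\<Sum>t\<in>{t. focal_instant a b g R P S t}. focal_signature a b g R P S t)"

definition phase_symplectic ::
  "(real^'n \<Rightarrow> real^'n \<Rightarrow> real) \<Rightarrow> (real^'n) \<times> (real^'n) \<Rightarrow> (real^'n) \<times> (real^'n) \<Rightarrow> real" where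
  "phase_symplectic g p q = g (fst p) (snd q) - g (snd p) (fst q)"

definition phase_flow ::
  "real \<Rightarrow> real \<Rightarrow> (real \<Rightarrow> (real^'n) \<Rightarrow>\<^sub>L (real^'n)) \<Rightarrow> real
     \<Rightarrow> (real^'n) \<times> (real^'n) \<Rightarrow> (real^'n) \<times> (real^'n)" where
  "phase_flow a b R t p =
     (THE q. \<exists>J J'. ode_solution a b R J J' \<and> p = (J a, J' a) \<and> q = (J t, J' t))"

definition quadruple_curve ::
  "real \<Rightarrow> real \<Rightarrow> (real^'n \<Rightarrow> real^'n \<Rightarrow> real) \<Rightarrow> (real \<Rightarrow> (real^'n) \<Rightarrow>\<^sub>L (real^'n))
     \<Rightarrow> (real^'n) set \<Rightarrow> (real^'n \<Rightarrow> real^'n \<Rightarrow> real) \<Rightarrow> real \<Rightarrow> ((real^'n) \<times> (real^'n)) set" where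
  "quadruple_curve a b g R P S t = phase_flow a b R t ` initial_space g P S"

text \<open>Meaningful only when \<open>b\<close> is not a focal instant.\<close>

definition maslov_index ::
  "real \<Rightarrow> real \<Rightarrow> (real^'n \<Rightarrow> real^'n \<Rightarrow> real) \<Rightarrow> (real \<Rightarrow> (real^'n) \<Rightarrow>\<^sub>L (real^'n))
     \<Rightarrow> (real^'n) set \<Rightarrow> (real^'n \<Rightarrow> real^'n \<Rightarrow> real) \<Rightarrow> int" where
  "maslov_index a b g R P S =
     curve_maslov_index (phase_symplectic g) ({0} \<times> UNIV) a b (quadruple_curve a b g R P S)"

end

theory Submission
  imports Defs "HOL-Complex_Analysis.Cauchy_Integral_Formula"
begin

text \<open>The example lives on \<open>[0, 5/4]\<close> with the metric \<open>2 * x1 * x2\<close>. The solutions vanishing at \<open>0\<close> are spanned by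
  \<open>J1 = u (1, 3 (1 - s^2)^2)\<close> and \<open>J2 = u (s^2, (1 - s^2)^2 (2 + s^2))\<close>, where \<open>u = s phi s\<close> is
  positive on \<open>(0, 5/4]\<close>. Their determinant is \<open>2 u^2 (1 - s^2)^3\<close>, so \<open>1\<close> is the only focal instant. There the positions
  fill a null line, which is its own orthogonal complement; the focal signature is therefore \<open>0\<close>. For a nondegenerate
  crossing the Maslov index would have to agree with it. Here, however, the velocities lie in the same null line, the crossing
  is tangential, and the determinant still changes sign because its zero has order three. In a chart around the crossing
  the curve is a family of symmetric matrices with one eigenvalue near \<open>-1\<close> and another
  passing from positive to negative; this contributes \<open>-1\<close>.

  To turn this picture into a value of the Maslov isomorphism, the relative homology group of the Lagrangian Grassmannian modulo the
  Lagrangians transverse to \<open>L0\<close> is computed by hand. The charts \<open>chartL c\<close> cover the Grassmannian, their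
  coordinates are symmetric matrices, and \<open>L0\<close> sits at the origin, so that transversality to \<open>L0\<close> means
  nonzero determinant. Convexity of the space of matrices shows that the class of a path in a chart with nondegenerate end points
  is the difference of the numbers of positive eigenvalues, in units of one class \<open>gen\<close> (\<open>hom_chart_path\<close>). Cutting
  arbitrary paths into pieces inside charts, and joining the intermediate points to nondegenerate matrices, gives that
  \<open>gen\<close> generates the group (\<open>relcycle_multiple_of_gen\<close>). It has infinite order because the
  square of a complex determinant maps the Grassmannian to the circle and winds around it along \<open>gen\<close>
  (\<open>gen_infinite_order\<close>). A positive crossing makes one eigenvalue positive and represents
  \<open>gen\<close> (\<open>positive_crossing_class\<close>). Hence the Maslov isomorphism exists, is unique and counts multiples of
  \<open>gen\<close> (\<open>maslov_iso_value\<close>).\<close>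

section \<open>Relative one-chains along segments of a convex set\<close>

text \<open>The affine singular simplex over a segment, followed by a map of the ambient vector space.
  With \<open>f\<close> defined on a convex set, every relation between such paths that is needed
  below comes from a triangle in that set.\<close>

definition simplex_path :: "('e::real_vector \<Rightarrow> 'a) \<Rightarrow> 'e \<Rightarrow> 'e \<Rightarrow> (nat \<Rightarrow> real) \<Rightarrow> 'a" where
  "simplex_path f p q = (\<lambda>x\<in>standard_simplex 1. f (x 0 *\<^sub>R p + x 1 *\<^sub>R q))"

lemma standard_simplex_1_iff:
  "x \<in> standard_simplex 1 \<longleftrightarrow> 0 \<le> x 0 \<and> 0 \<le> x 1 \<and> x 0 + x 1 = 1 \<and> (\<forall>i>1. x i = 0)"
proof -
  have "x i \<in> {0..1}" if "0 \<le> x 0" "0 \<le> x 1" "x 0 + x 1 = 1" "\<forall>i>1. x i = 0" for i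
    using that by (cases "i = 0 \<or> i = 1") auto
  then show ?thesis by (auto simp: standard_simplex_def)
qed

lemmas standard_simplex_Suc_0_iff = standard_simplex_1_iff[unfolded One_nat_def]

lemma standard_simplex_2_iff:
  "x \<in> standard_simplex 2 \<longleftrightarrow>
     0 \<le> x 0 \<and> 0 \<le> x 1 \<and> 0 \<le> x 2 \<and> x 0 + x 1 + x 2 = 1 \<and> (\<forall>i>2. x i = 0)"
proof -
  have "x i \<in> {0..1}" if "0 \<le> x 0" "0 \<le> x 1" "0 \<le> x 2" "x 0 + x 1 + x 2 = 1" "\<forall>i>2. x i = 0" for i
    using that by (cases "i = 0 \<or> i = 1 \<or> i = 2") auto
  then show ?thesis by (auto simp: standard_simplex_def numeral_2_eq_2)
qed

lemma curve_simplex_eq: "curve_simplex c d \<gamma> = simplex_path \<gamma> c d"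
proof -
  have "c + x 1 * (d - c) = x 0 * c + x 1 * d" if "x \<in> standard_simplex 1" for x
  proof -
    have "x 0 = 1 - x 1" using that by (auto simp: standard_simplex_Suc_0_iff)
    then have "x 0 * c + x 1 * d = (1 - x 1) * c + x 1 * d" by simp
    also have "\<dots> = c + x 1 * (d - c)" by (simp add: left_diff_distrib right_diff_distrib)
    finally show ?thesis by simp
  qed
  then show ?thesis by (auto simp: curve_simplex_def simplex_path_def restrict_def fun_eq_iff)
qed

text \<open>Paths over different segments, even in different vector spaces, are equal as simplices as soon as their
  parametrisations agree: this is how a path is read in a new coordinate system.\<close>

lemma simplex_path_eqI:
  assumes "\<And>t. t \<in> {0..1} \<Longrightarrow> f ((1 - t) *\<^sub>R p + t *\<^sub>R q) = f' ((1 - t) *\<^sub>R p' + t *\<^sub>R q')"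
  shows "simplex_path f p q = simplex_path f' p' q'"
proof
  fix x :: "nat \<Rightarrow> real"
  have "f (x 0 *\<^sub>R p + x 1 *\<^sub>R q) = f' (x 0 *\<^sub>R p' + x 1 *\<^sub>R q')" if "x \<in> standard_simplex 1"
  proof -
    have "x 0 = 1 - x 1" "x 1 \<in> {0..1}" using that by (auto simp: standard_simplex_Suc_0_iff)
    then show ?thesis using assms[of "x 1"] by simp
  qed
  then show "simplex_path f p q x = simplex_path f' p' q' x"
    by (simp add: simplex_path_def)
qed

lemma simplex_path_image: "simplex_path f p q ` standard_simplex 1 = f ` closed_segment p q"
proof -
  have "(\<lambda>x. x 0 *\<^sub>R p + x 1 *\<^sub>R q) ` standard_simplex 1 = closed_segment p q"
  proof (intro equalityI subsetI)
    fix z assume "z \<in> closed_segment p q"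
    then obtain t where t: "z = (1 - t) *\<^sub>R p + t *\<^sub>R q" "0 \<le> t" "t \<le> 1"
      by (auto simp: closed_segment_def)
    define x :: "nat \<Rightarrow> real" where "x = (\<lambda>i. if i = 0 then 1 - t else if i = 1 then t else 0)"
    have "x \<in> standard_simplex 1" unfolding standard_simplex_1_iff using t by (simp add: x_def)
    moreover have "z = x 0 *\<^sub>R p + x 1 *\<^sub>R q" by (simp add: x_def t)
    ultimately show "z \<in> (\<lambda>x. x 0 *\<^sub>R p + x 1 *\<^sub>R q) ` standard_simplex 1" by blast
  next
    fix z assume "z \<in> (\<lambda>x. x 0 *\<^sub>R p + x 1 *\<^sub>R q) ` standard_simplex 1"
    then obtain x where x: "x \<in> standard_simplex 1" "z = x 0 *\<^sub>R p + x 1 *\<^sub>R q" by blast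
    then have "x 0 = 1 - x 1" "x 1 \<in> {0..1}" by (auto simp: standard_simplex_Suc_0_iff)
    then show "z \<in> closed_segment p q" using x(2) unfolding closed_segment_def by auto
  qed
  then show ?thesis
    unfolding simplex_path_def by (metis (no_types, lifting) image_cong image_image restrict_apply)
qed

lemma continuous_map_from_simplex:
  fixes g :: "(nat \<Rightarrow> real) \<Rightarrow> 'e::real_normed_vector"
  assumes f: "continuous_map (top_of_set K) X f"
    and g: "continuous_map (powertop_real UNIV) euclidean g" "g ` standard_simplex n \<subseteq> K"
  shows "singular_simplex n X (\<lambda>x\<in>standard_simplex n. f (g x))"
proof -
  have "continuous_map (subtopology (powertop_real UNIV) (standard_simplex n)) (top_of_set K) g"
    using g by (auto simp: continuous_map_in_subtopology intro: continuous_map_from_subtopology)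
  then have "continuous_map (subtopology (powertop_real UNIV) (standard_simplex n)) X (f \<circ> g)"
    using f by (rule continuous_map_compose)
  then show ?thesis
    by (auto simp: singular_simplex_def o_def)
qed

lemma continuous_map_real_scaleR:
  fixes p :: "'e::real_normed_vector"
  shows "continuous_map (powertop_real UNIV) euclidean (\<lambda>x::nat \<Rightarrow> real. x i *\<^sub>R p)"
proof -
  have "continuous_map euclideanreal euclidean (\<lambda>t. t *\<^sub>R p)"
    by (simp add: continuous_intros)
  from continuous_map_compose[OF continuous_map_product_projection[of i UNIV "\<lambda>_. euclideanreal"] this]
  show ?thesis by (simp add: o_def)
qed

lemma continuous_map_add_vec:
  fixes f g :: "'x \<Rightarrow> 'e::real_normed_vector"
  assumes "continuous_map X euclidean f" "continuous_map X euclidean g"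
  shows "continuous_map X euclidean (\<lambda>x. f x + g x)"
  using assms by (auto simp: continuous_map_atin intro: tendsto_add)

lemma singular_simplex_path:
  fixes f :: "'e::real_normed_vector \<Rightarrow> 'a"
  assumes "continuous_map (top_of_set K) X f" "convex K" "p \<in> K" "q \<in> K"
  shows "singular_simplex 1 X (simplex_path f p q)"
  unfolding simplex_path_def
proof (rule continuous_map_from_simplex[OF assms(1)])
  show "continuous_map (powertop_real UNIV) euclidean (\<lambda>x::nat\<Rightarrow>real. x 0 *\<^sub>R p + x 1 *\<^sub>R q)"
    by (intro continuous_map_add_vec continuous_map_real_scaleR)
  show "(\<lambda>x. x 0 *\<^sub>R p + x 1 *\<^sub>R q) ` standard_simplex 1 \<subseteq> K"
    using assms by (auto simp: standard_simplex_Suc_0_iff intro!: convexD)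
qed

text \<open>The map \<open>f\<close> extends the three sides to a singular 2-simplex, whose boundary is
  the asserted relation. Concatenation, reversal and homotopies of paths are all instances.\<close>

lemma chain_triangle:
  fixes f :: "'e::real_normed_vector \<Rightarrow> 'a"
  assumes f: "continuous_map (top_of_set K) X f" and K: "convex K" "p \<in> K" "q \<in> K" "r \<in> K"
  shows "homologous_rel 1 X S
    (frag_of (simplex_path f p q) + frag_of (simplex_path f q r)) (frag_of (simplex_path f p r))"
proof -
  define g :: "(nat \<Rightarrow> real) \<Rightarrow> 'e" where "g x = x 0 *\<^sub>R p + x 1 *\<^sub>R q + x 2 *\<^sub>R r" for x
  define \<tau> where "\<tau> = (\<lambda>x\<in>standard_simplex 2. f (g x))"
  have \<tau>: "singular_simplex 2 X \<tau>"
    unfolding \<tau>_def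
  proof (rule continuous_map_from_simplex[OF f])
    show "continuous_map (powertop_real UNIV) euclidean g"
      unfolding g_def by (intro continuous_map_add_vec continuous_map_real_scaleR)
    show "g ` standard_simplex 2 \<subseteq> K"
    proof clarify
      fix x :: "nat \<Rightarrow> real" assume x: "x \<in> standard_simplex 2"
      have "(\<Sum>i\<in>{0,1,2::nat}. x i *\<^sub>R (if i = 0 then p else if i = 1 then q else r)) \<in> K"
        using x K by (intro convex_sum) (auto simp: standard_simplex_2_iff)
      then show "g x \<in> K" by (simp add: g_def add.assoc)
    qed
  qed
  have face: "singular_face 2 k \<tau> = (\<lambda>x\<in>standard_simplex 1. f (g (simplical_face k x)))" if "k \<le> 2" for k
    using that simplical_face_in_standard_simplex[of 2 k]
    by (auto simp: singular_face_def \<tau>_def fun_eq_iff restrict_def)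
  have "chain_boundary 2 (frag_of \<tau>) = frag_of (singular_face 2 0 \<tau>) - frag_of (singular_face 2 1 \<tau>)
      + frag_of (singular_face 2 2 \<tau>)"
    by (simp add: chain_boundary_of numeral_2_eq_2)
  also have "singular_face 2 0 \<tau> = simplex_path f q r"
    unfolding face[OF le0] by (simp add: simplex_path_def g_def simplical_face_def)
  also have "singular_face 2 1 \<tau> = simplex_path f p r"
    by (subst face) (simp_all add: simplex_path_def g_def simplical_face_def)
  also have "singular_face 2 2 \<tau> = simplex_path f p q"
    by (subst face) (simp_all add: simplex_path_def g_def simplical_face_def)
  finally have eq: "chain_boundary 2 (frag_of \<tau>) =
      frag_of (simplex_path f p q) + frag_of (simplex_path f q r) - frag_of (simplex_path f p r)"
    by simp
  show ?thesis
    unfolding homologous_rel_def singular_relboundary_alt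
    by (rule exI[of _ "frag_of \<tau>"], rule exI[of _ 0])
      (use \<tau> eq in \<open>simp add: singular_chain_of numeral_2_eq_2\<close>)
qed

lemma chain_constant:
  fixes f :: "'e::real_normed_vector \<Rightarrow> 'a"
  assumes f: "continuous_map (top_of_set K) X f" and K: "convex K" "p \<in> K" "q \<in> K"
    and const: "\<And>x. x \<in> closed_segment p q \<Longrightarrow> f x = f p"
  shows "homologous_rel 1 X S (frag_of (simplex_path f p q)) 0"
proof -
  have eq: "simplex_path f p q = simplex_path f p p"
  proof (rule simplex_path_eqI)
    fix t :: real assume "t \<in> {0..1}"
    then have "(1 - t) *\<^sub>R p + t *\<^sub>R q \<in> closed_segment p q"
      by (auto simp: closed_segment_def)
    moreover have "(1 - t) *\<^sub>R p + t *\<^sub>R p = p"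
      by (metis diff_add_cancel scaleR_left_distrib scaleR_one)
    ultimately show "f ((1 - t) *\<^sub>R p + t *\<^sub>R q) = f ((1 - t) *\<^sub>R p + t *\<^sub>R p)"
      by (metis const)
  qed
  have "homologous_rel 1 X S (frag_of (simplex_path f p p) + frag_of (simplex_path f p p) - frag_of (simplex_path f p p))
     (frag_of (simplex_path f p p) - frag_of (simplex_path f p p))"
    by (rule homologous_rel_diff[OF chain_triangle[OF f K(1)] homologous_rel_refl]) (use K in auto)
  then show ?thesis by (simp add: eq)
qed

lemma chain_in_subspace:
  fixes f :: "'e::real_normed_vector \<Rightarrow> 'a"
  assumes f: "continuous_map (top_of_set K) X f" and K: "convex K" "p \<in> K" "q \<in> K"
    and S: "f ` closed_segment p q \<subseteq> S"
  shows "homologous_rel 1 X S (frag_of (simplex_path f p q)) 0"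
proof -
  have "singular_chain 1 (subtopology X S) (frag_of (simplex_path f p q))"
    using singular_simplex_path[OF f K] S
    by (simp add: singular_chain_of singular_simplex_subtopology simplex_path_image[unfolded One_nat_def])
  then show ?thesis
    unfolding homologous_rel_def by (simp add: singular_chain_imp_relboundary)
qed

text \<open>A homotopy whose end points move inside the subspace does not change the relative class:
  both diagonal halves of the square compare a side with the same diagonal.\<close>

lemma chain_square:
  fixes f :: "'e::real_normed_vector \<Rightarrow> 'a"
  assumes f: "continuous_map (top_of_set K) X f"
    and K: "convex K" "p \<in> K" "q \<in> K" "p' \<in> K" "q' \<in> K"
    and sides: "homologous_rel 1 X S (frag_of (simplex_path f p p')) 0"
      "homologous_rel 1 X S (frag_of (simplex_path f q q')) 0"
  shows "homologous_rel 1 X S (frag_of (simplex_path f p q)) (frag_of (simplex_path f p' q'))"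
proof -
  let ?c = "\<lambda>p q. frag_of (simplex_path f p q)"
  have 1: "homologous_rel 1 X S (?c p q + ?c q q' - ?c q q') (?c p q' - 0)"
    by (rule homologous_rel_diff[OF chain_triangle[OF f K(1)] sides(2)]) (use K in auto)
  have 2: "homologous_rel 1 X S (?c p p' + ?c p' q' - ?c p p') (?c p q' - 0)"
    by (rule homologous_rel_diff[OF chain_triangle[OF f K(1)] sides(1)]) (use K in auto)
  have "homologous_rel 1 X S (?c p q) (?c p q')" "homologous_rel 1 X S (?c p' q') (?c p q')"
    using 1 2 by (simp_all only: add_diff_cancel_left' add_diff_cancel_right' diff_zero)
  then show ?thesis by (meson homologous_rel_sym homologous_rel_trans)
qed

section \<open>Symplectic linear algebra in dimension four\<close>

type_synonym phase = "(real^2) \<times> (real^2)"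

text \<open>The metric of the example, a hyperbolic plane with null basis vectors.\<close>

definition hyp :: "real^2 \<Rightarrow> real^2 \<Rightarrow> real" where
  "hyp x y = x$1 * y$2 + x$2 * y$1"

abbreviation om :: "phase \<Rightarrow> phase \<Rightarrow> real" where "om \<equiv> phase_symplectic hyp"

abbreviation vec2 :: "real \<Rightarrow> real \<Rightarrow> real^2" where "vec2 a b \<equiv> vector [a, b]"

lemma vec2_eq_iff: "(x::real^2) = y \<longleftrightarrow> x$1 = y$1 \<and> x$2 = y$2"
  by (simp add: vec_eq_iff forall_2)

lemma om_eq: "om p q = fst p$1 * snd q$2 + fst p$2 * snd q$1 - snd p$1 * fst q$2 - snd p$2 * fst q$1"
  by (simp add: phase_symplectic_def hyp_def)

lemma om_add_left: "om (p + q) r = om p r + om q r"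
  and om_add_right: "om r (p + q) = om r p + om r q"
  and om_scale_left: "om (c *\<^sub>R p) r = c * om p r"
  and om_scale_right: "om r (c *\<^sub>R p) = c * om r p"
  and om_diff_left: "om (p - q) r = om p r - om q r"
  and om_diff_right: "om r (p - q) = om r p - om r q"
  and om_zero_left: "om 0 r = 0" and om_zero_right: "om r 0 = 0"
  by (simp_all add: om_eq algebra_simps)

lemmas om_simps = om_add_left om_add_right om_scale_left om_scale_right om_diff_left om_diff_right
  om_zero_left om_zero_right

lemma om_skew: "om q p = - om p q" by (simp add: om_eq)

lemma om_self [simp]: "om p p = 0" by (simp add: om_eq)

lemma continuous_on_om [continuous_intros]:
  assumes "continuous_on S f" "continuous_on S g"
  shows "continuous_on S (\<lambda>x. om (f x) (g x))"
  unfolding om_eq by (intro continuous_intros assms)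

text \<open>Multiplication by the matrix of the symplectic form turns symplectic orthogonality into
  Euclidean orthogonality, so an isotropic subspace and its image have complementary dimensions.\<close>

lemma isotropic_dim_le:
  fixes L :: "phase set"
  assumes L: "subspace L" "\<And>x y. x \<in> L \<Longrightarrow> y \<in> L \<Longrightarrow> om x y = 0"
  shows "dim L \<le> 2"
proof -
  define K :: "phase \<Rightarrow> phase" where "K p = (vec2 (snd p$2) (snd p$1), - vec2 (fst p$2) (fst p$1))" for p
  have lin: "linear K"
    by (rule linearI) (auto simp: K_def vec2_eq_iff prod_eq_iff algebra_simps)
  have inj: "inj K"
    by (rule injI) (auto simp: K_def vec2_eq_iff prod_eq_iff)
  have inner: "x \<bullet> K y = om x y" for x y
    by (simp add: K_def om_eq inner_prod_def inner_vec_def sum_2 algebra_simps)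
  have "K ` L \<subseteq> {y \<in> UNIV. \<forall>x\<in>L. orthogonal x y}"
    using L(2) by (auto simp: orthogonal_def inner)
  then have "dim (K ` L) \<le> dim {y \<in> UNIV. \<forall>x\<in>L. orthogonal x y}"
    by (rule dim_subset)
  moreover have "dim (K ` L) = dim L"
    by (rule dim_image_eq[OF lin]) (use inj in \<open>auto intro: inj_on_subset\<close>)
  moreover have "dim {y \<in> UNIV. \<forall>x\<in>L. orthogonal x y} + dim L = dim (UNIV :: phase set)"
    by (rule dim_subspace_orthogonal_to_vectors) (use L in auto)
  ultimately show ?thesis by simp
qed

lemma span2_iff: "x \<in> span {u, v} \<longleftrightarrow> (\<exists>a b. x = a *\<^sub>R u + b *\<^sub>R v)"
  for u :: "'b::real_vector"
proof -
  have "x \<in> span {u, v} \<longleftrightarrow> (\<exists>a b. x - a *\<^sub>R u = b *\<^sub>R v)"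
    unfolding span_breakdown_eq[of x u "{v}"] by (auto simp: span_singleton)
  then show ?thesis by (simp add: diff_eq_eq add.commute)
qed

definition indep2 :: "'b::real_vector \<Rightarrow> 'b \<Rightarrow> bool" where
  "indep2 u v \<longleftrightarrow> (\<forall>a b. a *\<^sub>R u + b *\<^sub>R v = 0 \<longrightarrow> a = 0 \<and> b = 0)"

lemma indep2_neq: "indep2 u v \<Longrightarrow> u \<noteq> v"
proof
  assume uv: "indep2 u v" "u = v"
  then have "1 *\<^sub>R u + (- 1) *\<^sub>R v = 0" by simp
  with uv(1) have "(1::real) = 0" unfolding indep2_def by blast
  then show False by simp
qed

lemma indep2_independent:
  assumes "indep2 u v" shows "independent {u, v}"
proof -
  have "v \<noteq> 0"
  proof
    assume "v = 0"
    then have "0 *\<^sub>R u + 1 *\<^sub>R v = 0" by simp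
    then show False using assms unfolding indep2_def by (metis zero_neq_one)
  qed
  moreover have "u \<notin> span {v}"
  proof
    assume "u \<in> span {v}"
    then obtain k where "u = k *\<^sub>R v" by (auto simp: span_singleton)
    then have "1 *\<^sub>R u + (- k) *\<^sub>R v = 0" by simp
    then show False using assms unfolding indep2_def by (metis zero_neq_one)
  qed
  ultimately show ?thesis using indep2_neq[OF assms] by (simp add: independent_insert)
qed

lemma independent_indep2:
  assumes "independent {u, v}" "u \<noteq> v" shows "indep2 u v"
proof -
  have u: "u \<notin> span {v}" and v: "v \<noteq> 0"
    using assms by (simp_all add: independent_insert)
  show ?thesis unfolding indep2_def
  proof (intro allI impI)
    fix a b :: real assume eq: "a *\<^sub>R u + b *\<^sub>R v = 0"
    have "a = 0"
    proof (rule ccontr)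
      assume "a \<noteq> 0"
      have "a *\<^sub>R u = (- b) *\<^sub>R v" using eq by (simp add: eq_neg_iff_add_eq_0)
      then have "(1/a) *\<^sub>R a *\<^sub>R u = (1/a) *\<^sub>R (- b) *\<^sub>R v" by simp
      then have "u = (- b / a) *\<^sub>R v" using \<open>a \<noteq> 0\<close> by simp
      then show False using u by (metis span_base singletonI span_scale)
    qed
    then show "a = 0 \<and> b = 0" using eq v by simp
  qed
qed

lemma dim_span_indep2: "indep2 u v \<Longrightarrow> dim (span {u, v :: 'b::euclidean_space}) = 2"
  using indep2_independent[of u v] indep2_neq[of u v] by (simp add: dim_eq_card_independent)

lemma lagrangian_dim: "lagrangian om L \<Longrightarrow> dim L = 2"
  by (simp add: lagrangian_def)

lemma lagrangian_span:
  assumes "indep2 u v" "om u v = 0"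
  shows "lagrangian om (span {u, v})"
proof -
  have "om x y = 0" if xy: "x \<in> span {u, v}" "y \<in> span {u, v}" for x y
  proof -
    obtain a b c d where "x = a *\<^sub>R u + b *\<^sub>R v" "y = c *\<^sub>R u + d *\<^sub>R v"
      using xy unfolding span2_iff by blast
    then show ?thesis using assms(2) om_skew[of u v] by (simp add: om_simps)
  qed
  then show ?thesis using dim_span_indep2[OF assms(1)] by (simp add: lagrangian_def)
qed

lemma lagrangian_obtain:
  assumes "lagrangian om L"
  obtains u v where "L = span {u, v}" "indep2 u v" "om u v = 0"
proof -
  obtain B where B: "B \<subseteq> L" "independent B" "L \<subseteq> span B" "card B = dim L"
    using basis_exists by blast
  then have "card B = 2" using lagrangian_dim[OF assms] by simp
  then obtain u v where uv: "B = {u, v}" "u \<noteq> v" by (auto simp: card_2_iff)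
  have "span B \<subseteq> L" using B(1) assms by (simp add: lagrangian_def span_minimal)
  then show ?thesis using that[of u v] B uv assms independent_indep2 by (auto simp: lagrangian_def)
qed

text \<open>Otherwise adjoining the vector would give an isotropic subspace of dimension three.\<close>

lemma lagrangian_maximal:
  assumes L: "lagrangian om L" and x: "\<And>y. y \<in> L \<Longrightarrow> om x y = 0"
  shows "x \<in> L"
proof (rule ccontr)
  assume nx: "x \<notin> L"
  have sub: "subspace L" using L by (simp add: lagrangian_def)
  have "om y z = 0" if yz: "y \<in> span (insert x L)" "z \<in> span (insert x L)" for y z
  proof -
    have "span L = L" using sub by simp
    then obtain a b where ab: "y - a *\<^sub>R x \<in> L" "z - b *\<^sub>R x \<in> L"
      using yz unfolding span_breakdown_eq by metis
    then have "om (y - a *\<^sub>R x) (z - b *\<^sub>R x) = 0" "om x (y - a *\<^sub>R x) = 0" "om x (z - b *\<^sub>R x) = 0"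
      using L x by (auto simp: lagrangian_def)
    then show ?thesis using om_skew[of x y] by (simp add: om_simps)
  qed
  then have "dim (span (insert x L)) \<le> 2" by (intro isotropic_dim_le) auto
  moreover have "dim (insert x L) = dim L + 1"
    using nx span_eq_iff[of L] sub by (simp add: dim_insert del: span_eq_iff)
  ultimately show False using lagrangian_dim[OF L] by simp
qed

lemma cramer2_zero:
  fixes p q A B C D :: real
  assumes "p * A + q * C = 0" "p * B + q * D = 0"
  shows "p * (A * D - B * C) = 0" "q * (A * D - B * C) = 0"
proof -
  have "p * (A * D - B * C) = (p * A + q * C) * D - (p * B + q * D) * C"
    "q * (A * D - B * C) = (p * B + q * D) * A - (p * A + q * C) * B"
    by (simp_all add: algebra_simps)
  then show "p * (A * D - B * C) = 0" "q * (A * D - B * C) = 0" by (simp_all only: assms mult_zero_left diff_self)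
qed

lemma cramer2_solve:
  fixes x y A B C D d :: real
  assumes d: "d = A * D - B * C" "d \<noteq> 0"
  shows "((x * D - y * C) / d) * A + ((A * y - B * x) / d) * C = x"
    and "((x * D - y * C) / d) * B + ((A * y - B * x) / d) * D = y"
proof -
  have "(x * D - y * C) * A + (A * y - B * x) * C = x * d" "(x * D - y * C) * B + (A * y - B * x) * D = y * d"
    by (simp_all add: d(1) algebra_simps)
  then show "((x * D - y * C) / d) * A + ((A * y - B * x) / d) * C = x"
    "((x * D - y * C) / d) * B + ((A * y - B * x) / d) * D = y"
    using d(2) by (simp_all add: add_divide_distrib[symmetric])
qed

text \<open>A kernel vector of the pairing matrix gives a vector of the first Lagrangian orthogonal to the second
  one, which lies in it by maximality. The criterion makes transversality an open condition on continuous bases.\<close>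

lemma lag_transverse_det:
  assumes W: "indep2 u1 u2" "om u1 u2 = 0" and A: "indep2 a1 a2" "om a1 a2 = 0"
  shows "lag_transverse om (span {u1, u2}) (span {a1, a2}) \<longleftrightarrow>
    om u1 a1 * om u2 a2 - om u1 a2 * om u2 a1 \<noteq> 0" (is "?T \<longleftrightarrow> ?d \<noteq> 0")
proof
  assume d: "?d \<noteq> 0"
  have "x = 0" if "x \<in> span {u1, u2}" "x \<in> span {a1, a2}" for x
  proof -
    obtain p q r s where x: "x = p *\<^sub>R u1 + q *\<^sub>R u2" "x = r *\<^sub>R a1 + s *\<^sub>R a2"
      using \<open>x \<in> span {u1, u2}\<close> \<open>x \<in> span {a1, a2}\<close> unfolding span2_iff by blast
    have "om x a1 = 0" "om x a2 = 0" using A(2) om_skew[of a1 a2] by (simp_all add: x(2) om_simps)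
    then have e: "p * om u1 a1 + q * om u2 a1 = 0" "p * om u1 a2 + q * om u2 a2 = 0"
      by (simp_all add: x(1) om_simps)
    have "p * ?d = 0" "q * ?d = 0" using cramer2_zero[OF e] by simp_all
    then show "x = 0" using d x(1) by simp
  qed
  then show ?T using lagrangian_span[OF W] lagrangian_span[OF A]
    by (auto simp: lag_transverse_def span_zero)
next
  assume T: ?T
  show "?d \<noteq> 0"
  proof
    assume d: "?d = 0"
    obtain p q where pq: "p \<noteq> 0 \<or> q \<noteq> 0" "p * om u1 a1 + q * om u2 a1 = 0" "p * om u1 a2 + q * om u2 a2 = 0"
    proof (cases "om u1 a1 = 0 \<and> om u2 a1 = 0")
      case True
      show ?thesis
      proof (cases "om u1 a2 = 0 \<and> om u2 a2 = 0")
        case True then show ?thesis using that[of 1 0] \<open>om u1 a1 = 0 \<and> om u2 a1 = 0\<close> by simp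
      next
        case False then show ?thesis using that[of "om u2 a2" "- om u1 a2"] True by auto
      qed
    next
      case False
      show ?thesis by (rule that[of "om u2 a1" "- om u1 a1"]) (use False d in \<open>auto simp: algebra_simps\<close>)
    qed
    define x where "x = p *\<^sub>R u1 + q *\<^sub>R u2"
    have "x \<noteq> 0" using pq(1) W(1) unfolding indep2_def x_def by blast
    moreover have "x \<in> span {u1, u2}" unfolding x_def span2_iff by blast
    moreover have "x \<in> span {a1, a2}"
    proof (rule lagrangian_maximal[OF lagrangian_span[OF A]])
      fix y assume "y \<in> span {a1, a2}"
      then obtain r s where y: "y = r *\<^sub>R a1 + s *\<^sub>R a2" unfolding span2_iff by blast
      have "om x a1 = 0" "om x a2 = 0" using pq by (simp_all add: x_def om_simps)
      then show "om x y = 0" by (simp add: y om_simps)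
    qed
    ultimately show False using T by (auto simp: lag_transverse_def)
  qed
qed

section \<open>Charts of the Lagrangian Grassmannian\<close>

lemma graph_map_unique:
  assumes "lag_transverse om W L1" "y \<in> L1" "u + y \<in> W"
  shows "graph_map L1 W u = y"
  unfolding graph_map_def
proof (rule the_equality)
  show "y \<in> L1 \<and> u + y \<in> W" using assms by simp
next
  fix z assume z: "z \<in> L1 \<and> u + z \<in> W"
  have "(u + z) - (u + y) \<in> W" "z - y \<in> L1"
    using assms z unfolding lag_transverse_def lagrangian_def by (blast intro: subspace_diff)+
  then have "z - y \<in> W \<inter> L1" by simp
  moreover have "W \<inter> L1 = {0}" using assms(1) by (simp only: lag_transverse_def)
  ultimately have "z - y \<in> {0}" by (simp only:)
  then show "z = y" by simp
qed

text \<open>Cramer's rule for the splitting of the phase space into two transverse Lagrangians. It exhibits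
  the chart values as rational functions of a basis, which is the source of all continuity and smoothness statements.\<close>

lemma graph_map_cramer:
  assumes T: "lag_transverse om (span {w1, w2}) (span {a1, a2})"
    and W: "indep2 w1 w2" "om w1 w2 = 0" and A: "indep2 a1 a2" "om a1 a2 = 0"
  defines "d \<equiv> om w1 a1 * om w2 a2 - om w1 a2 * om w2 a1"
  defines "\<alpha> \<equiv> \<lambda>u. (om u a1 * om w2 a2 - om u a2 * om w2 a1) / d"
    and "\<beta> \<equiv> \<lambda>u. (om w1 a1 * om u a2 - om w1 a2 * om u a1) / d"
  shows "graph_map (span {a1, a2}) (span {w1, w2}) u = \<alpha> u *\<^sub>R w1 + \<beta> u *\<^sub>R w2 - u"
    and "graph_map (span {a1, a2}) (span {w1, w2}) u \<in> span {a1, a2}"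
    and "u + graph_map (span {a1, a2}) (span {w1, w2}) u \<in> span {w1, w2}"
proof -
  have d: "d \<noteq> 0" using T lag_transverse_det[OF W A] by (simp add: d_def)
  define y where "y = \<alpha> u *\<^sub>R w1 + \<beta> u *\<^sub>R w2 - u"
  have "om y a1 = 0" "om y a2 = 0"
    using cramer2_solve[OF meta_eq_to_obj_eq[OF d_def] d, of "om u a1" "om u a2"]
    by (simp_all add: y_def om_simps \<alpha>_def \<beta>_def)
  then have "om y z = 0" if "z \<in> span {a1, a2}" for z
    using that by (auto simp: span2_iff om_simps)
  then have y: "y \<in> span {a1, a2}" by (rule lagrangian_maximal[OF lagrangian_span[OF A]])
  have uy: "u + y \<in> span {w1, w2}" unfolding span2_iff y_def by auto
  have "graph_map (span {a1, a2}) (span {w1, w2}) u = y"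
    by (rule graph_map_unique[OF T y uy])
  then show "graph_map (span {a1, a2}) (span {w1, w2}) u = \<alpha> u *\<^sub>R w1 + \<beta> u *\<^sub>R w2 - u"
    "graph_map (span {a1, a2}) (span {w1, w2}) u \<in> span {a1, a2}"
    "u + graph_map (span {a1, a2}) (span {w1, w2}) u \<in> span {w1, w2}"
    using y uy by (simp_all add: y_def)
qed

lemma lag_chart_cramer:
  assumes T: "lag_transverse om (span {w1, w2}) (span {a1, a2})"
    and W: "indep2 w1 w2" "om w1 w2 = 0" and A: "indep2 a1 a2" "om a1 a2 = 0"
    and L: "lagrangian om L" "u \<in> L" "v \<in> L"
  shows "lag_chart om L (span {a1, a2}) (span {w1, w2}) (u, v) =
    ((om u a1 * om w2 a2 - om u a2 * om w2 a1) * om w1 v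
      + (om w1 a1 * om u a2 - om w1 a2 * om u a1) * om w2 v)
    / (om w1 a1 * om w2 a2 - om w1 a2 * om w2 a1)"
proof -
  have "om u v = 0" using L unfolding lagrangian_def by blast
  then show ?thesis
    using L(2,3) by (simp add: lag_chart_def graph_map_cramer(1)[OF T W A] om_simps add_divide_distrib)
qed

lemma graph_map_add_mem:
  assumes "lag_transverse om W L1"
  shows "graph_map L1 W u \<in> L1" "u + graph_map L1 W u \<in> W"
proof -
  have lag: "lagrangian om W" "lagrangian om L1"
    using assms by (simp_all only: lag_transverse_def)
  obtain w1 w2 where w: "W = span {w1, w2}" "indep2 w1 w2" "om w1 w2 = 0"
    using lag(1) by (rule lagrangian_obtain)
  obtain a1 a2 where a: "L1 = span {a1, a2}" "indep2 a1 a2" "om a1 a2 = 0"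
    using lag(2) by (rule lagrangian_obtain)
  show "graph_map L1 W u \<in> L1" "u + graph_map L1 W u \<in> W"
    using graph_map_cramer(2,3)[OF assms[unfolded w(1) a(1)] w(2,3) a(2,3)] unfolding w(1) a(1) .
qed

text \<open>The form is symmetric because both the graph and the domain are isotropic.\<close>

lemma lag_chart_in_bsym:
  assumes W: "lag_transverse om W L1" and L: "lagrangian om L"
  shows "lag_chart om L L1 W \<in> topspace (bsym_topology L)"
proof -
  let ?T = "graph_map L1 W"
  have sub: "subspace W" "subspace L1" using W by (auto simp: lag_transverse_def lagrangian_def)
  have add: "?T (u + v) = ?T u + ?T v" for u v
    by (rule graph_map_unique[OF W])
      (use subspace_add[OF sub(2)] subspace_add[OF sub(1) graph_map_add_mem(2)[OF W, of u] graph_map_add_mem(2)[OF W, of v]]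
        graph_map_add_mem(1)[OF W] in \<open>auto simp: algebra_simps\<close>)
  have scale: "?T (c *\<^sub>R u) = c *\<^sub>R ?T u" for c u
    by (rule graph_map_unique[OF W])
      (use subspace_scale[OF sub(2)] subspace_scale[OF sub(1) graph_map_add_mem(2)[OF W, of u], of c]
        graph_map_add_mem(1)[OF W] in \<open>auto simp: algebra_simps\<close>)
  have sym: "om (?T u) v = om (?T v) u" if "u \<in> L" "v \<in> L" for u v
  proof -
    have "om (u + ?T u) (v + ?T v) = 0" "om (?T u) (?T v) = 0" "om u v = 0"
      using graph_map_add_mem[OF W] W L that unfolding lag_transverse_def lagrangian_def by blast+
    then show ?thesis using om_skew[of u "?T v"] by (simp add: om_simps)
  qed
  have "sym_bilinear_on L (\<lambda>u v. om (?T u) v)"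
    unfolding sym_bilinear_on_def using sym by (auto simp: add scale om_simps)
  then have "lag_chart om L L1 W \<in> {restrict (\<lambda>(u, v). B u v) (L \<times> L) | B. sym_bilinear_on L B}"
    unfolding lag_chart_def by blast
  moreover have "lag_chart om L L1 W \<in> L \<times> L \<rightarrow>\<^sub>E UNIV"
    unfolding lag_chart_def by simp
  ultimately show ?thesis
    by (simp add: bsym_topology_def topspace_product_topology)
qed

lemma orthogonal_triple_in_plane:
  fixes p q p' q' p'' q'' :: real
  assumes "p * p' + q * q' = 0" "p * p'' + q * q'' = 0" "p' * p'' + q' * q'' = 0"
    "p \<noteq> 0 \<or> q \<noteq> 0" "p' \<noteq> 0 \<or> q' \<noteq> 0"
  shows "p'' = 0 \<and> q'' = 0"
proof -
  have "(p\<^sup>2 + q\<^sup>2) * (p'\<^sup>2 + q'\<^sup>2) = (p * q' - p' * q)\<^sup>2 + (p * p' + q * q')\<^sup>2"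
    by (simp add: power2_eq_square algebra_simps)
  then have d: "(p\<^sup>2 + q\<^sup>2) * (p'\<^sup>2 + q'\<^sup>2) = (p * q' - p' * q)\<^sup>2"
    using assms(1) by simp
  have "p\<^sup>2 + q\<^sup>2 \<noteq> 0" "p'\<^sup>2 + q'\<^sup>2 \<noteq> 0" using assms(4,5) by (simp_all add: sum_power2_eq_zero_iff)
  then have "p * q' - p' * q \<noteq> 0" using d by (metis no_zero_divisors zero_power2)
  moreover have "p'' * (p * q' - p' * q) = 0" "q'' * (p * q' - p' * q) = 0"
    by (rule cramer2_zero; use assms(2,3) in \<open>simp add: mult.commute\<close>)+
  ultimately show ?thesis by simp
qed

text \<open>The manifold topology is generated by preimages under the charts, so it suffices that transversality
  is open along the family and that the chart values, given by Cramer's rule, are continuous there.\<close>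

lemma continuous_map_span:
  fixes w1 w2 :: "'e::topological_space \<Rightarrow> phase"
  assumes cont: "continuous_on T w1" "continuous_on T w2"
    and W: "\<And>t. t \<in> T \<Longrightarrow> indep2 (w1 t) (w2 t)" "\<And>t. t \<in> T \<Longrightarrow> om (w1 t) (w2 t) = 0"
    and ex: "\<And>t. t \<in> T \<Longrightarrow> \<exists>L. lag_transverse om (span {w1 t, w2 t}) L"
  shows "continuous_map (top_of_set T) (lag_topology om) (\<lambda>t. span {w1 t, w2 t})"
  unfolding lag_topology_def continuous_on_generated_topo_iff
proof (intro conjI allI impI)
  let ?S = "{{W. lag_transverse om W L1 \<and> lag_chart om L L1 W \<in> U} | L L1 U.
          lag_transverse om L L1 \<and> openin (bsym_topology L) U}"
  show "(\<lambda>t. span {w1 t, w2 t}) ` topspace (top_of_set T) \<subseteq> \<Union>?S"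
  proof clarify
    fix t assume "t \<in> topspace (top_of_set T)"
    then obtain L where L: "lag_transverse om (span {w1 t, w2 t}) L" using ex[of t] by auto
    then have lag: "lagrangian om (span {w1 t, w2 t})" by (simp only: lag_transverse_def)
    have "span {w1 t, w2 t} \<in> {W. lag_transverse om W L \<and>
        lag_chart om (span {w1 t, w2 t}) L W \<in> topspace (bsym_topology (span {w1 t, w2 t}))}"
      using L lag_chart_in_bsym[OF L lag] by blast
    then show "span {w1 t, w2 t} \<in> \<Union>?S" using L by blast
  qed
  fix V assume "V \<in> ?S"
  then obtain L L1 U where V: "V = {W. lag_transverse om W L1 \<and> lag_chart om L L1 W \<in> U}"
    and L: "lag_transverse om L L1" and U: "openin (bsym_topology L) U" by blast
  have lag: "lagrangian om L" "lagrangian om L1" using L by (simp_all only: lag_transverse_def)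
  obtain a1 a2 where a: "L1 = span {a1, a2}" "indep2 a1 a2" "om a1 a2 = 0"
    using lag(2) by (rule lagrangian_obtain)
  define d where "d t = om (w1 t) a1 * om (w2 t) a2 - om (w1 t) a2 * om (w2 t) a1" for t
  define T' where "T' = {t \<in> T. d t \<noteq> 0}"
  have tr: "lag_transverse om (span {w1 t, w2 t}) L1 \<longleftrightarrow> d t \<noteq> 0" if "t \<in> T" for t
    unfolding a(1) d_def by (rule lag_transverse_det[OF W[OF that] a(2,3)])
  have "continuous_on T d" unfolding d_def by (intro continuous_intros cont)
  then have op: "openin (top_of_set T) (T \<inter> d -` (- {0}))"
    by (rule continuous_openin_preimage_gen) (simp add: open_Compl)
  have opT': "openin (top_of_set T) T'"
  proof -
    have "T \<inter> d -` (- {0}) = T'" by (auto simp: T'_def)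
    with op show ?thesis by simp
  qed
  have T': "T' \<subseteq> T" by (auto simp: T'_def)
  have "continuous_map (top_of_set T') (bsym_topology L) (\<lambda>t. lag_chart om L L1 (span {w1 t, w2 t}))"
    unfolding bsym_topology_def continuous_map_in_subtopology
  proof
    show "(\<lambda>t. lag_chart om L L1 (span {w1 t, w2 t})) \<in> topspace (top_of_set T')
        \<rightarrow> {restrict (\<lambda>(u, v). B u v) (L \<times> L) | B. sym_bilinear_on L B}"
    proof
      fix t assume "t \<in> topspace (top_of_set T')"
      then have "lag_transverse om (span {w1 t, w2 t}) L1" using tr[of t] by (auto simp: T'_def)
      from lag_chart_in_bsym[OF this lag(1)]
      show "lag_chart om L L1 (span {w1 t, w2 t})
          \<in> {restrict (\<lambda>(u, v). B u v) (L \<times> L) | B. sym_bilinear_on L B}"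
        unfolding bsym_topology_def topspace_subtopology by (rule IntD2)
    qed
    show "continuous_map (top_of_set T') (powertop_real (L \<times> L)) (\<lambda>t. lag_chart om L L1 (span {w1 t, w2 t}))"
      unfolding continuous_map_componentwise
    proof (intro conjI ballI)
      show "(\<lambda>t. lag_chart om L L1 (span {w1 t, w2 t})) ` topspace (top_of_set T') \<subseteq> extensional (L \<times> L)"
        by (auto simp: lag_chart_def)
      fix uv assume "uv \<in> L \<times> L"
      then obtain u v where uv: "uv = (u, v)" "u \<in> L" "v \<in> L" by blast
      let ?f = "\<lambda>t. ((om u a1 * om (w2 t) a2 - om u a2 * om (w2 t) a1) * om (w1 t) v
      + (om (w1 t) a1 * om u a2 - om (w1 t) a2 * om u a1) * om (w2 t) v) / d t"
      have "continuous_on T' ?f"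
        unfolding d_def
        by (intro continuous_intros continuous_on_subset[OF cont(1) T'] continuous_on_subset[OF cont(2) T'])
          (simp add: T'_def d_def)
      moreover have "?f t = lag_chart om L L1 (span {w1 t, w2 t}) uv" if "t \<in> T'" for t
      proof -
        have t: "t \<in> T" using that T' by blast
        then have "lag_transverse om (span {w1 t, w2 t}) (span {a1, a2})"
          using tr[OF t] that unfolding a(1) by (simp add: T'_def)
        from lag_chart_cramer[OF this W[OF t] a(2,3) lag(1) uv(2,3)]
        show ?thesis unfolding uv(1) a(1) d_def by (rule sym)
      qed
      ultimately show "continuous_map (top_of_set T') euclideanreal
          (\<lambda>t. lag_chart om L L1 (span {w1 t, w2 t}) uv)"
        by (simp add: continuous_on_eq)
    qed
  qed
  from openin_continuous_map_preimage[OF this U]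
  have "openin (top_of_set T') {t \<in> T'. lag_chart om L L1 (span {w1 t, w2 t}) \<in> U}"
    by simp
  then have "openin (top_of_set T) {t \<in> T'. lag_chart om L L1 (span {w1 t, w2 t}) \<in> U}"
    using opT' by (rule openin_trans)
  moreover have "(\<lambda>t. span {w1 t, w2 t}) -` V \<inter> topspace (top_of_set T)
      = {t \<in> T'. lag_chart om L L1 (span {w1 t, w2 t}) \<in> U}"
    using tr by (auto simp: V T'_def)
  ultimately show "openin (top_of_set T) ((\<lambda>t. span {w1 t, w2 t}) -` V \<inter> topspace (top_of_set T))"
    by simp
qed

section \<open>Symplectic frames\<close>

text \<open>A splitting into the Lagrangians spanned by the \<open>l\<close> and by the \<open>k\<close>, with dual bases.
  A triple \<open>(a, b, c)\<close> stands for the symmetric matrix with rows \<open>(a, b)\<close> and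
  \<open>(b, c)\<close>; its graph is the Lagrangian with that matrix in the chart.\<close>

locale symplectic_frame =
  fixes l1 l2 k1 k2 :: phase
  assumes ll: "om l1 l2 = 0" and kk: "om k1 k2 = 0"
    and kl: "om k1 l1 = 1" "om k2 l2 = 1" "om k1 l2 = 0" "om k2 l1 = 0"
begin

definition b1 :: "real \<times> real \<times> real \<Rightarrow> phase" where
  "b1 = (\<lambda>(a, b, c). l1 + a *\<^sub>R k1 + b *\<^sub>R k2)"
definition b2 :: "real \<times> real \<times> real \<Rightarrow> phase" where
  "b2 = (\<lambda>(a, b, c). l2 + b *\<^sub>R k1 + c *\<^sub>R k2)"
definition graph :: "real \<times> real \<times> real \<Rightarrow> phase set" where
  "graph m = span {b1 m, b2 m}"
definition coords :: "phase set \<Rightarrow> real \<times> real \<times> real" where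
  "coords W = (lag_chart om (span {l1, l2}) (span {k1, k2}) W (l1, l1),
               lag_chart om (span {l1, l2}) (span {k1, k2}) W (l1, l2),
               lag_chart om (span {l1, l2}) (span {k1, k2}) W (l2, l2))"
abbreviation K :: "phase set" where "K \<equiv> span {k1, k2}"

lemma lk: "om l1 k1 = -1" "om l2 k2 = -1" "om l2 k1 = 0" "om l1 k2 = 0"
  using kl om_skew[of l1 k1] om_skew[of l2 k2] om_skew[of l2 k1] om_skew[of l1 k2] by simp_all

lemma kk': "om k2 k1 = 0" and ll': "om l2 l1 = 0"
  using kk ll om_skew[of k2 k1] om_skew[of l2 l1] by simp_all

lemmas frame_simps = ll kk kl lk kk' ll'

lemma indep2_k: "indep2 k1 k2"
  unfolding indep2_def
proof (intro allI impI)
  fix a b assume e: "a *\<^sub>R k1 + b *\<^sub>R k2 = 0"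
  have "om (a *\<^sub>R k1 + b *\<^sub>R k2) l1 = 0" "om (a *\<^sub>R k1 + b *\<^sub>R k2) l2 = 0" by (simp_all only: e om_simps)
  then show "a = 0 \<and> b = 0" by (simp add: om_simps frame_simps)
qed

lemma indep2_b: "indep2 (b1 m) (b2 m)"
  unfolding indep2_def
proof (intro allI impI)
  fix x y assume e: "x *\<^sub>R b1 m + y *\<^sub>R b2 m = 0"
  have "om k1 (x *\<^sub>R b1 m + y *\<^sub>R b2 m) = 0" "om k2 (x *\<^sub>R b1 m + y *\<^sub>R b2 m) = 0"
    by (simp_all only: e om_simps)
  then show "x = 0 \<and> y = 0" by (cases m) (simp add: b1_def b2_def om_simps frame_simps)
qed

lemma om_b: "om (b1 m) (b2 m) = 0"
  by (cases m) (simp add: b1_def b2_def om_simps frame_simps)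

lemma b_zero: "b1 0 = l1" "b2 0 = l2"
  by (simp_all add: b1_def b2_def zero_prod_def)

lemma indep2_l: "indep2 l1 l2"
  using indep2_b[of 0] by (simp add: b_zero)

lemma lagrangian_graph: "lagrangian om (graph m)"
  unfolding graph_def by (rule lagrangian_span[OF indep2_b om_b])

lemma graph_zero: "graph 0 = span {l1, l2}"
  by (simp add: graph_def b_zero)

lemma graph_transverse: "lag_transverse om (graph m) K"
  unfolding graph_def lag_transverse_det[OF indep2_b om_b indep2_k kk]
  by (cases m) (simp add: b1_def b2_def om_simps frame_simps)

lemma coords_graph: "coords (graph m) = m"
proof -
  note c = lag_chart_cramer[OF graph_transverse[unfolded graph_def] indep2_b om_b indep2_k kk
    lagrangian_span[OF indep2_l ll]]
  have l: "l1 \<in> span {l1, l2}" "l2 \<in> span {l1, l2}" by (simp_all add: span_base)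
  show ?thesis
    unfolding coords_def graph_def c[OF l(1) l(1)] c[OF l(1) l(2)] c[OF l(2) l(2)]
    by (cases m) (simp add: b1_def b2_def om_simps frame_simps)
qed

text \<open>Projecting \<open>l1\<close> and \<open>l2\<close> to the Lagrangian along \<open>K\<close> gives a basis of the required form;
  isotropy forces the two off-diagonal entries to agree.\<close>

lemma transverse_imp_graph:
  assumes "lag_transverse om W K"
  obtains m where "W = graph m"
proof -
  define w1 w2 where "w1 = l1 + graph_map K W l1" and "w2 = l2 + graph_map K W l2"
  note g = graph_map_add_mem[OF assms]
  obtain a b where ab: "graph_map K W l1 = a *\<^sub>R k1 + b *\<^sub>R k2"
    using g(1)[of l1] unfolding span2_iff by blast
  obtain b' c where bc: "graph_map K W l2 = b' *\<^sub>R k1 + c *\<^sub>R k2"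
    using g(1)[of l2] unfolding span2_iff by blast
  have W: "subspace W" "dim W = 2" and iso: "om w1 w2 = 0"
    using assms g(2)[of l1] g(2)[of l2] lagrangian_dim[of W]
    unfolding lag_transverse_def lagrangian_def w1_def w2_def by blast+
  have "b = b'" using iso by (simp add: w1_def w2_def ab bc om_simps frame_simps)
  then have w: "w1 = b1 (a, b, c)" "w2 = b2 (a, b, c)"
    by (simp_all add: w1_def w2_def ab bc b1_def b2_def)
  have "span {w1, w2} \<subseteq> W"
    using g(2) W(1) by (intro span_minimal) (auto simp: w1_def w2_def)
  then have "graph (a, b, c) \<subseteq> W" by (simp add: graph_def w)
  then have "graph (a, b, c) = W"
    using W lagrangian_dim[OF lagrangian_graph, of "(a, b, c)"] lagrangian_graph[of "(a, b, c)"]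
    by (intro subspace_dim_equal) (auto simp: lagrangian_def)
  then show ?thesis using that by metis
qed

lemma graph_coords: "lag_transverse om W K \<Longrightarrow> graph (coords W) = W"
  using transverse_imp_graph[of W] coords_graph by metis

lemma continuous_on_b [continuous_intros]:
  assumes "continuous_on T m" shows "continuous_on T (\<lambda>t. b1 (m t))" "continuous_on T (\<lambda>t. b2 (m t))"
  unfolding b1_def b2_def case_prod_beta by (intro continuous_intros assms)+

lemma continuous_map_graph:
  assumes "continuous_on T m"
  shows "continuous_map (top_of_set T) (lag_topology om) (\<lambda>t. graph (m t))"
  unfolding graph_def
  by (rule continuous_map_span[OF continuous_on_b[OF assms] indep2_b om_b])
    (blast intro: graph_transverse[unfolded graph_def])

lemma openin_transverse:
  "openin (lag_topology om) {W. lag_transverse om W K}"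
proof -
  have L: "lag_transverse om (span {l1, l2}) K" using graph_transverse[of 0] by (simp add: graph_zero)
  have eq: "{W. lag_transverse om W K} = {W. lag_transverse om W K \<and>
      lag_chart om (span {l1, l2}) K W \<in> topspace (bsym_topology (span {l1, l2}))}"
    using lag_chart_in_bsym lagrangian_span[OF indep2_l ll] by blast
  show ?thesis
    unfolding lag_topology_def
    by (rule topology_generated_by_Basis) (use L eq in blast)
qed

text \<open>Evaluation at a pair of vectors is continuous on the space of forms, hence every chart coordinate
  is a continuous function on the domain of the chart.\<close>

lemma openin_chart_preimage:
  assumes "u \<in> span {l1, l2}" "v \<in> span {l1, l2}" "open O'"
  shows "openin (lag_topology om) {W. lag_transverse om W K \<and> lag_chart om (span {l1, l2}) K W (u, v) \<in> O'}"
proof -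
  let ?L = "span {l1, l2}"
  have L: "lag_transverse om ?L K" using graph_transverse[of 0] by (simp add: graph_zero)
  define U where "U = {f \<in> topspace (bsym_topology ?L). f (u, v) \<in> O'}"
  have "continuous_map (powertop_real (?L \<times> ?L)) euclideanreal (\<lambda>f. f (u, v))"
    by (rule continuous_map_product_projection) (use assms in auto)
  then have "continuous_map (bsym_topology ?L) euclideanreal (\<lambda>f. f (u, v))"
    unfolding bsym_topology_def by (rule continuous_map_from_subtopology)
  then have U: "openin (bsym_topology ?L) U"
    unfolding U_def by (rule openin_continuous_map_preimage) (use assms in simp)
  have eq: "{W. lag_transverse om W K \<and> lag_chart om ?L K W (u, v) \<in> O'}
      = {W. lag_transverse om W K \<and> lag_chart om ?L K W \<in> U}"
    unfolding U_def using lag_chart_in_bsym lagrangian_span[OF indep2_l ll] by blast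
  show ?thesis
    unfolding lag_topology_def eq
    by (rule topology_generated_by_Basis) (use L U in blast)
qed

lemma
  assumes f: "continuous_map (top_of_set T) (lag_topology om) f"
  shows openin_transverse_preimage: "openin (top_of_set T) {t \<in> T. lag_transverse om (f t) K}"
    and continuous_on_coords: "continuous_on {t \<in> T. lag_transverse om (f t) K} (\<lambda>t. coords (f t))"
proof -
  let ?T = "{t \<in> T. lag_transverse om (f t) K}"
  show op: "openin (top_of_set T) ?T"
    using openin_continuous_map_preimage[OF f openin_transverse] by simp
  have "continuous_on ?T (\<lambda>t. lag_chart om (span {l1, l2}) K (f t) (u, v))"
    if uv: "u \<in> span {l1, l2}" "v \<in> span {l1, l2}" for u v
  proof (rule iffD2[OF continuous_on_open_gen[of _ _ UNIV]]; (intro allI impI)?)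
    fix O' :: "real set" assume "openin (top_of_set UNIV) O'"
    then have "open O'" by simp
    from openin_continuous_map_preimage[OF f openin_chart_preimage[OF uv this]]
    have "openin (top_of_set T) {t \<in> T. lag_transverse om (f t) K \<and> lag_chart om (span {l1, l2}) K (f t) (u, v) \<in> O'}"
      by simp
    then have "openin (top_of_set ?T) {t \<in> T. lag_transverse om (f t) K \<and> lag_chart om (span {l1, l2}) K (f t) (u, v) \<in> O'}"
      by (rule openin_subset_trans) auto
    moreover have "?T \<inter> (\<lambda>t. lag_chart om (span {l1, l2}) K (f t) (u, v)) -` O' =
      {t \<in> T. lag_transverse om (f t) K \<and> lag_chart om (span {l1, l2}) K (f t) (u, v) \<in> O'}" by auto
    ultimately show "openin (top_of_set ?T) (?T \<inter> (\<lambda>t. lag_chart om (span {l1, l2}) K (f t) (u, v)) -` O')"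
      by simp
  qed simp
  moreover have "l1 \<in> span {l1, l2}" "l2 \<in> span {l1, l2}" by (simp_all add: span_base)
  ultimately show "continuous_on ?T (\<lambda>t. coords (f t))"
    unfolding coords_def by (intro continuous_on_Pair) blast+
qed

end

section \<open>Charts adapted to the vertical Lagrangian\<close>

abbreviation L0 :: "phase set" where "L0 \<equiv> {0} \<times> UNIV"
abbreviation Lam :: "phase set topology" where "Lam \<equiv> lag_topology om"
abbreviation Lam0 :: "phase set set" where "Lam0 \<equiv> lag_stratum om L0 0"

text \<open>The complements \<open>K\<close> are the graphs of the multiples of one operator representing a definite form; they are all transverse to
  \<open>L0\<close>, and those for different parameters are transverse to each other.\<close>

interpretation ch: symplectic_frame "(0, vec2 1 0)" "(0, vec2 0 1)" "(vec2 0 1, vec2 c 0)" "(vec2 1 0, vec2 0 c)" for c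
  by standard (simp_all add: om_eq)

text \<open>Coordinates on the Lagrangians transverse to \<open>L0\<close>, which become the graphs over the horizontal Lagrangian.\<close>

interpretation hz: symplectic_frame "(vec2 1 0, 0)" "(vec2 0 1, 0)" "(0, vec2 0 (-1))" "(0, vec2 (-1) 0)"
  by standard (simp_all add: om_eq)

text \<open>The chart \<open>chartL c\<close> parametrises the Lagrangians transverse to the \<open>c\<close>-th complement by
  symmetric matrices, with \<open>L0\<close> at the origin. The intersection with \<open>L0\<close> is the kernel of the matrix.\<close>

definition chartL :: "real \<Rightarrow> real \<times> real \<times> real \<Rightarrow> phase set" where "chartL c m = ch.graph c m"

lemma ch_b: "ch.b1 c (x, y, z) = (vec2 y x, vec2 (1 + c * x) (c * y))"
   "ch.b2 c (x, y, z) = (vec2 z y, vec2 (c * y) (1 + c * z))"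
  by (simp_all add: ch.b1_def ch.b2_def prod_eq_iff vec2_eq_iff)

lemma hz_b: "hz.b1 (x, y, z) = (vec2 1 0, vec2 (- y) (- x))"
   "hz.b2 (x, y, z) = (vec2 0 1, vec2 (- z) (- y))"
  by (simp_all add: hz.b1_def hz.b2_def prod_eq_iff vec2_eq_iff)

lemma hz_K: "hz.K = L0"
proof -
  have "(0, w) \<in> hz.K" for w
    unfolding span2_iff by (intro exI[of _ "- w$2"] exI[of _ "- w$1"]) (simp add: prod_eq_iff vec2_eq_iff)
  moreover have "p \<in> L0" if "p \<in> hz.K" for p
    using that unfolding span2_iff by (cases p) (auto simp: vec2_eq_iff)
  ultimately show ?thesis by auto
qed

lemma lagrangian_L0: "lagrangian om L0"
  using lagrangian_span[OF hz.indep2_k hz.kk] by (simp only: hz_K)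

lemma Lam0_iff: "W \<in> Lam0 \<longleftrightarrow> lag_transverse om W L0"
proof -
  have "dim (W \<inter> L0) = 0 \<longleftrightarrow> W \<inter> L0 = {0}" if "lagrangian om W"
  proof -
    have "0 \<in> W \<inter> L0" using that by (auto simp: lagrangian_def subspace_0 zero_prod_def[symmetric])
        (simp add: zero_prod_def)
    then show ?thesis unfolding dim_eq_0 by blast
  qed
  then show ?thesis using lagrangian_L0 by (auto simp: lag_stratum_def lag_transverse_def)
qed

lemma ge1_iff: "lagrangian om W \<Longrightarrow> W \<in> lag_stratum_ge1 om L0 \<longleftrightarrow> W \<notin> Lam0"
  by (auto simp: lag_stratum_ge1_def lag_stratum_def simp del: dim_eq_0)

text \<open>Vectors of the Lagrangian in the complements for three different parameters
  would be pairwise orthogonal in the plane.\<close>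

lemma exists_chart:
  assumes W: "lagrangian om W"
  obtains c where "lag_transverse om W (ch.K c)"
proof (rule ccontr)
  assume "\<not> thesis"
  then have no: "\<not> lag_transverse om W (ch.K c)" for c using that by blast
  have "\<exists>p q. (p \<noteq> 0 \<or> q \<noteq> 0) \<and> (vec2 q p, vec2 (c * p) (c * q)) \<in> W" for c
  proof -
    have "lagrangian om (ch.K c)" by (rule lagrangian_span[OF ch.indep2_k ch.kk])
    then have "W \<inter> ch.K c \<noteq> {0}" using W no[of c] unfolding lag_transverse_def by blast
    moreover have "0 \<in> W \<inter> ch.K c" using W by (simp add: lagrangian_def subspace_0 span_zero)
    ultimately obtain x where x: "x \<in> W" "x \<in> ch.K c" "x \<noteq> 0" by blast
    then obtain p q where pq: "x = p *\<^sub>R (vec2 0 1, vec2 c 0) + q *\<^sub>R (vec2 1 0, vec2 0 c)"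
      unfolding span2_iff by blast
    have "x = (vec2 q p, vec2 (c * p) (c * q))" by (simp add: pq prod_eq_iff vec2_eq_iff)
    moreover have "p \<noteq> 0 \<or> q \<noteq> 0" using x(3) pq by (auto simp: zero_prod_def)
    ultimately show ?thesis using x(1) by auto
  qed
  then obtain P Q where PQ: "\<And>c. P c \<noteq> 0 \<or> Q c \<noteq> 0" "\<And>c. (vec2 (Q c) (P c), vec2 (c * P c) (c * Q c)) \<in> W"
    by metis
  have orth: "P c * P d + Q c * Q d = 0" if "c \<noteq> d" for c d :: real
  proof -
    have "om (vec2 (Q c) (P c), vec2 (c * P c) (c * Q c)) (vec2 (Q d) (P d), vec2 (d * P d) (d * Q d)) = 0"
      using PQ(2)[of c] PQ(2)[of d] W unfolding lagrangian_def by blast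
    then have "(d - c) * (P c * P d + Q c * Q d) = 0" by (simp add: om_eq algebra_simps)
    then show ?thesis using that by simp
  qed
  show False
    using orthogonal_triple_in_plane[OF orth[of 0 1] orth[of 0 2] orth[of 1 2] PQ(1) PQ(1)] PQ(1)[of 2] by simp
qed

lemma lagrangian_eq_chartL:
  assumes "lagrangian om W" obtains c m where "W = chartL c m"
  using exists_chart[OF assms] ch.transverse_imp_graph unfolding chartL_def by metis

lemma lagrangian_chartL: "lagrangian om (chartL c m)"
  unfolding chartL_def by (rule ch.lagrangian_graph)

lemma chartL_transverse: "lag_transverse om (chartL c m) (ch.K c)"
  unfolding chartL_def by (rule ch.graph_transverse)

lemma continuous_map_lagrangian_span:
  fixes w1 w2 :: "'e::topological_space \<Rightarrow> phase"
  assumes "continuous_on T w1" "continuous_on T w2"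
    and W: "\<And>t. t \<in> T \<Longrightarrow> indep2 (w1 t) (w2 t)" "\<And>t. t \<in> T \<Longrightarrow> om (w1 t) (w2 t) = 0"
  shows "continuous_map (top_of_set T) Lam (\<lambda>t. span {w1 t, w2 t})"
proof (rule continuous_map_span[OF assms])
  fix t assume "t \<in> T"
  then have "lagrangian om (span {w1 t, w2 t})" by (intro lagrangian_span W)
  then show "\<exists>L. lag_transverse om (span {w1 t, w2 t}) L" using exists_chart by blast
qed

lemma topspace_Lam: "topspace Lam = {W. lagrangian om W}"
proof -
  have "\<Union>{{W. lag_transverse om W L1 \<and> lag_chart om L L1 W \<in> U} | L L1 U.
          lag_transverse om L L1 \<and> openin (bsym_topology L) U} \<subseteq> {W. lagrangian om W}"
    by (auto simp: lag_transverse_def)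
  then have "topspace Lam \<subseteq> {W. lagrangian om W}"
    unfolding lag_topology_def topology_generated_by_topspace .
  moreover have "W \<in> topspace Lam" if W: "lagrangian om W" for W
  proof -
    obtain c where "lag_transverse om W (ch.K c)" using exists_chart[OF W] .
    then show ?thesis using openin_subset[OF ch.openin_transverse[of c]] by blast
  qed
  ultimately show ?thesis by blast
qed

text \<open>Determinant, trace and number of positive eigenvalues; the last one is meant for nonsingular matrices.\<close>

definition sym_det :: "real \<times> real \<times> real \<Rightarrow> real" where "sym_det = (\<lambda>(x, y, z). x * z - y\<^sup>2)"
definition sym_tr :: "real \<times> real \<times> real \<Rightarrow> real" where "sym_tr = (\<lambda>(x, y, z). x + z)"
definition pos_index :: "real \<times> real \<times> real \<Rightarrow> int" where
  "pos_index m = (if sym_det m < 0 then 1 else if sym_tr m > 0 then 2 else 0)"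

lemma chartL_Lam0_iff: "chartL c m \<in> Lam0 \<longleftrightarrow> sym_det m \<noteq> 0"
proof -
  obtain x y z where m: "m = (x, y, z)" by (cases m)
  have "chartL c m \<in> Lam0 \<longleftrightarrow> lag_transverse om (chartL c m) hz.K" by (simp only: Lam0_iff hz_K)
  then show ?thesis
    unfolding chartL_def ch.graph_def
      lag_transverse_det[OF ch.indep2_b ch.om_b hz.indep2_k hz.kk]
    by (auto simp: m ch_b om_eq sym_det_def power2_eq_square)
qed

lemma continuous_map_chartL:
  fixes m :: "'e::topological_space \<Rightarrow> real \<times> real \<times> real"
  assumes c: "continuous_on T c" and m: "continuous_on T m"
  shows "continuous_map (top_of_set T) Lam (\<lambda>t. chartL (c t) (m t))"
proof -
  have eq: "vec2 x 0 = x *\<^sub>R vec2 1 0" "vec2 0 x = x *\<^sub>R vec2 0 1" for x by (simp_all add: vec2_eq_iff)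
  have c2: "continuous_on T (\<lambda>t. vec2 (c t) 0)" "continuous_on T (\<lambda>t. vec2 0 (c t))"
    unfolding eq[of "c _"] by (intro continuous_intros c)+
  show ?thesis
    unfolding chartL_def ch.graph_def
    by (rule continuous_map_lagrangian_span[OF _ _ ch.indep2_b ch.om_b];
      unfold ch.b1_def ch.b2_def case_prod_beta; intro continuous_intros m c2)
qed

section \<open>Classes of paths inside one chart\<close>

definition homologous :: "phase set chain \<Rightarrow> phase set chain \<Rightarrow> bool" where
  "homologous z z' \<longleftrightarrow> homologous_rel 1 Lam Lam0 z z'"

abbreviation path_chain :: "('e::real_vector \<Rightarrow> phase set) \<Rightarrow> 'e \<Rightarrow> 'e \<Rightarrow> phase set chain" where
  "path_chain f p q \<equiv> frag_of (simplex_path f p q)"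

lemma hom_refl [simp]: "homologous z z" by (simp add: homologous_def)
lemma hom_sym: "homologous z z' \<Longrightarrow> homologous z' z" unfolding homologous_def by (subst homologous_rel_sym)
lemma hom_trans [trans]: "homologous a b \<Longrightarrow> homologous b c \<Longrightarrow> homologous a c"
  unfolding homologous_def by (rule homologous_rel_trans)
lemma hom_add: "homologous a a' \<Longrightarrow> homologous b b' \<Longrightarrow> homologous (a + b) (a' + b')"
  unfolding homologous_def by (rule homologous_rel_add)
lemma hom_diff: "homologous a a' \<Longrightarrow> homologous b b' \<Longrightarrow> homologous (a - b) (a' - b')"
  unfolding homologous_def by (rule homologous_rel_diff)
lemmas hom_triangle = chain_triangle[where X = Lam and S = Lam0, folded homologous_def]
lemmas hom_constant = chain_constant[where X = Lam and S = Lam0, folded homologous_def]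
lemmas hom_in_subspace = chain_in_subspace[where X = Lam and S = Lam0, folded homologous_def]
lemmas hom_square = chain_square[where X = Lam and S = Lam0, folded homologous_def]

lemma closed_segment_01: "closed_segment 0 (1::real) = {0..1}" by (simp add: closed_segment_eq_real_ivl)

lemma closed_segment_Pair:
  "closed_segment (a, b) (a, d) = {a} \<times> closed_segment b d"
  for a :: "'x::real_vector" and b :: "'y::real_vector"
proof -
  have "(1 - u) *\<^sub>R a + u *\<^sub>R a = a" for u by (simp add: scaleR_left_diff_distrib)
  then show ?thesis by (auto simp: closed_segment_def)
qed

lemma continuous_map_chartL_fixed: "continuous_map (top_of_set UNIV) Lam (chartL c)"
  using continuous_map_chartL[OF continuous_on_const continuous_on_id, of UNIV c] by simp

text \<open>The matrices form a convex set, so a path in a chart can be deformed to a straight one.\<close>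

lemma hom_straighten:
  fixes s t :: real
  assumes m: "continuous_on (closed_segment s t) m"
  shows "homologous (path_chain (\<lambda>x. chartL c (m x)) s t) (path_chain (chartL c) (m s) (m t))"
proof -
  define f where "f = (\<lambda>(u::real, r::real). chartL c ((1 - r) *\<^sub>R m ((1 - u) *\<^sub>R s + u *\<^sub>R t) + r *\<^sub>R ((1 - u) *\<^sub>R m s + u *\<^sub>R m t)))"
  let ?K = "{0..1} \<times> {0..1} :: (real \<times> real) set"
  have "continuous_on ?K (\<lambda>x. (1 - snd x) *\<^sub>R m ((1 - fst x) *\<^sub>R s + fst x *\<^sub>R t)
      + snd x *\<^sub>R ((1 - fst x) *\<^sub>R m s + fst x *\<^sub>R m t))"
  proof (intro continuous_intros continuous_on_compose2[OF m])
    show "(\<lambda>x. (1 - fst x) *\<^sub>R s + fst x *\<^sub>R t) ` ?K \<subseteq> closed_segment s t"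
      unfolding closed_segment_def by auto
  qed
  then have f: "continuous_map (top_of_set ?K) Lam f"
    unfolding f_def case_prod_beta by (rule continuous_map_chartL[OF continuous_on_const])
  have K: "convex ?K" by (intro convex_Times) auto
  have "homologous (path_chain f (0, 0) (1, 0)) (path_chain f (0, 1) (1, 1))"
  proof (rule hom_square[OF f K])
    show "homologous (path_chain f (0, 0) (0, 1)) 0"
    proof (rule hom_constant[OF f K])
      fix x :: "real \<times> real" assume "x \<in> closed_segment (0, 0) (0, 1)"
      then obtain r where "x = (0, r)" unfolding closed_segment_Pair by auto
      then show "f x = f (0, 0)" by (simp add: f_def scaleR_left_diff_distrib)
    qed auto
    show "homologous (path_chain f (1, 0) (1, 1)) 0"
    proof (rule hom_constant[OF f K])
      fix x :: "real \<times> real" assume "x \<in> closed_segment (1, 0) (1, 1)"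
      then obtain r where "x = (1, r)" unfolding closed_segment_Pair by auto
      then show "f x = f (1, 0)" by (simp add: f_def scaleR_left_diff_distrib)
    qed auto
  qed auto
  also have "simplex_path f (0, 1) (1, 1) = simplex_path (chartL c) (m s) (m t)"
    by (rule simplex_path_eqI) (simp add: f_def)
  finally show ?thesis
    using simplex_path_eqI[of f "(0, 0)" "(1, 0)" "\<lambda>x. chartL c (m x)" s t] by (simp add: f_def)
qed

text \<open>Moving the parameter \<open>c\<close> to \<open>0\<close> keeps nondegenerate end points inside \<open>Lam0\<close>,
  so the relative class does not depend on the chart.\<close>

lemma hom_chart_0:
  assumes "sym_det m \<noteq> 0" "sym_det n \<noteq> 0"
  shows "homologous (path_chain (chartL c) m n) (path_chain (chartL 0) m n)"
proof -
  define f where "f = (\<lambda>(u::real, r::real). chartL ((1 - r) * c) ((1 - u) *\<^sub>R m + u *\<^sub>R n))"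
  have f: "continuous_map (top_of_set UNIV) Lam f"
    unfolding f_def case_prod_beta by (intro continuous_map_chartL continuous_intros)
  have K: "convex (UNIV :: (real \<times> real) set)" by simp
  have "homologous (path_chain f (0, 0) (1, 0)) (path_chain f (0, 1) (1, 1))"
  proof (rule hom_square[OF f K])
    show "homologous (path_chain f (0, 0) (0, 1)) 0"
      by (rule hom_in_subspace[OF f K]) (auto simp: closed_segment_Pair f_def chartL_Lam0_iff assms)
    show "homologous (path_chain f (1, 0) (1, 1)) 0"
      by (rule hom_in_subspace[OF f K]) (auto simp: closed_segment_Pair f_def chartL_Lam0_iff assms)
  qed auto
  also have "simplex_path f (0, 1) (1, 1) = simplex_path (chartL 0) m n"
    by (rule simplex_path_eqI) (simp add: f_def)
  also have "simplex_path f (0, 0) (1, 0) = simplex_path (chartL c) m n"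
    by (rule simplex_path_eqI) (simp add: f_def)
  finally show ?thesis .
qed

lemma hom_path_component:
  assumes n: "path n" "pathstart n = m" "pathfinish n = m'" and nd: "\<And>t. t \<in> {0..1} \<Longrightarrow> sym_det (n t) \<noteq> 0"
  shows "homologous (path_chain (chartL 0) m m') 0"
proof -
  have cont: "continuous_on (closed_segment 0 1) n" using n(1) by (simp add: path_def closed_segment_01)
  have "homologous (path_chain (chartL 0) (n 0) (n 1)) (path_chain (\<lambda>x. chartL 0 (n x)) 0 1)"
    by (rule hom_sym[OF hom_straighten[OF cont]])
  also have "homologous (path_chain (\<lambda>x. chartL 0 (n x)) 0 1) 0"
  proof (rule hom_in_subspace)
    show "continuous_map (top_of_set {0..1}) Lam (\<lambda>x. chartL 0 (n x))"
      using cont by (intro continuous_map_chartL continuous_on_const) (simp add: closed_segment_01)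
  qed (use nd in \<open>auto simp: closed_segment_01 chartL_Lam0_iff\<close>)
  finally show ?thesis using n by (simp add: pathstart_def pathfinish_def)
qed

lemma hom_segment_component:
  assumes "\<And>t. 0 \<le> t \<Longrightarrow> t \<le> 1 \<Longrightarrow> sym_det ((1 - t) *\<^sub>R m + t *\<^sub>R m') \<noteq> 0"
  shows "homologous (path_chain (chartL 0) m m') 0"
proof (rule hom_path_component[of "linepath m m'"])
  fix t :: real assume "t \<in> {0..1}"
  then show "sym_det (linepath m m' t) \<noteq> 0" using assms[of t] by (simp add: linepath_def)
qed simp_all

lemma hom_chartL_triangle: "homologous (path_chain (chartL c) m n + path_chain (chartL c) n p) (path_chain (chartL c) m p)"
  by (rule hom_triangle[OF continuous_map_chartL_fixed]) auto

definition index_rep :: "int \<Rightarrow> real \<times> real \<times> real" where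
  "index_rep i = (if i = 0 then (-1, 0, -1) else if i = 1 then (1, 0, -1) else (1, 0, 1))"

text \<open>Nondegenerate symmetric matrices with the same number of positive eigenvalues are connected: definite
  ones by segments, indefinite ones by first removing the trace and then avoiding the origin in the plane of
  traceless matrices.\<close>

lemma hom_to_rep:
  assumes "sym_det m \<noteq> 0"
  shows "homologous (path_chain (chartL 0) m (index_rep (pos_index m))) 0"
proof -
  obtain x y z where m: "m = (x, y, z)" by (cases m)
  consider "sym_det m < 0" | "sym_det m > 0" "sym_tr m > 0" | "sym_det m > 0" "sym_tr m \<le> 0" using assms by linarith
  then show ?thesis
  proof cases
    case 2
    have pos: "sym_det ((1 - t) *\<^sub>R m + t *\<^sub>R (1, 0, 1)) > 0" if "0 \<le> t" "t \<le> 1" for t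
    proof -
      have "sym_det ((1 - t) *\<^sub>R m + t *\<^sub>R (1, 0, 1)) = (1 - t)\<^sup>2 * sym_det m + t * (1 - t) * sym_tr m + t\<^sup>2"
        by (simp add: m sym_det_def sym_tr_def power2_eq_square algebra_simps)
      moreover have "(1 - t)\<^sup>2 * sym_det m + t\<^sup>2 > 0"
      proof (cases "t = 0")
        case False then show ?thesis using 2 by (intro add_nonneg_pos) auto
      qed (use 2 in simp)
      moreover have "t * (1 - t) * sym_tr m \<ge> 0" using 2 that by simp
      ultimately show ?thesis by linarith
    qed
    have "homologous (path_chain (chartL 0) m (1, 0, 1)) 0"
      by (rule hom_segment_component) (drule (1) pos, erule less_imp_neq[THEN not_sym])
    then show ?thesis using 2 by (simp add: pos_index_def index_rep_def)
  next
    case 3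
    have pos: "sym_det ((1 - t) *\<^sub>R m + t *\<^sub>R (-1, 0, -1)) > 0" if "0 \<le> t" "t \<le> 1" for t
    proof -
      have "sym_det ((1 - t) *\<^sub>R m + t *\<^sub>R (-1, 0, -1)) = (1 - t)\<^sup>2 * sym_det m - t * (1 - t) * sym_tr m + t\<^sup>2"
        by (simp add: m sym_det_def sym_tr_def power2_eq_square algebra_simps)
      moreover have "(1 - t)\<^sup>2 * sym_det m + t\<^sup>2 > 0"
      proof (cases "t = 0")
        case False then show ?thesis using 3 by (intro add_nonneg_pos) auto
      qed (use 3 in simp)
      moreover have "t * (1 - t) * sym_tr m \<le> 0" using 3 that by (simp add: mult_nonneg_nonpos)
      ultimately show ?thesis by linarith
    qed
    have "homologous (path_chain (chartL 0) m (-1, 0, -1)) 0"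
      by (rule hom_segment_component) (drule (1) pos, erule less_imp_neq[THEN not_sym])
    then show ?thesis using 3 by (simp add: pos_index_def index_rep_def)
  next
    case 1
    define p q where "p = (x + z) / 2" and "q = (x - z) / 2"
    have xz: "x = p + q" "z = p - q" by (simp_all add: p_def q_def field_simps)
    have d: "p\<^sup>2 < q\<^sup>2 + y\<^sup>2" using 1 by (simp add: m sym_det_def xz power2_eq_square algebra_simps)
    have 11: "homologous (path_chain (chartL 0) m (q, y, - q)) 0"
    proof (rule hom_segment_component)
      fix t :: real assume t: "0 \<le> t" "t \<le> 1"
      have "sym_det ((1 - t) *\<^sub>R m + t *\<^sub>R (q, y, - q)) = (1 - t)\<^sup>2 * p\<^sup>2 - q\<^sup>2 - y\<^sup>2"
        by (simp add: m sym_det_def xz power2_eq_square algebra_simps)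
      moreover have "(1 - t)\<^sup>2 \<le> 1" using t by (simp add: power_le_one)
      then have "(1 - t)\<^sup>2 * p\<^sup>2 \<le> p\<^sup>2" by (simp add: mult_left_le_one_le)
      ultimately show "sym_det ((1 - t) *\<^sub>R m + t *\<^sub>R (q, y, - q)) \<noteq> 0" using d by linarith
    qed
    have "(q, y) \<noteq> (0, 0)"
    proof
      assume "(q, y) = (0, 0)"
      then have "p\<^sup>2 < 0" using d by simp
      then show False by simp
    qed
    then have "(q, y) \<in> - {0 :: real \<times> real}" "(1, 0) \<in> - {0 :: real \<times> real}" by (simp_all add: zero_prod_def)
    moreover have "path_connected (- {0 :: real \<times> real})" by (rule path_connected_punctured_universe) simp
    ultimately obtain g where g: "path g" "path_image g \<subseteq> - {0}" "pathstart g = (q, y)" "pathfinish g = (1, 0)"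
      unfolding path_connected_def by blast
    have 12: "homologous (path_chain (chartL 0) (q, y, - q) (1, 0, -1)) 0"
    proof (rule hom_path_component[of "\<lambda>t. (fst (g t), snd (g t), - fst (g t))"])
      show "path (\<lambda>t. (fst (g t), snd (g t), - fst (g t)))"
        using g(1) unfolding path_def by (intro continuous_intros)
      fix t :: real assume "t \<in> {0..1}"
      then have "g t \<noteq> 0" using g(2) by (auto simp: path_image_def)
      then have "fst (g t) \<noteq> 0 \<or> snd (g t) \<noteq> 0" by (auto simp: prod_eq_iff)
      then have "(fst (g t))\<^sup>2 + (snd (g t))\<^sup>2 \<noteq> 0" by (simp add: sum_power2_eq_zero_iff)
      moreover have "sym_det (fst (g t), snd (g t), - fst (g t)) = - ((fst (g t))\<^sup>2 + (snd (g t))\<^sup>2)"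
        by (simp add: sym_det_def power2_eq_square)
      ultimately show "sym_det (fst (g t), snd (g t), - fst (g t)) \<noteq> 0" by linarith
    qed (use g in \<open>auto simp: pathstart_def pathfinish_def\<close>)
    have "homologous (path_chain (chartL 0) m (1, 0, -1)) (path_chain (chartL 0) m (q, y, - q) + path_chain (chartL 0) (q, y, - q) (1, 0, -1))"
      by (rule hom_sym[OF hom_chartL_triangle])
    also have "homologous \<dots> (0 + 0)" by (rule hom_add[OF 11 12])
    finally show ?thesis using 1 by (simp add: pos_index_def index_rep_def)
  qed
qed

text \<open>The class of a path along which one eigenvalue becomes positive.\<close>

definition gen :: "phase set chain" where "gen = path_chain (chartL 0) (-1, 0, -1) (1, 0, -1)"

text \<open>It does not matter whether the other eigenvalue is negative or positive: it can be moved from one sign to the other through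
  infinity, where the Lagrangian is not in the chart but stays transverse to \<open>L0\<close>.\<close>

lemma hom_rep_1_2: "homologous (path_chain (chartL 0) (1, 0, -1) (1, 0, 1)) gen"
proof -
  define f where "f = (\<lambda>(s::real, d::real). span {(vec2 0 s, vec2 1 0), (vec2 1 0, vec2 0 d)})"
  have eq: "vec2 0 x = x *\<^sub>R vec2 0 1" for x by (simp add: vec2_eq_iff)
  have ind: "indep2 (vec2 0 s, vec2 1 0) (vec2 1 0, vec2 0 d)" for s d
    by (simp add: indep2_def prod_eq_iff vec2_eq_iff)
  have iso: "om (vec2 0 s, vec2 1 0) (vec2 1 0, vec2 0 d) = 0" for s d by (simp add: om_eq)
  have f: "continuous_map (top_of_set UNIV) Lam f"
    unfolding f_def case_prod_beta
    by (rule continuous_map_lagrangian_span[OF _ _ ind iso]; unfold eq[of "fst _"] eq[of "snd _"]; intro continuous_intros)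
  have K: "convex (UNIV :: (real \<times> real) set)" by simp
  have inL: "f (s, d) \<in> Lam0" if "s \<noteq> 0" for s d
  proof -
    have "lag_transverse om (f (s, d)) hz.K"
      unfolding f_def case_prod_conv lag_transverse_det[OF ind iso hz.indep2_k hz.kk]
      using that by (simp add: om_eq)
    then show ?thesis by (simp only: Lam0_iff hz_K)
  qed
  have pos: "f (s, 1) = chartL 0 (s, 0, 1)" for s
    by (simp add: f_def chartL_def ch.graph_def ch_b)
  have neg: "f (s, -1) = chartL 0 (s, 0, -1)" for s
  proof -
    have "span {u, - v} = span {u, v}" for u v :: phase
    proof -
      have "a *\<^sub>R u + b *\<^sub>R - v = a *\<^sub>R u + (- b) *\<^sub>R v" for a b by simp
      moreover have "a *\<^sub>R u + b *\<^sub>R v = a *\<^sub>R u + (- b) *\<^sub>R - v" for a b by simp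
      ultimately have "x \<in> span {u, - v} \<longleftrightarrow> x \<in> span {u, v}" for x
        unfolding span2_iff by blast
      then show ?thesis by blast
    qed
    note flip = this
    have v: "(vec2 1 0, vec2 0 (-1)) = - (vec2 (-1) 0, vec2 0 1)" by (simp add: prod_eq_iff vec2_eq_iff)
    have "f (s, -1) = span {(vec2 0 s, vec2 1 0), (vec2 (-1) 0, vec2 0 1)}"
      unfolding f_def case_prod_conv v by (rule flip)
    then show ?thesis by (simp add: chartL_def ch.graph_def ch_b)
  qed
  have "homologous (path_chain f (-1, -1) (1, -1)) (path_chain f (-1, 1) (1, 1))"
  proof (rule hom_square[OF f K])
    show "homologous (path_chain f (-1, -1) (-1, 1)) 0"
      by (rule hom_in_subspace[OF f K]) (auto simp: closed_segment_Pair inL)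
    show "homologous (path_chain f (1, -1) (1, 1)) 0"
      by (rule hom_in_subspace[OF f K]) (auto simp: closed_segment_Pair inL)
  qed auto
  also have "simplex_path f (-1, -1) (1, -1) = simplex_path (chartL 0) (-1, 0, -1) (1, 0, -1)"
    by (rule simplex_path_eqI) (simp add: neg)
  also have "simplex_path f (-1, 1) (1, 1) = simplex_path (chartL 0) (-1, 0, 1) (1, 0, 1)"
    by (rule simplex_path_eqI) (simp add: pos)
  finally have 1: "homologous gen (path_chain (chartL 0) (-1, 0, 1) (1, 0, 1))" by (simp add: gen_def)
  have "homologous (path_chain (chartL 0) (-1, 0, 1) (index_rep (pos_index (-1, 0, 1)))) 0" by (rule hom_to_rep) (simp add: sym_det_def)
  then have 2: "homologous (path_chain (chartL 0) (-1, 0, 1) (1, 0, -1)) 0" by (simp add: pos_index_def index_rep_def sym_det_def)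
  have "homologous (path_chain (chartL 0) (1, 0, -1) (1, 0, 1)) (path_chain (chartL 0) (-1, 0, 1) (1, 0, -1) + path_chain (chartL 0) (1, 0, -1) (1, 0, 1))"
    using hom_add[OF hom_sym[OF 2] hom_refl] by simp
  also have "homologous \<dots> (path_chain (chartL 0) (-1, 0, 1) (1, 0, 1))" by (rule hom_chartL_triangle)
  also have "homologous \<dots> gen" by (rule hom_sym[OF 1])
  finally show ?thesis .
qed

lemma hom_chartL_self: "homologous (path_chain (chartL c) m m) 0"
  by (rule hom_constant[OF continuous_map_chartL_fixed]) auto

lemma pos_index_cases: "pos_index m \<in> {0, 1, 2}" by (simp add: pos_index_def)

lemma hom_from_rep_0: "i \<in> {0, 1, 2} \<Longrightarrow> homologous (path_chain (chartL 0) (index_rep 0) (index_rep i)) (frag_cmul i gen)"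
proof -
  assume "i \<in> {0, 1, 2}"
  then consider "i = 0" | "i = 1" | "i = 2" by auto
  then show ?thesis
  proof cases
    case 1 then show ?thesis by (simp add: hom_chartL_self)
  next
    case 2 then show ?thesis by (simp add: index_rep_def gen_def)
  next
    case 3
    have "homologous (path_chain (chartL 0) (index_rep 0) (index_rep 2)) (path_chain (chartL 0) (index_rep 0) (index_rep 1) + path_chain (chartL 0) (index_rep 1) (index_rep 2))"
      by (rule hom_sym[OF hom_chartL_triangle])
    also have "homologous \<dots> (gen + gen)"
      by (rule hom_add) (simp_all add: index_rep_def hom_rep_1_2, simp add: gen_def)
    also have "gen + gen = frag_cmul 2 gen"
      using frag_cmul_distrib[of 1 1 gen] by simp
    finally show ?thesis using 3 by simp
  qed
qed

text \<open>In a convex chart the relative class depends only on the components of the end points, and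
  passing from one component to the next contributes one generator.\<close>

theorem hom_chart_path:
  assumes "sym_det m \<noteq> 0" "sym_det n \<noteq> 0"
  shows "homologous (path_chain (chartL c) m n) (frag_cmul (pos_index n - pos_index m) gen)"
proof -
  let ?p = "path_chain (chartL 0)" and ?M = "index_rep (pos_index m)" and ?N = "index_rep (pos_index n)"
  have base: "homologous (?p (index_rep 0) k) (frag_cmul (pos_index k) gen)" if "sym_det k \<noteq> 0" for k
  proof -
    have "homologous (?p (index_rep 0) k + ?p k (index_rep (pos_index k)) - ?p k (index_rep (pos_index k))) (frag_cmul (pos_index k) gen - 0)"
      by (rule hom_diff[OF hom_trans[OF hom_chartL_triangle hom_from_rep_0[OF pos_index_cases]] hom_to_rep[OF that]])
    then show ?thesis by simp
  qed
  have "homologous (path_chain (chartL c) m n) (?p m n)" by (rule hom_chart_0[OF assms])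
  also have "?p m n = ?p (index_rep 0) m + ?p m n - ?p (index_rep 0) m" by simp
  also have "homologous \<dots> (frag_cmul (pos_index n) gen - frag_cmul (pos_index m) gen)"
    by (rule hom_diff[OF hom_trans[OF hom_chartL_triangle base[OF assms(2)]] base[OF assms(1)]])
  also have "\<dots> = frag_cmul (pos_index n - pos_index m) gen" by (simp add: frag_cmul_diff_distrib)
  finally show ?thesis .
qed

section \<open>The relative homology group is cyclic\<close>

text \<open>Homologous up to multiples of the generator; eventually every relative cycle is equivalent to \<open>0\<close>.\<close>

definition gen_equiv :: "phase set chain \<Rightarrow> phase set chain \<Rightarrow> bool" where
  "gen_equiv z z' \<longleftrightarrow> (\<exists>k. homologous (z - z') (frag_cmul k gen))"

lemma hom_imp_gen_equiv: "homologous z z' \<Longrightarrow> gen_equiv z z'"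
  unfolding gen_equiv_def using hom_diff[of z z' z' z'] by (intro exI[of _ 0]) simp

lemma gen_equiv_add: "gen_equiv a a' \<Longrightarrow> gen_equiv b b' \<Longrightarrow> gen_equiv (a + b) (a' + b')"
  unfolding gen_equiv_def
proof clarify
  fix k l assume "homologous (a - a') (frag_cmul k gen)" "homologous (b - b') (frag_cmul l gen)"
  from hom_add[OF this] show "\<exists>k. homologous (a + b - (a' + b')) (frag_cmul k gen)"
    by (intro exI[of _ "k + l"]) (simp add: frag_cmul_distrib algebra_simps)
qed

lemma gen_equiv_sym: "gen_equiv a b \<Longrightarrow> gen_equiv b a"
  unfolding gen_equiv_def
proof clarify
  fix k assume "homologous (a - b) (frag_cmul k gen)"
  from hom_diff[OF hom_refl[of 0] this] show "\<exists>k. homologous (b - a) (frag_cmul k gen)"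
    by (intro exI[of _ "- k"]) (simp add: frag_cmul_diff_distrib[of 0, simplified])
qed

lemma gen_equiv_refl [simp]: "gen_equiv a a" by (rule hom_imp_gen_equiv) simp

lemma gen_equiv_trans [trans]: "gen_equiv a b \<Longrightarrow> gen_equiv b c \<Longrightarrow> gen_equiv a c"
  unfolding gen_equiv_def
proof clarify
  fix k l assume "homologous (a - b) (frag_cmul k gen)" "homologous (b - c) (frag_cmul l gen)"
  from hom_add[OF this] show "\<exists>k. homologous (a - c) (frag_cmul k gen)"
    by (intro exI[of _ "k + l"]) (simp add: frag_cmul_distrib)
qed

lemma gen_equiv_minus: "gen_equiv a b \<Longrightarrow> gen_equiv (- a) (- b)"
  using gen_equiv_add[OF gen_equiv_sym[of a b] gen_equiv_refl[of "- a - b"]] by simp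

lemma gen_equiv_diff: "gen_equiv a a' \<Longrightarrow> gen_equiv b b' \<Longrightarrow> gen_equiv (a - b) (a' - b')"
  using gen_equiv_add[OF _ gen_equiv_minus] by fastforce

lemma gen_equiv_chart_path: "sym_det m \<noteq> 0 \<Longrightarrow> sym_det n \<noteq> 0 \<Longrightarrow> gen_equiv (path_chain (chartL c) m n) 0"
  unfolding gen_equiv_def using hom_chart_path by fastforce

text \<open>A path from a Lagrangian to a fixed nondegenerate matrix of some chart. Up to multiples of the generator its class is a
  potential: the class of any path is the difference of the potentials of its end points.\<close>

definition to_base :: "phase set \<Rightarrow> phase set chain" where
  "to_base W = (let c = SOME c. lag_transverse om W (ch.K c) in path_chain (chartL c) (ch.coords c W) (1, 0, 1))"

lemma sym_det_base: "sym_det (1, 0, 1) \<noteq> 0" by (simp add: sym_det_def)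

text \<open>Along the identity direction the determinant is a monic quadratic polynomial.\<close>

lemma exists_small_nondegenerate:
  assumes "0 < (e::real)"
  obtains s where "0 < s" "s \<le> e" "sym_det (m + s *\<^sub>R (1, 0, 1)) \<noteq> 0"
proof -
  obtain x y z where m: "m = (x, y, z)" by (cases m)
  let ?p = "\<lambda>s. (x * z - y\<^sup>2) + (x + z) * s + s\<^sup>2"
  have det: "sym_det (m + s *\<^sub>R (1, 0, 1)) = ?p s" for s
    by (simp add: m sym_det_def power2_eq_square algebra_simps)
  note obt = that
  show ?thesis
  proof (rule ccontr)
    assume neg: "\<not> thesis"
    have 0: "?p s = 0" if s: "0 < s" "s \<le> e" for s
    proof (rule ccontr)
      assume "?p s \<noteq> 0"
      then have "sym_det (m + s *\<^sub>R (1, 0, 1)) \<noteq> 0" by (simp only: det not_False_eq_True)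
      then have thesis by (rule obt[OF s])
      with neg show False ..
    qed
    \<comment> \<open>a monic quadratic polynomial cannot vanish at three points\<close>
    have "?p e = 0" "?p (e/2) = 0" "?p (e/4) = 0" by (rule 0; use assms in simp)+
    moreover have "D + T * e + e\<^sup>2 - 3 * (D + T * (e/2) + (e/2)\<^sup>2) + 2 * (D + T * (e/4) + (e/4)\<^sup>2)
        = 3/8 * e\<^sup>2" for D T by (simp add: power2_eq_square field_simps)
    note this[of "x * z - y\<^sup>2" "x + z"]
    ultimately have "e\<^sup>2 = 0" by simp
    then show False using assms by simp
  qed
qed

text \<open>The potential does not depend on the chart: a short path leaves the Lagrangian inside both
  chart domains and ends at a Lagrangian transverse to \<open>L0\<close>; after that only paths between nondegenerate
  matrices remain, and these are multiples of the generator.\<close>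

lemma gen_equiv_to_base:
  assumes n: "sym_det n \<noteq> 0"
  shows "gen_equiv (path_chain (chartL c) m n) (to_base (chartL c m))"
proof -
  define W where "W = chartL c m"
  \<comment> \<open>\<open>c\'\<close> is the chart used by \<open>to_base\<close>, in general different from \<open>c\<close>\<close>
  define c' where "c' = (SOME c. lag_transverse om W (ch.K c))"
  have tr: "lag_transverse om W (ch.K c')"
    unfolding c'_def by (rule someI_ex) (use exists_chart[of W] lagrangian_chartL W_def in metis)
  define \<zeta> where "\<zeta> s = chartL c (m + s *\<^sub>R (1, 0, 1))" for s
  have cont: "continuous_map (top_of_set {0..1}) Lam \<zeta>"
    unfolding \<zeta>_def by (intro continuous_map_chartL continuous_intros)
  let ?T = "{s \<in> {0..1}. lag_transverse om (\<zeta> s) (ch.K c')}"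
  have op: "openin (top_of_set {0..1}) ?T" by (rule ch.openin_transverse_preimage[OF cont])
  have \<zeta>0: "\<zeta> 0 = W" unfolding \<zeta>_def W_def scaleR_zero_left add_0_right ..
  have "0 \<in> ?T" using tr by (simp add: \<zeta>0)
  then obtain d where d: "d > 0" "ball 0 d \<inter> {0..1} \<subseteq> ?T"
    using op unfolding openin_contains_ball by blast
  then have T: "{0..min (d/2) 1} \<subseteq> ?T" by (auto simp: subset_iff dist_real_def)
  obtain e where e: "0 < e" "e \<le> min (d/2) 1" "sym_det (m + e *\<^sub>R (1, 0, 1)) \<noteq> 0"
    using exists_small_nondegenerate[of "min (d/2) 1" m] d(1) by auto
  \<comment> \<open>the same short path in the coordinates of the other chart\<close>
  define w where "w s = ch.coords c' (\<zeta> s)" for s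
  have Fw: "chartL c' (w s) = \<zeta> s" if "s \<in> {0..e}" for s
  proof -
    have "s \<in> {0..min (d/2) 1}" using that e(2) by auto
    then have "s \<in> ?T" using T by blast
    then have "lag_transverse om (\<zeta> s) (ch.K c')" by blast
    then show ?thesis unfolding chartL_def w_def by (rule ch.graph_coords)
  qed
  have contw: "continuous_on (closed_segment 0 e) w"
    unfolding w_def
    by (rule continuous_on_subset[OF ch.continuous_on_coords[OF cont]])
      (use T e in \<open>auto simp: closed_segment_eq_real_ivl subset_iff\<close>)
  have we: "sym_det (w e) \<noteq> 0"
    using Fw[of e] e(1,3) chartL_Lam0_iff[of c' "w e"] chartL_Lam0_iff[of c "m + e *\<^sub>R (1, 0, 1)"] by (simp add: \<zeta>_def)
  have w0: "w 0 = ch.coords c' W" by (simp add: w_def \<zeta>0)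
  have "continuous_on (closed_segment 0 e) (\<lambda>s. m + s *\<^sub>R (1, 0, 1))" by (intro continuous_intros)
  from hom_sym[OF hom_straighten[OF this, of c]]
  have "homologous (path_chain (chartL c) m (m + e *\<^sub>R (1, 0, 1))) (path_chain \<zeta> 0 e)"
    unfolding scaleR_zero_left add_0_right \<zeta>_def .
  also have "simplex_path \<zeta> 0 e = simplex_path (\<lambda>s. chartL c' (w s)) 0 e"
  proof (rule simplex_path_eqI)
    fix u :: real assume "u \<in> {0..1}"
    then have "(1 - u) *\<^sub>R 0 + u *\<^sub>R e \<in> {0..e}" using e(1) by (simp add: mult_left_le_one_le)
    then show "\<zeta> ((1 - u) *\<^sub>R 0 + u *\<^sub>R e) = chartL c' (w ((1 - u) *\<^sub>R 0 + u *\<^sub>R e))"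
      by (rule Fw[symmetric])
  qed
  also have "homologous (path_chain (\<lambda>s. chartL c' (w s)) 0 e) (path_chain (chartL c') (w 0) (w e))"
    by (rule hom_straighten[OF contw])
  finally have short: "gen_equiv (path_chain (chartL c) m (m + e *\<^sub>R (1, 0, 1))) (path_chain (chartL c') (w 0) (w e))"
    by (rule hom_imp_gen_equiv)
  have "gen_equiv (path_chain (chartL c) m n) (path_chain (chartL c) m (m + e *\<^sub>R (1, 0, 1)) + path_chain (chartL c) (m + e *\<^sub>R (1, 0, 1)) n)"
    by (rule hom_imp_gen_equiv[OF hom_sym[OF hom_chartL_triangle]])
  also have "gen_equiv \<dots> (path_chain (chartL c') (w 0) (w e) + 0)"
    by (rule gen_equiv_add[OF short gen_equiv_chart_path[OF e(3) n]])
  also have "gen_equiv \<dots> (path_chain (chartL c') (w 0) (w e) + path_chain (chartL c') (w e) (1, 0, 1))"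
    by (rule gen_equiv_add[OF gen_equiv_refl gen_equiv_sym[OF gen_equiv_chart_path[OF we sym_det_base]]])
  also have "gen_equiv \<dots> (path_chain (chartL c') (w 0) (1, 0, 1))"
    by (rule hom_imp_gen_equiv[OF hom_chartL_triangle])
  finally show ?thesis by (simp add: to_base_def c'_def[symmetric] W_def[symmetric] w0)
qed

lemma gen_equiv_local:
  fixes s t :: real
  assumes cont: "continuous_map (top_of_set {s..t}) Lam \<sigma>" and st: "s \<le> t"
    and tr: "\<And>x. x \<in> {s..t} \<Longrightarrow> lag_transverse om (\<sigma> x) (ch.K c)"
  shows "gen_equiv (path_chain \<sigma> s t) (to_base (\<sigma> s) - to_base (\<sigma> t))"
proof -
  define w where "w x = ch.coords c (\<sigma> x)" for x
  have Fw: "chartL c (w x) = \<sigma> x" if "x \<in> {s..t}" for x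
    unfolding chartL_def w_def by (rule ch.graph_coords[OF tr[OF that]])
  have contw: "continuous_on (closed_segment s t) w"
    unfolding w_def
    by (rule continuous_on_subset[OF ch.continuous_on_coords[OF cont]])
      (use tr st in \<open>auto simp: closed_segment_eq_real_ivl\<close>)
  have "simplex_path \<sigma> s t = simplex_path (\<lambda>x. chartL c (w x)) s t"
  proof (rule simplex_path_eqI)
    fix u :: real assume "u \<in> {0..1}"
    then have "(1 - u) *\<^sub>R s + u *\<^sub>R t \<in> closed_segment s t" unfolding closed_segment_def by auto
    then show "\<sigma> ((1 - u) *\<^sub>R s + u *\<^sub>R t) = chartL c (w ((1 - u) *\<^sub>R s + u *\<^sub>R t))"
      using st by (intro Fw[symmetric]) (simp add: closed_segment_eq_real_ivl)
  qed
  then have "gen_equiv (path_chain \<sigma> s t) (path_chain (chartL c) (w s) (w t))"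
    by (simp add: hom_imp_gen_equiv hom_straighten[OF contw])
  also have "path_chain (chartL c) (w s) (w t) = path_chain (chartL c) (w s) (w t) + path_chain (chartL c) (w t) (1, 0, 1) - path_chain (chartL c) (w t) (1, 0, 1)"
    by simp
  also have "gen_equiv \<dots> (path_chain (chartL c) (w s) (1, 0, 1) - path_chain (chartL c) (w t) (1, 0, 1))"
    by (rule gen_equiv_diff[OF hom_imp_gen_equiv[OF hom_chartL_triangle] gen_equiv_refl])
  also have "gen_equiv \<dots> (to_base (chartL c (w s)) - to_base (chartL c (w t)))"
    by (rule gen_equiv_diff[OF gen_equiv_to_base gen_equiv_to_base]) (simp_all add: sym_det_base)
  finally show ?thesis using st by (simp add: Fw)
qed

text \<open>Every point of the path has a neighbourhood inside one chart, and the potential differences add up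
  under subdivision.\<close>

lemma gen_equiv_path:
  fixes a b :: real
  assumes cont: "continuous_map (top_of_set {a..b}) Lam \<sigma>" and ab: "a \<le> b"
  shows "gen_equiv (path_chain \<sigma> a b) (to_base (\<sigma> a) - to_base (\<sigma> b))"
proof -
  define P where "P s t \<longleftrightarrow> (a \<le> s \<and> s \<le> t \<and> t \<le> b \<longrightarrow> gen_equiv (path_chain \<sigma> s t) (to_base (\<sigma> s) - to_base (\<sigma> t)))" for s t
  have "P a b"
    using ab
  proof (induction rule: Bolzano)
    case (trans x y z)
    show ?case unfolding P_def
    proof
      assume xz: "a \<le> x \<and> x \<le> z \<and> z \<le> b"
      have "gen_equiv (path_chain \<sigma> x z) (path_chain \<sigma> x y + path_chain \<sigma> y z)"
        by (rule hom_imp_gen_equiv[OF hom_sym[OF hom_triangle[OF cont]]]) (use xz trans in auto)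
      also have "gen_equiv \<dots> ((to_base (\<sigma> x) - to_base (\<sigma> y)) + (to_base (\<sigma> y) - to_base (\<sigma> z)))"
        by (rule gen_equiv_add) (use xz trans in \<open>auto simp: P_def\<close>)
      finally show "gen_equiv (path_chain \<sigma> x z) (to_base (\<sigma> x) - to_base (\<sigma> z))" by simp
    qed
  next
    case (local x)
    have "\<sigma> x \<in> topspace Lam" using continuous_map_image_subset_topspace[OF cont] local by auto
    then obtain c where c: "lag_transverse om (\<sigma> x) (ch.K c)"
      using exists_chart by (auto simp: topspace_Lam)
    let ?T = "{s \<in> {a..b}. lag_transverse om (\<sigma> s) (ch.K c)}"
    have "openin (top_of_set {a..b}) ?T" by (rule ch.openin_transverse_preimage[OF cont])
    moreover have "x \<in> ?T" using local c by auto
    ultimately obtain d where d: "d > 0" "ball x d \<inter> {a..b} \<subseteq> ?T"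
      unfolding openin_contains_ball by blast
    have "P s t" if "s \<le> x \<and> x \<le> t \<and> t - s < d" for s t
      unfolding P_def
    proof
      assume st: "a \<le> s \<and> s \<le> t \<and> t \<le> b"
      have sub: "{s..t} \<subseteq> ?T"
        using that st by (intro subset_trans[OF _ d(2)]) (auto simp: dist_real_def)
      have "continuous_map (top_of_set {s..t}) Lam \<sigma>"
        using continuous_map_from_subtopology_mono[OF cont] st by auto
      then show "gen_equiv (path_chain \<sigma> s t) (to_base (\<sigma> s) - to_base (\<sigma> t))"
        by (rule gen_equiv_local[of _ _ _ c]) (use st sub in auto)
    qed
    then show ?case using d(1) by blast
  qed
  then show ?thesis using ab by (simp add: P_def)
qed

text \<open>Barycentric coordinates on the standard 1-simplex.\<close>

definition edge :: "real \<Rightarrow> nat \<Rightarrow> real" where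
  "edge t = (\<lambda>i. if i = 0 then 1 - t else if i = 1 then t else 0)"

lemma edge_in: "t \<in> {0..1} \<Longrightarrow> edge t \<in> standard_simplex (Suc 0)"
  by (simp add: standard_simplex_Suc_0_iff edge_def)

lemma simplex_1_eq_edge: "x \<in> standard_simplex (Suc 0) \<Longrightarrow> x = edge (x 1)"
  by (auto simp: fun_eq_iff edge_def standard_simplex_Suc_0_iff)

lemma continuous_map_edge:
  assumes "singular_simplex (Suc 0) X \<sigma>"
  shows "continuous_map (top_of_set {0..1}) X (\<lambda>t. \<sigma> (edge t))"
proof -
  have "continuous_map (top_of_set {0..1}) (powertop_real UNIV) edge"
    unfolding continuous_map_componentwise_UNIV
  proof
    fix k :: nat
    show "continuous_map (top_of_set {0..1}) euclideanreal (\<lambda>t. edge t k)"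
      unfolding edge_def by (cases "k = 0"; cases "k = 1") (auto intro!: continuous_intros)
  qed
  then have "continuous_map (top_of_set {0..1}) (subtopology (powertop_real UNIV) (standard_simplex (Suc 0))) edge"
    using edge_in by (auto simp: continuous_map_in_subtopology)
  from continuous_map_compose[OF this] show ?thesis
    using assms unfolding singular_simplex_def by (auto simp: o_def)
qed

lemma simplex_path_edge:
  assumes "singular_simplex (Suc 0) X \<sigma>"
  shows "\<sigma> = simplex_path (\<lambda>t. \<sigma> (edge t)) (0::real) 1"
proof
  fix x
  show "\<sigma> x = simplex_path (\<lambda>t. \<sigma> (edge t)) (0::real) 1 x"
  proof (cases "x \<in> standard_simplex (Suc 0)")
    case True
    then show ?thesis using simplex_1_eq_edge[OF True] by (simp add: simplex_path_def)
  next
    case False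
    have "\<sigma> \<in> extensional (standard_simplex (Suc 0))" using assms by (simp only: singular_simplex_def)
    then have "\<sigma> x = undefined" using False by (rule extensional_arb)
    then show ?thesis using False by (simp add: simplex_path_def)
  qed
qed

lemma gen_equiv_simplex:
  assumes "singular_simplex (Suc 0) Lam \<sigma>"
  shows "gen_equiv (frag_of \<sigma>) (to_base (\<sigma> (edge 0)) - to_base (\<sigma> (edge 1)))"
  using gen_equiv_path[OF continuous_map_edge[OF assms]] simplex_path_edge[OF assms] by simp

definition boundary_to_base :: "phase set chain \<Rightarrow> phase set chain" where
  "boundary_to_base = frag_extend (\<lambda>\<tau>. to_base (\<tau> (edge 0)))"

lemma standard_simplex_0_edge: "standard_simplex 0 = {edge 0}"
  by (auto simp: standard_simplex_0 edge_def fun_eq_iff)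

lemma singular_face_1:
  "singular_face (Suc 0) 0 \<sigma> (edge 0) = \<sigma> (edge 1)" "singular_face (Suc 0) (Suc 0) \<sigma> (edge 0) = \<sigma> (edge 0)"
proof -
  have "simplical_face 0 (edge 0) = edge 1" "simplical_face (Suc 0) (edge 0) = edge 0"
    by (auto simp: simplical_face_def edge_def fun_eq_iff)
  then show "singular_face (Suc 0) 0 \<sigma> (edge 0) = \<sigma> (edge 1)" "singular_face (Suc 0) (Suc 0) \<sigma> (edge 0) = \<sigma> (edge 0)"
    by (simp_all add: singular_face_def standard_simplex_0_edge)
qed

lemma gen_equiv_chain:
  assumes "singular_chain (Suc 0) Lam z"
  shows "gen_equiv z (- boundary_to_base (chain_boundary (Suc 0) z))"
proof -
  have "Poly_Mapping.keys z \<subseteq> Collect (singular_simplex (Suc 0) Lam)"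
    using assms by (simp add: singular_chain_def)
  then show ?thesis
  proof (induction z rule: frag_induction)
    case zero then show ?case by (simp add: boundary_to_base_def)
  next
    case (one \<sigma>)
    have "boundary_to_base (chain_boundary (Suc 0) (frag_of \<sigma>)) = to_base (\<sigma> (edge 1)) - to_base (\<sigma> (edge 0))"
      by (simp add: boundary_to_base_def chain_boundary_of frag_extend_diff frag_extend_minus frag_extend_add singular_face_1)
    then show ?case using gen_equiv_simplex[of \<sigma>] one by simp
  next
    case (diff a b)
    then show ?case
      using gen_equiv_diff[OF diff] by (simp add: boundary_to_base_def chain_boundary_diff frag_extend_diff)
  qed
qed

lemma to_base_Lam0: "W \<in> Lam0 \<Longrightarrow> gen_equiv (to_base W) 0"
proof -
  assume W: "W \<in> Lam0"
  then have "lagrangian om W" by (simp add: lag_stratum_def)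
  then obtain c m where cm: "W = chartL c m" by (rule lagrangian_eq_chartL)
  then have "sym_det m \<noteq> 0" using W chartL_Lam0_iff by simp
  from gen_equiv_trans[OF gen_equiv_sym[OF gen_equiv_to_base[OF sym_det_base]] gen_equiv_chart_path[OF this sym_det_base]]
  show ?thesis unfolding cm .
qed

lemma boundary_to_base_Lam0:
  assumes "singular_chain 0 (subtopology Lam Lam0) z"
  shows "gen_equiv (boundary_to_base z) 0"
proof -
  have "Poly_Mapping.keys z \<subseteq> Collect (singular_simplex 0 (subtopology Lam Lam0))"
    using assms by (simp add: singular_chain_def)
  then show ?thesis
  proof (induction z rule: frag_induction)
    case zero then show ?case by (simp add: boundary_to_base_def)
  next
    case (one \<tau>)
    then have "\<tau> (edge 0) \<in> Lam0"
      by (auto simp: singular_simplex_subtopology standard_simplex_0_edge)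
    then show ?case by (simp add: boundary_to_base_def to_base_Lam0)
  next
    case (diff a b)
    then show ?case using gen_equiv_diff[OF diff] by (simp add: boundary_to_base_def frag_extend_diff)
  qed
qed

text \<open>A chain is equivalent to the potential of its boundary, up to sign, and the potential
  vanishes on Lagrangians transverse to \<open>L0\<close>.\<close>

theorem relcycle_multiple_of_gen:
  assumes "singular_relcycle 1 Lam Lam0 z"
  obtains k where "homologous z (frag_cmul k gen)"
proof -
  have z: "singular_chain (Suc 0) Lam z" "singular_chain 0 (subtopology Lam Lam0) (chain_boundary (Suc 0) z)"
    using assms by (simp_all add: singular_relcycle)
  have "gen_equiv z 0"
    using gen_equiv_trans[OF gen_equiv_chain[OF z(1)] gen_equiv_minus[OF boundary_to_base_Lam0[OF z(2)]]] by simp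
  then show ?thesis using that by (auto simp: gen_equiv_def)
qed

section \<open>The generator has infinite order\<close>

text \<open>Complex coordinates turning the symplectic form into the imaginary part of a Hermitian product.\<close>

definition zcoord1 :: "phase \<Rightarrow> complex" where "zcoord1 p = of_real (fst p$1) + \<i> * of_real (snd p$2)"
definition zcoord2 :: "phase \<Rightarrow> complex" where "zcoord2 p = of_real (fst p$2) + \<i> * of_real (snd p$1)"
definition zdet :: "phase \<Rightarrow> phase \<Rightarrow> complex" where
  "zdet u v = zcoord1 u * zcoord2 v - zcoord2 u * zcoord1 v"

lemma continuous_on_zdet [continuous_intros]:
  assumes "continuous_on S f" "continuous_on S g"
  shows "continuous_on S (\<lambda>x. zdet (f x) (g x))"
  unfolding zdet_def zcoord1_def zcoord2_def by (intro continuous_intros assms)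

text \<open>Lagrange's identity in the complex plane: the Gram determinant of the Hermitian product is the squared modulus of
  the determinant. For isotropic vectors the Hermitian product is real.\<close>

lemma gram_zdet: "(u \<bullet> u) * (v \<bullet> v) - (u \<bullet> v)\<^sup>2 = (cmod (zdet u v))\<^sup>2 + (om u v)\<^sup>2"
  unfolding cmod_power2
  by (simp add: zdet_def zcoord1_def zcoord2_def om_eq inner_prod_def inner_vec_def sum_2 power2_eq_square algebra_simps)

lemma zdet_nonzero:
  assumes ind: "indep2 u v" and iso: "om u v = 0"
  shows "zdet u v \<noteq> 0"
proof
  assume "zdet u v = 0"
  then have g: "(u \<bullet> u) * (v \<bullet> v) - (u \<bullet> v)\<^sup>2 = 0" using gram_zdet[of u v] iso by simp
  \<comment> \<open>\<open>v\<close> rescales the component of \<open>u\<close> orthogonal to it\<close>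
  define x where "x = (v \<bullet> v) *\<^sub>R u + (- (u \<bullet> v)) *\<^sub>R v"
  have "x \<bullet> x = (v \<bullet> v) * ((u \<bullet> u) * (v \<bullet> v) - (u \<bullet> v)\<^sup>2)"
    by (simp add: x_def inner_add_left inner_add_right inner_diff_left inner_diff_right inner_commute[of v u] power2_eq_square algebra_simps)
  then have "x = 0" using g by simp
  then have "v \<bullet> v = 0" using ind unfolding indep2_def x_def by blast
  then have "0 *\<^sub>R u + 1 *\<^sub>R v = 0" by simp
  then have "(1::real) = 0" using ind unfolding indep2_def by blast
  then show False by simp
qed

text \<open>The squared determinant, a map from the Lagrangian Grassmannian to the unit circle.\<close>

definition angle :: "phase set \<Rightarrow> complex" where
  "angle W = (SOME z. \<exists>u v. W = span {u, v} \<and> indep2 u v \<and> z = (zdet u v)\<^sup>2 / of_real ((cmod (zdet u v))\<^sup>2))"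

text \<open>A change of real basis multiplies the determinant by a nonzero real number, which disappears after
  squaring and normalising.\<close>

lemma angle_span:
  assumes uv: "indep2 u v" "om u v = 0"
  shows "angle (span {u, v}) = (zdet u v)\<^sup>2 / of_real ((cmod (zdet u v))\<^sup>2)"
proof -
  have "\<exists>z u' v'. span {u, v} = span {u', v'} \<and> indep2 u' v' \<and> z = (zdet u' v')\<^sup>2 / of_real ((cmod (zdet u' v'))\<^sup>2)"
    using uv by blast
  from someI_ex[OF this] obtain u' v' where s: "span {u, v} = span {u', v'}" "indep2 u' v'"
    and a: "angle (span {u, v}) = (zdet u' v')\<^sup>2 / of_real ((cmod (zdet u' v'))\<^sup>2)"
    unfolding angle_def by blast
  have "u' \<in> span {u, v}" "v' \<in> span {u, v}" using s by (simp_all add: span_base)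
  then obtain p q r t where e: "u' = p *\<^sub>R u + q *\<^sub>R v" "v' = r *\<^sub>R u + t *\<^sub>R v"
    unfolding span2_iff by blast
  define D where "D = p * t - q * r"
  have d: "zdet u' v' = of_real D * zdet u v"
    by (simp add: zdet_def zcoord1_def zcoord2_def e D_def algebra_simps)
  have "om u' v' = 0" using uv(2) om_skew[of u v] by (simp add: e om_simps)
  then have "zdet u' v' \<noteq> 0" using zdet_nonzero s by blast
  then have "D \<noteq> 0" using d by auto
  then show ?thesis
    unfolding a d by (simp add: norm_mult power_mult_distrib)
qed

lemma angle_nonzero: "lagrangian om W \<Longrightarrow> angle W \<noteq> 0"
proof -
  assume "lagrangian om W"
  then obtain u v where uv: "W = span {u, v}" "indep2 u v" "om u v = 0" by (rule lagrangian_obtain)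
  then show ?thesis using zdet_nonzero[OF uv(2,3)] by (simp add: angle_span)
qed

lemma continuous_on_angle:
  fixes f :: "'e::topological_space \<Rightarrow> phase set"
  assumes f: "continuous_map (top_of_set T) Lam f"
  shows "continuous_on T (\<lambda>t. angle (f t))"
  unfolding continuous_on_def
proof
  fix t assume t: "t \<in> T"
  have "f t \<in> topspace Lam" using continuous_map_image_subset_topspace[OF f] t by auto
  then have "lagrangian om (f t)" by (simp add: topspace_Lam)
  then obtain c where c: "lag_transverse om (f t) (ch.K c)" by (rule exists_chart)
  define T' where "T' = {s \<in> T. lag_transverse om (f s) (ch.K c)}"
  have "openin (top_of_set T) T'" unfolding T'_def by (rule ch.openin_transverse_preimage[OF f])
  then obtain U where U: "open U" "T' = T \<inter> U" by (auto simp: openin_open)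
  let ?m = "\<lambda>s. ch.coords c (f s)"
  let ?z = "\<lambda>s. zdet (ch.b1 c (?m s)) (ch.b2 c (?m s))"
  have m: "continuous_on T' ?m" unfolding T'_def by (rule ch.continuous_on_coords[OF f])
  have nz: "?z s \<noteq> 0" for s by (rule zdet_nonzero[OF ch.indep2_b ch.om_b])
  have "continuous_on T' (\<lambda>s. (?z s)\<^sup>2 / of_real ((cmod (?z s))\<^sup>2))"
    by (intro continuous_intros m ch.continuous_on_b) (simp add: nz)
  moreover have "(?z s)\<^sup>2 / of_real ((cmod (?z s))\<^sup>2) = angle (f s)" if "s \<in> T'" for s
  proof -
    have "lag_transverse om (f s) (ch.K c)" using that unfolding T'_def by blast
    from ch.graph_coords[OF this] have "f s = span {ch.b1 c (?m s), ch.b2 c (?m s)}"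
      by (simp only: ch.graph_def)
    then show ?thesis using angle_span[OF ch.indep2_b ch.om_b] by metis
  qed
  ultimately have "continuous_on T' (\<lambda>s. angle (f s))" by (rule continuous_on_eq)
  moreover have "t \<in> T'" using t c unfolding T'_def by blast
  ultimately have "((\<lambda>s. angle (f s)) \<longlongrightarrow> angle (f t)) (at t within T')"
    unfolding continuous_on_def by blast
  moreover have "at t within T' = at t within T"
    by (rule at_within_nhd[of _ U]) (use U \<open>t \<in> T'\<close> in auto)
  ultimately show "((\<lambda>s. angle (f s)) \<longlongrightarrow> angle (f t)) (at t within T)" by simp
qed

lemma log_difference_unique:
  fixes g h :: "real \<Rightarrow> complex"
  assumes g: "continuous_on {0..1} g" and h: "continuous_on {0..1} h"
    and eq: "\<And>t. t \<in> {0..1} \<Longrightarrow> exp (g t) = exp (h t)"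
  shows "g 1 - g 0 = h 1 - h 0"
proof -
  let ?k = "\<lambda>t. g t - h t"
  have "?k constant_on {0..1}"
  proof (rule continuous_discrete_range_constant)
    show "continuous_on {0..1} ?k" by (intro continuous_intros g h)
    fix x :: real assume x: "x \<in> {0..1}"
    show "\<exists>e>0. \<forall>y. y \<in> {0..1} \<and> ?k y \<noteq> ?k x \<longrightarrow> e \<le> cmod (?k y - ?k x)"
    proof (intro exI[of _ 1] conjI allI impI)
      fix y assume y: "y \<in> {0..1} \<and> ?k y \<noteq> ?k x"
      \<comment> \<open>two logarithms differ by a multiple of \<open>2 * pi * \<i>\<close>, so distinct values are at least \<open>1\<close> apart\<close>
      have "exp (?k y - ?k x) = 1" using eq[of x] eq[of y] x y by (simp add: exp_diff)
      then obtain n :: int where n: "Re (?k y - ?k x) = 0" "Im (?k y - ?k x) = of_int (2 * n) * pi"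
        unfolding exp_eq_1 by blast
      have "n \<noteq> 0"
      proof
        assume "n = 0"
        then have "?k y - ?k x = 0" using n by (simp add: complex_eq_iff)
        then show False using y by simp
      qed
      then have "1 \<le> \<bar>real_of_int (2 * n)\<bar> * pi"
        using pi_ge_two by (intro order_trans[OF _ mult_mono[of 1 _ 1 pi]]) (auto simp: abs_if)
      then have "1 \<le> \<bar>Im (?k y - ?k x)\<bar>" unfolding n(2) by (simp add: abs_mult)
      then show "1 \<le> cmod (?k y - ?k x)" using abs_Im_le_cmod order_trans by blast
    qed simp
  qed simp
  then obtain c where "\<And>t. t \<in> {0..1} \<Longrightarrow> ?k t = c" unfolding constant_on_def by blast
  from this[of 0] this[of 1] have "g 1 - h 1 = g 0 - h 0" by simp
  then show ?thesis by (simp add: algebra_simps)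
qed

text \<open>The increment of a continuous logarithm of the angle along a simplex.\<close>

definition variation :: "((nat \<Rightarrow> real) \<Rightarrow> phase set) \<Rightarrow> complex" where
  "variation \<sigma> = (SOME d. \<exists>g. continuous_on {0..1} g \<and>
     (\<forall>t\<in>{0..1}. angle (\<sigma> (edge t)) = exp (g t)) \<and> d = g 1 - g 0)"

lemma variation_eq:
  assumes "continuous_on {0..1} g" "\<And>t. t \<in> {0..1} \<Longrightarrow> angle (\<sigma> (edge t)) = exp (g t)"
  shows "variation \<sigma> = g 1 - g 0"
proof -
  have "\<exists>d g. continuous_on {0..1} g \<and> (\<forall>t\<in>{0..1}. angle (\<sigma> (edge t)) = exp (g t)) \<and> d = g 1 - g 0"
    using assms by blast
  from someI_ex[OF this] obtain h where h: "continuous_on {0..1} h"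
    "\<forall>t\<in>{0..1}. angle (\<sigma> (edge t)) = exp (h t)" "variation \<sigma> = h 1 - h 0"
    unfolding variation_def by blast
  then show ?thesis using log_difference_unique[OF assms(1) h(1)] assms(2) by metis
qed

text \<open>The Lagrangians transverse to \<open>L0\<close> form a contractible set, so the angle has a continuous logarithm there.\<close>

definition log_Lam0 :: "real \<times> real \<times> real \<Rightarrow> complex" where
  "log_Lam0 = (SOME h. continuous_on UNIV h \<and> (\<forall>m. angle (hz.graph m) = exp (h m)))"

lemma log_Lam0: "continuous_on UNIV log_Lam0" "angle (hz.graph m) = exp (log_Lam0 m)"
proof -
  have "continuous_map (top_of_set UNIV) Lam (\<lambda>m. hz.graph m)"
    by (rule hz.continuous_map_graph) (rule continuous_on_id)
  then have 1: "continuous_on UNIV (\<lambda>m. angle (hz.graph m))" by (rule continuous_on_angle)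
  have 2: "contractible (UNIV :: (real \<times> real \<times> real) set)"
    by (rule convex_imp_contractible) simp
  obtain g where "continuous_on UNIV g" "\<And>m. m \<in> UNIV \<Longrightarrow> angle (hz.graph m) = exp (g m)"
    by (rule continuous_logarithm_on_contractible[OF 1 2 angle_nonzero[OF hz.lagrangian_graph]]) blast
  then have "\<exists>h. continuous_on UNIV h \<and> (\<forall>m. angle (hz.graph m) = exp (h m))" by blast
  from someI_ex[OF this] show "continuous_on UNIV log_Lam0" "angle (hz.graph m) = exp (log_Lam0 m)"
    unfolding log_Lam0_def by blast+
qed

definition end_log :: "phase set \<Rightarrow> complex" where
  "end_log W = (if W \<in> Lam0 then log_Lam0 (hz.coords W) else 0)"

text \<open>Outside \<open>Lam0\<close> the end point correction may be any function of the end point, as it cancels in boundaries.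
  On \<open>Lam0\<close> it makes the winding of paths inside \<open>Lam0\<close> vanish.\<close>

definition winding :: "((nat \<Rightarrow> real) \<Rightarrow> phase set) \<Rightarrow> complex" where
  "winding \<sigma> = variation \<sigma> - (end_log (\<sigma> (edge 1)) - end_log (\<sigma> (edge 0)))"

lemma Lam0_graph:
  assumes "W \<in> Lam0" shows "hz.graph (hz.coords W) = W"
  using assms unfolding Lam0_iff by (intro hz.graph_coords) (simp only: hz_K)

lemma hz_graph_Lam0: "hz.graph m \<in> Lam0"
  using hz.graph_transverse[of m] unfolding Lam0_iff by (simp only: hz_K)

lemma winding_Lam0:
  assumes "singular_simplex (Suc 0) (subtopology Lam Lam0) \<sigma>"
  shows "winding \<sigma> = 0"
proof -
  have \<sigma>: "singular_simplex (Suc 0) Lam \<sigma>" "\<sigma> ` standard_simplex (Suc 0) \<subseteq> Lam0"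
    using assms by (simp_all add: singular_simplex_subtopology)
  have L: "\<sigma> (edge t) \<in> Lam0" if "t \<in> {0..1}" for t using \<sigma>(2) edge_in[OF that] by blast
  have "continuous_on {t \<in> {0..1}. lag_transverse om (\<sigma> (edge t)) hz.K} (\<lambda>t. hz.coords (\<sigma> (edge t)))"
    by (rule hz.continuous_on_coords[OF continuous_map_edge[OF \<sigma>(1)]])
  moreover have "{t \<in> {0..1}. lag_transverse om (\<sigma> (edge t)) hz.K} = {0..1}"
    using L unfolding Lam0_iff hz_K by blast
  ultimately have "continuous_on {0..1} (\<lambda>t. hz.coords (\<sigma> (edge t)))" by simp
  then have "continuous_on {0..1} (\<lambda>t. log_Lam0 (hz.coords (\<sigma> (edge t))))"
    by (intro continuous_on_compose2[OF log_Lam0(1)]) auto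
  moreover have "angle (\<sigma> (edge t)) = exp (log_Lam0 (hz.coords (\<sigma> (edge t))))" if "t \<in> {0..1}" for t
    using log_Lam0(2)[of "hz.coords (\<sigma> (edge t))"] Lam0_graph[OF L[OF that]] by simp
  ultimately have "variation \<sigma> = log_Lam0 (hz.coords (\<sigma> (edge 1))) - log_Lam0 (hz.coords (\<sigma> (edge 0)))"
    by (rule variation_eq)
  then show ?thesis using L[of 0] L[of 1] by (simp add: winding_def end_log_def)
qed

definition triangle :: "real \<times> real \<Rightarrow> nat \<Rightarrow> real" where
  "triangle = (\<lambda>(s, t) i. if i = 0 then 1 - s - t else if i = 1 then s else if i = 2 then t else 0)"

text \<open>A logarithm of the angle on the whole triangle computes the variation along all three sides.\<close>

lemma winding_boundary:
  assumes \<tau>: "singular_simplex 2 Lam \<tau>"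
  shows "winding (singular_face 2 0 \<tau>) - winding (singular_face 2 1 \<tau>) + winding (singular_face 2 2 \<tau>) = 0"
proof -
  define T :: "(real \<times> real) set" where "T = {p. 0 \<le> fst p \<and> 0 \<le> snd p \<and> fst p + snd p \<le> 1}"
  have cvx: "convex T"
  proof (rule convexI)
    fix x y and u v :: real assume xy: "x \<in> T" "y \<in> T" and uv: "0 \<le> u" "0 \<le> v" "u + v = 1"
    have "u * (fst x + snd x) + v * (fst y + snd y) \<le> u * 1 + v * 1"
      using xy uv by (intro add_mono mult_left_mono) (auto simp: T_def)
    then show "u *\<^sub>R x + v *\<^sub>R y \<in> T" using xy uv by (simp add: T_def algebra_simps)
  qed
  have tri: "triangle p \<in> standard_simplex 2" if "p \<in> T" for p
    using that by (cases p) (simp add: T_def triangle_def standard_simplex_2_iff)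
  have "continuous_map (top_of_set T) (powertop_real UNIV) triangle"
    unfolding continuous_map_componentwise_UNIV
  proof
    fix k :: nat
    show "continuous_map (top_of_set T) euclideanreal (\<lambda>p. triangle p k)"
      unfolding triangle_def case_prod_beta
      by (cases "k = 0"; cases "k = 1"; cases "k = 2") (auto intro!: continuous_intros)
  qed
  then have "continuous_map (top_of_set T) (subtopology (powertop_real UNIV) (standard_simplex 2)) triangle"
    using tri by (auto simp: continuous_map_in_subtopology)
  from continuous_map_compose[OF this]
  have f: "continuous_map (top_of_set T) Lam (\<lambda>p. \<tau> (triangle p))"
    using \<tau> unfolding singular_simplex_def by (auto simp: o_def)
  have "angle (\<tau> (triangle p)) \<noteq> 0" if "p \<in> T" for p
  proof -
    have "\<tau> (triangle p) \<in> topspace Lam" using continuous_map_image_subset_topspace[OF f] that by auto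
    then show ?thesis by (intro angle_nonzero) (simp add: topspace_Lam)
  qed
  then obtain G where G: "continuous_on T G" "\<And>p. p \<in> T \<Longrightarrow> angle (\<tau> (triangle p)) = exp (G p)"
    using continuous_logarithm_on_contractible[OF continuous_on_angle[OF f] convex_imp_contractible[OF cvx]] by blast
  have face: "singular_face 2 k \<tau> (edge t) = \<tau> (simplical_face k (edge t))" if "t \<in> {0..1}" for k t
    using edge_in[OF that] by (simp add: singular_face_def)
  have fe: "simplical_face 0 (edge t) = triangle (1 - t, t)" "simplical_face 1 (edge t) = triangle (0, t)"
    "simplical_face 2 (edge t) = triangle (t, 0)" for t
    by (auto simp: simplical_face_def edge_def triangle_def fun_eq_iff)
  have var: "variation (singular_face 2 k \<tau>) = G (e 1) - G (e 0)"
    if e: "continuous_on {0..1} e" "\<And>t. t \<in> {0..1} \<Longrightarrow> e t \<in> T"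
      "\<And>t. t \<in> {0..1} \<Longrightarrow> simplical_face k (edge t) = triangle (e t)" for k e
  proof (rule variation_eq)
    show "continuous_on {0..1} (\<lambda>t. G (e t))"
      by (rule continuous_on_compose2[OF G(1) e(1)]) (use e(2) in auto)
    fix t :: real assume t: "t \<in> {0..1}"
    show "angle (singular_face 2 k \<tau> (edge t)) = exp (G (e t))"
      unfolding face[OF t] e(3)[OF t] by (rule G(2)[OF e(2)[OF t]])
  qed
  have v0: "variation (singular_face 2 0 \<tau>) = G (1 - 1, 1) - G (1 - 0, 0)"
    by (rule var[of "\<lambda>t. (1 - t, t)"]) (auto simp: T_def fe intro!: continuous_intros)
  have v1: "variation (singular_face 2 1 \<tau>) = G (0, 1) - G (0, 0)"
    by (rule var[of "\<lambda>t. (0, t)"]) (auto simp: T_def fe[unfolded One_nat_def] intro!: continuous_intros)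
  have v2: "variation (singular_face 2 2 \<tau>) = G (1, 0) - G (0, 0)"
    by (rule var[of "\<lambda>t. (t, 0)"]) (auto simp: T_def fe intro!: continuous_intros)
  have ends: "singular_face 2 0 \<tau> (edge 1) = \<tau> (triangle (0, 1))" "singular_face 2 0 \<tau> (edge 0) = \<tau> (triangle (1, 0))"
    "singular_face 2 1 \<tau> (edge 1) = \<tau> (triangle (0, 1))" "singular_face 2 1 \<tau> (edge 0) = \<tau> (triangle (0, 0))"
    "singular_face 2 2 \<tau> (edge 1) = \<tau> (triangle (1, 0))" "singular_face 2 2 \<tau> (edge 0) = \<tau> (triangle (0, 0))"
    by (simp_all only: face[of 0, simplified] face[of 1, simplified] fe) simp_all
  show ?thesis unfolding winding_def v0 v1 v2 ends by simp
qed

definition winding_chain :: "phase set chain \<Rightarrow> complex" where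
  "winding_chain z = (\<Sum>\<sigma>\<in>Poly_Mapping.keys z. of_int (Poly_Mapping.lookup z \<sigma>) * winding \<sigma>)"

lemma winding_chain_superset:
  assumes "finite A" "Poly_Mapping.keys z \<subseteq> A"
  shows "winding_chain z = (\<Sum>\<sigma>\<in>A. of_int (Poly_Mapping.lookup z \<sigma>) * winding \<sigma>)"
  unfolding winding_chain_def
  by (rule sum.mono_neutral_left) (use assms in \<open>auto simp: in_keys_iff\<close>)

lemma winding_chain_diff: "winding_chain (a - b) = winding_chain a - winding_chain b"
proof -
  let ?A = "Poly_Mapping.keys a \<union> Poly_Mapping.keys b"
  have "winding_chain (a - b) = (\<Sum>\<sigma>\<in>?A. of_int (Poly_Mapping.lookup (a - b) \<sigma>) * winding \<sigma>)"
    by (rule winding_chain_superset) (use keys_diff[of a b] in auto)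
  also have "\<dots> = (\<Sum>\<sigma>\<in>?A. of_int (Poly_Mapping.lookup a \<sigma>) * winding \<sigma>)
      - (\<Sum>\<sigma>\<in>?A. of_int (Poly_Mapping.lookup b \<sigma>) * winding \<sigma>)"
    by (simp add: lookup_minus left_diff_distrib sum_subtractf)
  also have "\<dots> = winding_chain a - winding_chain b"
    using winding_chain_superset[of ?A a] winding_chain_superset[of ?A b] by simp
  finally show ?thesis .
qed

lemma winding_chain_0 [simp]: "winding_chain 0 = 0" by (simp add: winding_chain_def)

lemma winding_chain_minus: "winding_chain (- a) = - winding_chain a"
  using winding_chain_diff[of 0 a] by simp

lemma winding_chain_add: "winding_chain (a + b) = winding_chain a + winding_chain b"
  using winding_chain_diff[of a "- b"] by (simp add: winding_chain_minus)

lemma winding_chain_of [simp]: "winding_chain (frag_of \<sigma>) = winding \<sigma>"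
  by (simp add: winding_chain_def)

lemma winding_chain_cmul_of: "winding_chain (frag_cmul k (frag_of \<sigma>)) = of_int k * winding \<sigma>"
  by (subst winding_chain_superset[of "{\<sigma>}"]) (auto simp: keys_cmul)

lemma winding_chain_boundary:
  assumes "singular_chain 2 Lam d"
  shows "winding_chain (chain_boundary 2 d) = 0"
proof -
  have "Poly_Mapping.keys d \<subseteq> Collect (singular_simplex 2 Lam)"
    using assms by (simp add: singular_chain_def)
  then show ?thesis
  proof (induction d rule: frag_induction)
    case (one \<tau>)
    have "chain_boundary 2 (frag_of \<tau>) = frag_of (singular_face 2 0 \<tau>) - frag_of (singular_face 2 1 \<tau>)
      + frag_of (singular_face 2 2 \<tau>)"
      by (simp add: chain_boundary_of numeral_2_eq_2)
    then show ?case using winding_boundary[of \<tau>] one by (simp add: winding_chain_add winding_chain_diff)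
  qed (simp_all add: chain_boundary_diff winding_chain_diff)
qed

lemma winding_chain_Lam0:
  assumes "singular_chain (Suc 0) (subtopology Lam Lam0) e"
  shows "winding_chain e = 0"
proof -
  have "Poly_Mapping.keys e \<subseteq> Collect (singular_simplex (Suc 0) (subtopology Lam Lam0))"
    using assms by (simp add: singular_chain_def)
  then show ?thesis
    by (induction e rule: frag_induction) (simp_all add: winding_Lam0 winding_chain_diff)
qed

lemma exp_arctan: "exp (- 2 * \<i> * of_real (arctan r)) = (1 - \<i> * of_real r)\<^sup>2 / of_real (1 + r\<^sup>2)"
proof -
  have pos: "1 + r\<^sup>2 > 0" by (simp add: add_pos_nonneg)
  have "exp (\<i> * of_real (- arctan r)) = (1 - \<i> * of_real r) / of_real (sqrt (1 + r\<^sup>2))"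
    unfolding cis_conv_exp[symmetric] by (simp add: complex_eq_iff cos_arctan sin_arctan)
  then have "(exp (\<i> * of_real (- arctan r)))\<^sup>2 = (1 - \<i> * of_real r)\<^sup>2 / of_real ((sqrt (1 + r\<^sup>2))\<^sup>2)"
    by (simp only: power_divide of_real_power)
  moreover have "(sqrt (1 + r\<^sup>2))\<^sup>2 = 1 + r\<^sup>2" using pos by simp
  moreover have "(exp (\<i> * of_real (- arctan r)))\<^sup>2 = exp (- 2 * \<i> * of_real (arctan r))"
    by (simp add: exp_double[symmetric] mult.assoc)
  ultimately show ?thesis by (simp only:)
qed

lemma cancel_two: "2 * x * y / of_real (2 * r) = x * (y / of_real r)" for x y :: complex and r :: real
  by simp

lemma angle_chartL_diag:
  "angle (chartL 0 (s, 0, -1)) = \<i> * exp (- 2 * \<i> * of_real (arctan s))"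
proof -
  have z: "zdet (ch.b1 0 (s, 0, -1)) (ch.b2 0 (s, 0, -1)) = (1 - \<i>) * (of_real s + \<i>)"
    unfolding ch_b by (simp add: zdet_def zcoord1_def zcoord2_def algebra_simps)
  have n: "(cmod ((1 - \<i>) * (of_real s + \<i>)))\<^sup>2 = 2 * (1 + s\<^sup>2)"
    unfolding norm_mult power_mult_distrib cmod_power2 by simp
  have sq: "((1 - \<i>) * (of_real s + \<i>))\<^sup>2 = 2 * \<i> * (1 - \<i> * of_real s)\<^sup>2"
    by (simp add: power2_eq_square complex_eq_iff algebra_simps)
  have "angle (chartL 0 (s, 0, -1)) = ((1 - \<i>) * (of_real s + \<i>))\<^sup>2 / of_real (2 * (1 + s\<^sup>2))"
    unfolding chartL_def ch.graph_def angle_span[OF ch.indep2_b ch.om_b] z n ..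
  also have "\<dots> = \<i> * ((1 - \<i> * of_real s)\<^sup>2 / of_real (1 + s\<^sup>2))"
    unfolding sq by (rule cancel_two)
  finally show ?thesis unfolding exp_arctan .
qed

lemma angle_hz_diag:
  "angle (hz.graph (1, 0, r)) = - \<i> * exp (- 2 * \<i> * of_real (arctan r))"
proof -
  have z: "zdet (hz.b1 (1, 0, r)) (hz.b2 (1, 0, r)) = (1 - \<i>) * (1 - \<i> * of_real r)"
    unfolding hz_b by (simp add: zdet_def zcoord1_def zcoord2_def algebra_simps)
  have n: "(cmod ((1 - \<i>) * (1 - \<i> * of_real r)))\<^sup>2 = 2 * (1 + r\<^sup>2)"
    unfolding norm_mult power_mult_distrib cmod_power2 by simp
  have sq: "((1 - \<i>) * (1 - \<i> * of_real r))\<^sup>2 = 2 * (- \<i>) * (1 - \<i> * of_real r)\<^sup>2"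
    by (simp add: power2_eq_square complex_eq_iff algebra_simps)
  have "angle (hz.graph (1, 0, r)) = ((1 - \<i>) * (1 - \<i> * of_real r))\<^sup>2 / of_real (2 * (1 + r\<^sup>2))"
    unfolding hz.graph_def angle_span[OF hz.indep2_b hz.om_b] z n ..
  also have "\<dots> = - \<i> * ((1 - \<i> * of_real r)\<^sup>2 / of_real (1 + r\<^sup>2))"
    unfolding sq by (rule cancel_two)
  finally show ?thesis unfolding exp_arctan .
qed

lemma chartL_eq_hz: 
  assumes "s = 1 \<or> s = -1" shows "chartL 0 (s, 0, -1) = hz.graph (1, 0, - s)"
proof -
  have sub: "hz.graph (1, 0, - s) \<subseteq> chartL 0 (s, 0, -1)"
    unfolding hz.graph_def
  proof (rule span_minimal)
    have "(vec2 1 0, vec2 0 (-1)) = 0 *\<^sub>R (vec2 0 s, vec2 1 0) + (-1) *\<^sub>R (vec2 (-1) 0, vec2 0 1)"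
      "(vec2 0 1, vec2 s 0) = s *\<^sub>R (vec2 0 s, vec2 1 0) + 0 *\<^sub>R (vec2 (-1) 0, vec2 0 1)"
      using assms by (auto simp: prod_eq_iff vec2_eq_iff)
    then have "(vec2 1 0, vec2 0 (-1)) \<in> chartL 0 (s, 0, -1)" "(vec2 0 1, vec2 s 0) \<in> chartL 0 (s, 0, -1)"
      unfolding chartL_def ch.graph_def ch_b span2_iff by (simp_all only: mult_zero_left add_0_right) blast+
    then show "{hz.b1 (1, 0, - s), hz.b2 (1, 0, - s)} \<subseteq> chartL 0 (s, 0, -1)"
      by (simp add: hz_b)
  qed (use lagrangian_chartL[of 0 "(s, 0, -1)"] in \<open>simp add: lagrangian_def\<close>)
  have "dim (chartL 0 (s, 0, -1)) \<le> dim (hz.graph (1, 0, - s))"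
    by (simp only: lagrangian_dim[OF lagrangian_chartL] lagrangian_dim[OF hz.lagrangian_graph])
  then have "hz.graph (1, 0, - s) = chartL 0 (s, 0, -1)"
    using lagrangian_chartL[of 0 "(s, 0, -1)"] hz.lagrangian_graph[of "(1, 0, - s)"] unfolding lagrangian_def
    by (intro subspace_dim_equal[OF _ _ sub]) blast+
  then show ?thesis by simp
qed

text \<open>On the generator the angle turns by \<open>- pi\<close>, and so it does on a path in \<open>Lam0\<close> closing it up,
  along which the reciprocal of the moving eigenvalue runs through \<open>0\<close>.\<close>

lemma winding_gen: "winding (simplex_path (chartL 0) (-1, 0, -1) (1, 0, -1)) = - 2 * \<i> * of_real pi"
proof -
  let ?\<sigma> = "simplex_path (chartL 0) (-1, 0, -1) (1, 0, -1)"
  have \<sigma>: "?\<sigma> (edge t) = chartL 0 (2 * t - 1, 0, -1)" if "t \<in> {0..1}" for t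
    using edge_in[OF that] by (simp add: simplex_path_def edge_def)
  have v: "variation ?\<sigma> = (\<i> * of_real (pi / 2) - 2 * \<i> * of_real (arctan (2 * 1 - 1)))
      - (\<i> * of_real (pi / 2) - 2 * \<i> * of_real (arctan (2 * 0 - 1)))"
  proof (rule variation_eq[of "\<lambda>t. \<i> * of_real (pi / 2) - 2 * \<i> * of_real (arctan (2 * t - 1))"])
    show "continuous_on {0..1} (\<lambda>t. \<i> * of_real (pi / 2) - 2 * \<i> * of_real (arctan (2 * t - 1)))"
      by (intro continuous_intros)
    fix t :: real assume "t \<in> {0..1}"
    have "exp (\<i> * of_real (pi / 2) - 2 * \<i> * of_real (arctan (2 * t - 1)))
        = exp (\<i> * of_real (pi / 2)) * exp (- 2 * \<i> * of_real (arctan (2 * t - 1)))"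
      by (simp add: exp_add[symmetric])
    also have "exp (\<i> * of_real (pi / 2)) = \<i>"
      unfolding cis_conv_exp[symmetric] by simp
    finally show "angle (?\<sigma> (edge t)) = exp (\<i> * of_real (pi / 2) - 2 * \<i> * of_real (arctan (2 * t - 1)))"
      unfolding \<sigma>[OF \<open>t \<in> {0..1}\<close>] angle_chartL_diag by simp
  qed
  have e: "end_log (chartL 0 (s, 0, -1)) = log_Lam0 (1, 0, - s)" if "s = 1 \<or> s = -1" for s
    unfolding chartL_eq_hz[OF that] end_log_def using hz_graph_Lam0 hz.coords_graph by simp
  have "log_Lam0 (1, 0, 2 * 1 - 1) - log_Lam0 (1, 0, 2 * 0 - 1) =
     (- \<i> * of_real (pi / 2) - 2 * \<i> * of_real (arctan (2 * 1 - 1)))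
      - (- \<i> * of_real (pi / 2) - 2 * \<i> * of_real (arctan (2 * 0 - 1)))"
  proof (rule log_difference_unique[of "\<lambda>t. log_Lam0 (1, 0, 2 * t - 1)"
      "\<lambda>t. - \<i> * of_real (pi / 2) - 2 * \<i> * of_real (arctan (2 * t - 1))"])
    show "continuous_on {0..1} (\<lambda>t. log_Lam0 (1, 0, 2 * t - 1))"
      by (intro continuous_on_compose2[OF log_Lam0(1)] continuous_intros) auto
    show "continuous_on {0..1} (\<lambda>t. - \<i> * of_real (pi / 2) - 2 * \<i> * of_real (arctan (2 * t - 1)))"
      by (intro continuous_intros)
    fix t :: real
    have "exp (- \<i> * of_real (pi / 2) - 2 * \<i> * of_real (arctan (2 * t - 1)))
        = exp (\<i> * of_real (- pi / 2)) * exp (- 2 * \<i> * of_real (arctan (2 * t - 1)))"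
      by (simp add: exp_add[symmetric])
    also have "exp (\<i> * of_real (- pi / 2)) = - \<i>"
      by (simp only: cis_conv_exp[symmetric]) (simp add: complex_eq_iff)
    finally show "exp (log_Lam0 (1, 0, 2 * t - 1)) =
        exp (- \<i> * of_real (pi / 2) - 2 * \<i> * of_real (arctan (2 * t - 1)))"
      using log_Lam0(2)[of "(1, 0, 2 * t - 1)"] angle_hz_diag[of "2 * t - 1"] by simp
  qed
  then have l: "log_Lam0 (1, 0, 1) - log_Lam0 (1, 0, -1) = - \<i> * of_real pi"
    by (simp add: arctan_one arctan_minus algebra_simps)
  have "winding ?\<sigma> = variation ?\<sigma> - (log_Lam0 (1, 0, -1) - log_Lam0 (1, 0, 1))"
    unfolding winding_def using \<sigma>[of 0] \<sigma>[of 1] e[of 1] e[of "-1"] by simp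
  also have "\<dots> = - \<i> * of_real pi + (log_Lam0 (1, 0, 1) - log_Lam0 (1, 0, -1))"
    unfolding v by (simp add: arctan_one arctan_minus algebra_simps)
  finally show ?thesis unfolding l by simp
qed

theorem gen_infinite_order:
  assumes "homologous (frag_cmul k gen) 0" shows "k = 0"
proof -
  obtain d e where d: "singular_chain (Suc 1) Lam d" and e: "singular_chain 1 (subtopology Lam Lam0) e"
    and eq: "chain_boundary (Suc 1) d + e = frag_cmul k gen"
    using assms unfolding homologous_def homologous_rel_def singular_relboundary by auto
  have "winding_chain (frag_cmul k gen) = winding_chain (chain_boundary 2 d) + winding_chain e"
    using eq winding_chain_add[of "chain_boundary 2 d" e] by (simp add: numeral_2_eq_2)
  also have "\<dots> = 0" using winding_chain_boundary[of d] winding_chain_Lam0[of e] d e by (simp add: numeral_2_eq_2)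
  finally show ?thesis by (simp add: gen_def winding_chain_cmul_of winding_gen)
qed

section \<open>Crossings of the Maslov cycle\<close>

text \<open>Away from the crossing the path lies in \<open>Lam0\<close> and contributes nothing; near it the path lies in
  one chart.\<close>

lemma crossing_class:
  fixes p q t :: real
  assumes cont: "continuous_map (top_of_set {p..q}) Lam \<gamma>" and t: "p < t" "t < q"
    and tr: "lag_transverse om (\<gamma> t) (ch.K c)"
    and off: "\<And>s. s \<in> {p..q} \<Longrightarrow> s \<noteq> t \<Longrightarrow> \<gamma> s \<in> Lam0"
    and e: "0 < e" "\<And>s. t - e < s \<Longrightarrow> s < t \<Longrightarrow> p \<le> s \<Longrightarrow> pos_index (ch.coords c (\<gamma> s)) = i"
      "\<And>s. t < s \<Longrightarrow> s < t + e \<Longrightarrow> s \<le> q \<Longrightarrow> pos_index (ch.coords c (\<gamma> s)) = j"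
  shows "homologous (path_chain \<gamma> p q) (frag_cmul (j - i) gen)"
proof -
  let ?T = "{s \<in> {p..q}. lag_transverse om (\<gamma> s) (ch.K c)}"
  have op: "openin (top_of_set {p..q}) ?T" by (rule ch.openin_transverse_preimage[OF cont])
  have "t \<in> ?T" using t tr by simp
  then obtain d where d: "d > 0" "ball t d \<inter> {p..q} \<subseteq> ?T"
    using op unfolding openin_contains_ball by blast
  define r where "r = min (min (d / 2) (e / 2)) (min ((t - p) / 2) ((q - t) / 2))"
  have r: "0 < r" "r < d" "r < e" "r < t - p" "r < q - t"
    using d(1) e(1) t by (auto simp: r_def min_def)
  define s1 s2 where "s1 = t - r" and "s2 = t + r"
  have s: "p < s1" "s1 < t" "t < s2" "s2 < q" using r by (auto simp: s1_def s2_def)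
  define m where "m s = ch.coords c (\<gamma> s)" for s
  have trs: "lag_transverse om (\<gamma> s) (ch.K c)" if "s \<in> {s1..s2}" for s
  proof -
    have "s \<in> ball t d" "s \<in> {p..q}" using that r s by (auto simp: s1_def s2_def dist_real_def)
    then show ?thesis using d(2) by blast
  qed
  have Fm: "chartL c (m s) = \<gamma> s" if "s \<in> {s1..s2}" for s
    unfolding chartL_def m_def by (rule ch.graph_coords[OF trs[OF that]])
  have seg: "closed_segment s1 s2 = {s1..s2}" using s by (simp add: closed_segment_eq_real_ivl)
  have sub: "{s1..s2} \<subseteq> ?T" using trs s by auto
  have contm: "continuous_on (closed_segment s1 s2) m"
    unfolding m_def seg by (rule continuous_on_subset[OF ch.continuous_on_coords[OF cont] sub])
  have nd: "sym_det (m s1) \<noteq> 0" "sym_det (m s2) \<noteq> 0"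
    using off[of s1] off[of s2] Fm[of s1] Fm[of s2] s chartL_Lam0_iff[of c "m s1"] chartL_Lam0_iff[of c "m s2"] by auto
  have "simplex_path \<gamma> s1 s2 = simplex_path (\<lambda>s. chartL c (m s)) s1 s2"
  proof (rule simplex_path_eqI)
    fix u :: real assume "u \<in> {0..1}"
    then have "(1 - u) *\<^sub>R s1 + u *\<^sub>R s2 \<in> closed_segment s1 s2" unfolding closed_segment_def by auto
    then show "\<gamma> ((1 - u) *\<^sub>R s1 + u *\<^sub>R s2) = chartL c (m ((1 - u) *\<^sub>R s1 + u *\<^sub>R s2))"
      unfolding seg by (rule Fm[symmetric])
  qed
  then have "homologous (path_chain \<gamma> s1 s2) (path_chain (chartL c) (m s1) (m s2))"
    by (simp only: hom_straighten[OF contm])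
  also have "homologous \<dots> (frag_cmul (pos_index (m s2) - pos_index (m s1)) gen)" by (rule hom_chart_path[OF nd])
  also have "pos_index (m s2) = j" unfolding m_def by (rule e(3)) (use r s in \<open>auto simp: s2_def\<close>)
  also have "pos_index (m s1) = i" unfolding m_def by (rule e(2)) (use r s in \<open>auto simp: s1_def\<close>)
  finally have mid: "homologous (path_chain \<gamma> s1 s2) (frag_cmul (j - i) gen)" .
  have left: "homologous (path_chain \<gamma> p s1) 0"
    by (rule hom_in_subspace[OF cont]) (use s off in \<open>auto simp: closed_segment_eq_real_ivl\<close>)
  have right: "homologous (path_chain \<gamma> s2 q) 0"
    by (rule hom_in_subspace[OF cont]) (use s off in \<open>auto simp: closed_segment_eq_real_ivl\<close>)
  have "homologous (path_chain \<gamma> p q) (path_chain \<gamma> p s1 + path_chain \<gamma> s1 q)"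
    by (rule hom_sym[OF hom_triangle[OF cont]]) (use s in auto)
  also have "homologous \<dots> (0 + (path_chain \<gamma> s1 s2 + path_chain \<gamma> s2 q))"
    by (rule hom_add[OF left hom_sym[OF hom_triangle[OF cont]]]) (use s in auto)
  also have "homologous \<dots> (0 + (frag_cmul (j - i) gen + 0))"
    by (rule hom_add[OF hom_refl hom_add[OF mid right]])
  finally show ?thesis by simp
qed

text \<open>At a crossing with one-dimensional intersection the trace is the nonzero eigenvalue, which keeps its sign nearby;
  the sign of the determinant then decides the sign of the eigenvalue that crosses zero.\<close>

lemma crossing_class_sign:
  fixes p q t :: real
  assumes cont: "continuous_map (top_of_set {p..q}) Lam \<gamma>" and t: "p < t" "t < q"
    and tr: "lag_transverse om (\<gamma> t) (ch.K c)"
    and off: "\<And>s. s \<in> {p..q} \<Longrightarrow> s \<noteq> t \<Longrightarrow> \<gamma> s \<in> Lam0"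
    and sym_tr: "sym_tr (ch.coords c (\<gamma> t)) \<noteq> 0"
    and \<epsilon>: "\<epsilon> = 1 \<or> \<epsilon> = (-1::int)"
    and e: "0 < e" "\<And>s. s \<in> {p..q} \<Longrightarrow> 0 < \<bar>s - t\<bar> \<Longrightarrow> \<bar>s - t\<bar> < e \<Longrightarrow>
       0 < of_int \<epsilon> * (s - t) * (sym_tr (ch.coords c (\<gamma> t)) * sym_det (ch.coords c (\<gamma> s)))"
  shows "homologous (path_chain \<gamma> p q) (frag_cmul \<epsilon> gen)"
proof -
  define m where "m s = ch.coords c (\<gamma> s)" for s
  let ?T = "{s \<in> {p..q}. lag_transverse om (\<gamma> s) (ch.K c)}"
  have "openin (top_of_set {p..q}) ?T" by (rule ch.openin_transverse_preimage[OF cont])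
  moreover have tT: "t \<in> ?T" using t tr by simp
  ultimately obtain d where d: "d > 0" "ball t d \<inter> {p..q} \<subseteq> ?T"
    unfolding openin_contains_ball by blast
  have "continuous_on ?T m" unfolding m_def by (rule ch.continuous_on_coords[OF cont])
  then have "continuous_on ?T (\<lambda>s. sym_tr (m s))"
    unfolding sym_tr_def case_prod_beta by (intro continuous_intros)
  moreover have "0 < \<bar>sym_tr (m t)\<bar>" using sym_tr by (simp add: m_def)
  ultimately have "\<exists>d>0. \<forall>s\<in>?T. dist s t < d \<longrightarrow> dist (sym_tr (m s)) (sym_tr (m t)) < \<bar>sym_tr (m t)\<bar>"
    using tT unfolding continuous_on_iff by blast
  then obtain d' where d': "d' > 0" "\<And>s. s \<in> ?T \<Longrightarrow> dist s t < d' \<Longrightarrow> dist (sym_tr (m s)) (sym_tr (m t)) < \<bar>sym_tr (m t)\<bar>"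
    by blast
  define e' where "e' = min e (min d d')"
  have e': "0 < e'" using d d' e by (simp add: e'_def)
  have near: "sym_tr (m s) * sym_tr (m t) > 0 \<and> 0 < of_int \<epsilon> * (s - t) * (sym_tr (m t) * sym_det (m s))"
    if "s \<in> {p..q}" "s \<noteq> t" "\<bar>s - t\<bar> < e'" for s
  proof
    show "0 < of_int \<epsilon> * (s - t) * (sym_tr (m t) * sym_det (m s))"
      unfolding m_def by (rule e(2)) (use that in \<open>auto simp: e'_def\<close>)
    have "s \<in> ball t d" using that by (auto simp: e'_def dist_real_def)
    then have "s \<in> ?T" using that d(2) by blast
    moreover have "dist s t < d'" using that by (auto simp: e'_def dist_real_def)
    ultimately have "\<bar>sym_tr (m s) - sym_tr (m t)\<bar> < \<bar>sym_tr (m t)\<bar>" using d'(2) by (simp add: dist_real_def)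
    then show "sym_tr (m s) * sym_tr (m t) > 0" by (auto simp: zero_less_mult_iff abs_if split: if_splits)
  qed
  define up :: int where "up = (if sym_tr (m t) > 0 then 2 else 0)"
  have ind: "pos_index (m s) = (if of_int \<epsilon> * (s - t) * sym_tr (m t) > 0 then up else 1)"
    if "s \<in> {p..q}" "s \<noteq> t" "\<bar>s - t\<bar> < e'" for s
  proof -
    let ?x = "of_int \<epsilon> * (s - t) * sym_tr (m t)"
    have "0 < ?x * sym_det (m s)" using near[OF that] by (simp add: mult.assoc)
    moreover have "(r > 0 \<longleftrightarrow> d > 0) \<and> d \<noteq> 0" if "0 < r * d" for r d :: real
      using that by (auto simp: zero_less_mult_iff)
    ultimately have x: "?x > 0 \<longleftrightarrow> sym_det (m s) > 0" and nz: "sym_det (m s) \<noteq> 0" by blast+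
    have trs: "sym_tr (m s) > 0 \<longleftrightarrow> sym_tr (m t) > 0" using near[OF that] by (auto simp: zero_less_mult_iff)
    show ?thesis
    proof (cases "sym_det (m s) > 0")
      case True then show ?thesis using x trs by (simp add: pos_index_def up_def)
    next
      case False
      then have "sym_det (m s) < 0" using nz by simp
      then show ?thesis using x False by (simp add: pos_index_def)
    qed
  qed
  define j where "j = (if of_int \<epsilon> * sym_tr (m t) > 0 then up else 1)"
  define i where "i = (if of_int \<epsilon> * sym_tr (m t) < 0 then up else 1)"
  have "homologous (path_chain \<gamma> p q) (frag_cmul (j - i) gen)"
  proof (rule crossing_class[OF cont t tr off e'])
    fix s assume s: "t - e' < s" "s < t" "p \<le> s"
    have "pos_index (m s) = (if of_int \<epsilon> * (s - t) * sym_tr (m t) > 0 then up else 1)"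
      by (rule ind) (use s t in auto)
    moreover have "of_int \<epsilon> * (s - t) * sym_tr (m t) > 0 \<longleftrightarrow> of_int \<epsilon> * sym_tr (m t) < 0"
      using s(2) \<epsilon> by (auto simp: zero_less_mult_iff mult_less_0_iff)
    ultimately show "pos_index (ch.coords c (\<gamma> s)) = i" by (simp add: m_def i_def)
  next
    fix s assume s: "t < s" "s < t + e'" "s \<le> q"
    have "pos_index (m s) = (if of_int \<epsilon> * (s - t) * sym_tr (m t) > 0 then up else 1)"
      by (rule ind) (use s t in auto)
    moreover have "of_int \<epsilon> * (s - t) * sym_tr (m t) > 0 \<longleftrightarrow> of_int \<epsilon> * sym_tr (m t) > 0"
      using s(1) \<epsilon> by (auto simp: zero_less_mult_iff mult_less_0_iff)
    ultimately show "pos_index (ch.coords c (\<gamma> s)) = j" by (simp add: m_def j_def)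
  qed
  moreover have "j - i = \<epsilon>"
    using \<epsilon> sym_tr by (auto simp: j_def i_def up_def m_def)
  ultimately show ?thesis by simp
qed

lemma stratum_lagrangian: "continuous_map (top_of_set T) Lam \<gamma> \<Longrightarrow> s \<in> T \<Longrightarrow> lagrangian om (\<gamma> s)"
  using continuous_map_image_subset_topspace[of "top_of_set T" Lam \<gamma>] by (auto simp: topspace_Lam)

lemma coords_sym_det_zero:
  assumes "lag_transverse om W (ch.K c)"
  shows "W \<in> Lam0 \<longleftrightarrow> sym_det (ch.coords c W) \<noteq> 0"
  using chartL_Lam0_iff[of c "ch.coords c W"] ch.graph_coords[OF assms] by (simp add: chartL_def)

lemma stratum1_sym_tr:
  assumes tr: "lag_transverse om W (ch.K c)" and W: "W \<in> lag_stratum om L0 1"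
  shows "sym_det (ch.coords c W) = 0" "sym_tr (ch.coords c W) \<noteq> 0"
proof -
  have d: "dim (W \<inter> L0) = 1" using W by (simp add: lag_stratum_def)
  then have "W \<notin> Lam0" by (simp add: lag_stratum_def del: dim_eq_0)
  then show 0: "sym_det (ch.coords c W) = 0" using coords_sym_det_zero[OF tr] by blast
  obtain x y z where m: "ch.coords c W = (x, y, z)" by (cases "ch.coords c W")
  show "sym_tr (ch.coords c W) \<noteq> 0"
  proof
    assume "sym_tr (ch.coords c W) = 0"
    then have z: "z = - x" by (simp add: m sym_tr_def eq_neg_iff_add_eq_0 add.commute)
    then have "x\<^sup>2 + y\<^sup>2 = 0" using 0 unfolding m sym_det_def prod.case z power2_eq_square by linarith
    then have "x = 0" "y = 0" by (simp_all add: sum_power2_eq_zero_iff)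
    then have "ch.coords c W = 0" by (simp add: m z zero_prod_def)
    then have "W = span {(0, vec2 1 0), (0, vec2 0 1)}"
      using ch.graph_coords[OF tr] ch.graph_zero by metis
    then have "W \<subseteq> L0"
    proof (simp only:, intro span_minimal)
      show "subspace L0" using lagrangian_L0 by (simp only: lagrangian_def)
    qed auto
    then have "W \<inter> L0 = W" by blast
    then show False using d W lagrangian_dim[of W] by (simp add: lag_stratum_def)
  qed
qed

text \<open>The tangent form is the derivative of the chart matrix, because differences of chart matrices are the chart values
  centred at the crossing. On the kernel of a matrix of rank one the derivative of the determinant is the nonzero eigenvalue times the
  value of the tangent form, so positivity means that an eigenvalue becomes positive.\<close>

lemma positive_crossing_class:
  assumes pos: "positive_crossing_curve om L0 p q \<gamma>"
  shows "homologous (path_chain \<gamma> p q) gen"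
proof -
  have cont: "continuous_map (top_of_set {p..q}) Lam \<gamma>" and "p < q"
    using pos unfolding positive_crossing_curve_def lag_smooth_curve_def by blast+
  obtain t B where t: "t \<in> {p..q}" and cr: "\<And>s. s \<in> {p..q} \<Longrightarrow> \<gamma> s \<in> lag_stratum_ge1 om L0 \<longleftrightarrow> s = t"
    and st1: "\<gamma> t \<in> lag_stratum om L0 1" and B: "lag_tangent om p q \<gamma> t B"
    and Bpos: "\<And>u. u \<in> \<gamma> t \<inter> L0 \<Longrightarrow> u \<noteq> 0 \<Longrightarrow> B u u > 0"
    and ends: "\<gamma> p \<notin> lag_stratum_ge1 om L0" "\<gamma> q \<notin> lag_stratum_ge1 om L0"
    using pos unfolding positive_crossing_curve_def by metis
  have "t \<noteq> p" "t \<noteq> q" using cr[of t] t ends by auto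
  then have t': "p < t" "t < q" using t by auto
  have off: "\<gamma> s \<in> Lam0" if "s \<in> {p..q}" "s \<noteq> t" for s
    using cr[OF that(1)] that(2) ge1_iff[OF stratum_lagrangian[OF cont that(1)]] by blast
  obtain c where tr: "lag_transverse om (\<gamma> t) (ch.K c)"
    using exists_chart[OF stratum_lagrangian[OF cont t]] .
  note dt = stratum1_sym_tr[OF tr st1]
  let ?T = "{s \<in> {p..q}. lag_transverse om (\<gamma> s) (ch.K c)}"
  have "openin (top_of_set {p..q}) ?T" by (rule ch.openin_transverse_preimage[OF cont])
  moreover have tT: "t \<in> ?T" using t tr by simp
  ultimately obtain d where d: "d > 0" "ball t d \<inter> {p..q} \<subseteq> ?T"
    unfolding openin_contains_ball by blast
  have near: "lag_transverse om (\<gamma> s) (ch.K c)" if "s \<in> {p..q}" "dist s t < d" for s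
  proof -
    have "s \<in> ball t d \<inter> {p..q}" using that by (simp add: dist_commute)
    then show ?thesis using d(2) by blast
  qed
  define m where "m s = ch.coords c (\<gamma> s)" for s
  obtain x y z where m: "m t = (x, y, z)" by (cases "m t")
  have \<gamma>t: "\<gamma> t = ch.graph c (m t)" unfolding m_def by (rule ch.graph_coords[OF tr, symmetric])
  have within: "at t within {p..q} = at t" by (rule at_within_interior) (use t' in simp)
  let ?u1 = "ch.b1 c (m t)" and ?u2 = "ch.b2 c (m t)"
  have chart: "lag_chart om (\<gamma> t) (ch.K c) (\<gamma> s) (a *\<^sub>R ?u1 + b *\<^sub>R ?u2, a *\<^sub>R ?u1 + b *\<^sub>R ?u2)
      = a\<^sup>2 * (fst (m s) - x) + 2 * a * b * (fst (snd (m s)) - y) + b\<^sup>2 * (snd (snd (m s)) - z)"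
    if s: "s \<in> {p..q}" "dist s t < d" for s a b
  proof -
    let ?v = "a *\<^sub>R ?u1 + b *\<^sub>R ?u2"
    let ?X = "fst (m s) - x" and ?Y = "fst (snd (m s)) - y" and ?Z = "snd (snd (m s)) - z"
    let ?k1 = "(vec2 0 1, vec2 c 0)" and ?k2 = "(vec2 1 0, vec2 0 c)"
    have \<gamma>s: "\<gamma> s = ch.graph c (m s)" unfolding m_def by (rule ch.graph_coords[OF near[OF s], symmetric])
    have v: "?v \<in> \<gamma> t" unfolding \<gamma>t ch.graph_def span2_iff by blast
    have gm: "graph_map (ch.K c) (\<gamma> s) ?v = (a * ?X + b * ?Y) *\<^sub>R ?k1 + (a * ?Y + b * ?Z) *\<^sub>R ?k2"
    proof (rule graph_map_unique[OF near[OF s]])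
      show "(a * ?X + b * ?Y) *\<^sub>R ?k1 + (a * ?Y + b * ?Z) *\<^sub>R ?k2 \<in> ch.K c" unfolding span2_iff by blast
      have "?v + ((a * ?X + b * ?Y) *\<^sub>R ?k1 + (a * ?Y + b * ?Z) *\<^sub>R ?k2) = a *\<^sub>R ch.b1 c (m s) + b *\<^sub>R ch.b2 c (m s)"
        unfolding ch.b1_def ch.b2_def by (simp add: m case_prod_beta prod_eq_iff vec2_eq_iff algebra_simps)
      then show "?v + ((a * ?X + b * ?Y) *\<^sub>R ?k1 + (a * ?Y + b * ?Z) *\<^sub>R ?k2) \<in> \<gamma> s"
        unfolding \<gamma>s ch.graph_def span2_iff by blast
    qed
    have "lag_chart om (\<gamma> t) (ch.K c) (\<gamma> s) (?v, ?v) = om (graph_map (ch.K c) (\<gamma> s) ?v) ?v"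
      using v by (simp only: lag_chart_def restrict_apply mem_Times_iff fst_conv snd_conv) simp
    also have "\<dots> = a\<^sup>2 * ?X + 2 * a * b * ?Y + b\<^sup>2 * ?Z"
      unfolding gm unfolding m ch_b om_eq by (simp add: power2_eq_square algebra_simps)
    finally show ?thesis .
  qed
  have D: "((\<lambda>s. a\<^sup>2 * (fst (m s) - x) + 2 * a * b * (fst (snd (m s)) - y) + b\<^sup>2 * (snd (snd (m s)) - z))
      has_real_derivative B (a *\<^sub>R ?u1 + b *\<^sub>R ?u2) (a *\<^sub>R ?u1 + b *\<^sub>R ?u2)) (at t)" for a b
  proof -
    let ?v = "a *\<^sub>R ?u1 + b *\<^sub>R ?u2"
    have "?v \<in> \<gamma> t" unfolding \<gamma>t ch.graph_def span2_iff by blast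
    then have "((\<lambda>s. lag_chart om (\<gamma> t) (ch.K c) (\<gamma> s) (?v, ?v)) has_real_derivative B ?v ?v) (at t within {p..q})"
      using B tr unfolding lag_tangent_def by blast
    then show ?thesis
      unfolding within[symmetric] by (rule has_field_derivative_transform_within[OF _ d(1) t chart])
  qed
  \<comment> \<open>the entries of the tangent form, the mixed one by polarisation\<close>
  define x' z' y' where "x' = B (1 *\<^sub>R ?u1 + 0 *\<^sub>R ?u2) (1 *\<^sub>R ?u1 + 0 *\<^sub>R ?u2)"
    and "z' = B (0 *\<^sub>R ?u1 + 1 *\<^sub>R ?u2) (0 *\<^sub>R ?u1 + 1 *\<^sub>R ?u2)"
    and "y' = (B (1 *\<^sub>R ?u1 + 1 *\<^sub>R ?u2) (1 *\<^sub>R ?u1 + 1 *\<^sub>R ?u2) - x' - z') / 2"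
  have Dx0: "((\<lambda>s. fst (m s) - x) has_real_derivative x') (at t)"
    using D[of 1 0] by (simp add: x'_def)
  have Dz0: "((\<lambda>s. snd (snd (m s)) - z) has_real_derivative z') (at t)"
    using D[of 0 1] by (simp add: z'_def)
  have "((\<lambda>s. ((1\<^sup>2 * (fst (m s) - x) + 2 * 1 * 1 * (fst (snd (m s)) - y) + 1\<^sup>2 * (snd (snd (m s)) - z))
      - (fst (m s) - x) - (snd (snd (m s)) - z)) / 2) has_real_derivative y') (at t)"
    unfolding y'_def by (intro DERIV_cdivide DERIV_diff D Dx0 Dz0)
  moreover have "(\<lambda>s. ((1\<^sup>2 * (fst (m s) - x) + 2 * 1 * 1 * (fst (snd (m s)) - y) + 1\<^sup>2 * (snd (snd (m s)) - z))
      - (fst (m s) - x) - (snd (snd (m s)) - z)) / 2) = (\<lambda>s. fst (snd (m s)) - y)" by (simp add: fun_eq_iff)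
  ultimately have Dy0: "((\<lambda>s. fst (snd (m s)) - y) has_real_derivative y') (at t)" by (simp only:)
  have Dx: "((\<lambda>s. fst (m s)) has_real_derivative x') (at t)"
    using DERIV_add[OF Dx0 DERIV_const[of x]] by simp
  have Dy: "((\<lambda>s. fst (snd (m s))) has_real_derivative y') (at t)"
    using DERIV_add[OF Dy0 DERIV_const[of y]] by simp
  have Dz: "((\<lambda>s. snd (snd (m s))) has_real_derivative z') (at t)"
    using DERIV_add[OF Dz0 DERIV_const[of z]] by simp
  have quad: "B (a *\<^sub>R ?u1 + b *\<^sub>R ?u2) (a *\<^sub>R ?u1 + b *\<^sub>R ?u2) = a\<^sup>2 * x' + 2 * a * b * y' + b\<^sup>2 * z'" for a b
    by (rule DERIV_unique[OF D]) (intro DERIV_add DERIV_cmult Dx0 Dy0 Dz0)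
  have kernel: "a\<^sup>2 * x' + 2 * a * b * y' + b\<^sup>2 * z' > 0"
    if "a * x + b * y = 0" "a * y + b * z = 0" "a \<noteq> 0 \<or> b \<noteq> 0" for a b
  proof -
    let ?v = "a *\<^sub>R ?u1 + b *\<^sub>R ?u2"
    have "fst ?v = 0" using that(1,2) unfolding m ch_b by (simp add: vec2_eq_iff)
    then have "?v \<in> L0" by (cases ?v) simp
    moreover have "?v \<in> \<gamma> t" unfolding \<gamma>t ch.graph_def span2_iff by blast
    moreover have "?v \<noteq> 0" using that(3) ch.indep2_b[of c "m t"] unfolding indep2_def by blast
    ultimately have "B ?v ?v > 0" by (intro Bpos IntI)
    then show ?thesis unfolding quad .
  qed
  define D' where "D' = x' * z + x * z' - 2 * y * y'"
  have Ddet: "((\<lambda>s. sym_det (m s)) has_real_derivative D') (at t)"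
    using DERIV_diff[OF DERIV_mult[OF Dx Dz] DERIV_power[OF Dy, of 2]]
    unfolding sym_det_def case_prod_beta by (simp add: m D'_def algebra_simps)
  have xz: "x * z = y\<^sup>2" and sym_tr: "x + z \<noteq> 0" using dt by (simp_all add: m_def[symmetric] m sym_det_def sym_tr_def)
  have "(x + z) * D' > 0"
  proof (cases "z = 0")
    case True
    then have y: "y = 0" using xz by simp
    have "x \<noteq> 0" using sym_tr True by simp
    then have "z' > 0" using kernel[of 0 1] y True by simp
    moreover have "x\<^sup>2 > 0" using \<open>x \<noteq> 0\<close> by simp
    ultimately have "x\<^sup>2 * z' > 0" by (rule mult_pos_pos[rotated])
    then show ?thesis using y True by (simp add: D'_def power2_eq_square mult.assoc)
  next
    case False
    have "z\<^sup>2 * x' + 2 * z * (- y) * y' + (- y)\<^sup>2 * z' > 0"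
      by (rule kernel) (use xz False in \<open>simp_all add: power2_eq_square algebra_simps\<close>)
    also have "z\<^sup>2 * x' + 2 * z * (- y) * y' + (- y)\<^sup>2 * z' = z * D'"
      by (simp add: xz[symmetric] D'_def power2_eq_square[of z] algebra_simps)
    finally have zD: "z * D' > 0" .
    have "z * (x + z) = y\<^sup>2 + z\<^sup>2" using xz by (simp add: power2_eq_square algebra_simps)
    moreover have "y\<^sup>2 + z\<^sup>2 > 0" using False by (simp add: sum_power2_gt_zero_iff)
    ultimately have "z * (x + z) > 0" by simp
    then show ?thesis using zD by (auto simp: zero_less_mult_iff)
  qed
  note pos' = this
  have Dd: "((\<lambda>s. (x + z) * sym_det (m s)) has_real_derivative (x + z) * D') (at t)"
    by (rule DERIV_cmult[OF Ddet])
  obtain d1 where d1: "d1 > 0" "\<And>h. 0 < h \<Longrightarrow> h < d1 \<Longrightarrow> (x + z) * sym_det (m t) < (x + z) * sym_det (m (t + h))"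
    using DERIV_pos_inc_right[OF Dd pos'] by blast
  obtain d2 where d2: "d2 > 0" "\<And>h. 0 < h \<Longrightarrow> h < d2 \<Longrightarrow> (x + z) * sym_det (m (t - h)) < (x + z) * sym_det (m t)"
    using DERIV_pos_inc_left[OF Dd pos'] by blast
  have det0: "sym_det (m t) = 0" using dt by (simp add: m_def)
  have trt: "sym_tr (ch.coords c (\<gamma> t)) = x + z" by (simp add: m_def[symmetric] m sym_tr_def)
  have "homologous (path_chain \<gamma> p q) (frag_cmul 1 gen)"
  proof (rule crossing_class_sign[OF cont t' tr off dt(2)])
    show "0 < min d1 d2" using d1 d2 by simp
    fix s assume s: "0 < \<bar>s - t\<bar>" "\<bar>s - t\<bar> < min d1 d2"
    show "0 < of_int 1 * (s - t) * (sym_tr (ch.coords c (\<gamma> t)) * sym_det (ch.coords c (\<gamma> s)))"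
    proof (cases "s > t")
      case True
      then show ?thesis using d1(2)[of "s - t"] s det0 by (simp add: trt m_def)
    next
      case False
      then have "(x + z) * sym_det (m s) < 0" using d2(2)[of "t - s"] s det0 by simp
      then have "0 < (s - t) * ((x + z) * sym_det (m s))" using False s by (intro mult_neg_neg) auto
      then show ?thesis by (simp add: trt m_def)
    qed
  qed auto
  then show ?thesis by simp
qed

lemma has_derivative_power_quotient:
  fixes q0 q1 C :: real
  assumes "q0 + q1 * t \<noteq> 0"
  shows "((\<lambda>s. C / (q0 + q1 * s) ^ Suc n) has_real_derivative (C * (- q1) * real (Suc n)) / (q0 + q1 * t) ^ Suc (Suc n)) (at t within I)"
proof -
  let ?q = "q0 + q1 * t"
  have q: "((\<lambda>s. (q0 + q1 * s) ^ Suc n) has_real_derivative real (Suc n) * (q1 * ?q ^ n)) (at t within I)"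
    by (rule derivative_eq_intros refl)+ simp
  have "((\<lambda>s. C * inverse ((q0 + q1 * s) ^ Suc n)) has_real_derivative
      C * (- (inverse (?q ^ Suc n) * (real (Suc n) * (q1 * ?q ^ n)) * inverse (?q ^ Suc n)))) (at t within I)"
    by (intro DERIV_cmult DERIV_inverse'[OF q]) (use assms in simp)
  moreover have "C * (- (inverse (r ^ Suc n) * (real (Suc n) * (q1 * r ^ n)) * inverse (r ^ Suc n)))
      = (C * (- q1) * real (Suc n)) / r ^ Suc (Suc n)" if "r \<noteq> 0" for r
    using that by (simp add: field_simps)
  note this[OF assms]
  ultimately show ?thesis by (simp only: divide_inverse)
qed

text \<open>The iterated derivatives of a fractional linear function are explicit.\<close>

lemma smooth_real_on_moebius:
  assumes eq: "\<And>t. t \<in> I \<Longrightarrow> f t = (p0 + p1 * t) / (q0 + q1 * t)"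
    and q: "\<And>t. t \<in> I \<Longrightarrow> q0 + q1 * t \<noteq> 0"
  shows "smooth_real_on f I"
proof -
  define C where "C k = (p1 * q0 - p0 * q1) * (- q1) ^ k * fact (Suc k)" for k :: nat
  define D where "D k t = (case k of 0 \<Rightarrow> (p0 + p1 * t) / (q0 + q1 * t) | Suc k \<Rightarrow> C k / (q0 + q1 * t) ^ Suc (Suc k))" for k t
  have "(D k has_real_derivative D (Suc k) t) (at t within I)" if t: "t \<in> I" for k t
  proof (cases k)
    case 0
    have "((\<lambda>t. (p0 + p1 * t) / (q0 + q1 * t)) has_real_derivative
        (p1 * (q0 + q1 * t) - (p0 + p1 * t) * q1) / ((q0 + q1 * t) * (q0 + q1 * t))) (at t within I)"
      by (rule derivative_eq_intros refl q[OF t])+ simp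
    moreover have "p1 * (q0 + q1 * t) - (p0 + p1 * t) * q1 = C 0" by (simp add: C_def algebra_simps)
    ultimately show ?thesis by (simp add: 0 D_def[abs_def] power2_eq_square)
  next
    case (Suc l)
    have "C (Suc l) = C l * (- q1) * real (Suc (Suc l))" by (simp add: C_def algebra_simps)
    then show ?thesis
      using has_derivative_power_quotient[OF q[OF t], of "C l" "Suc l" I] by (simp add: Suc D_def[abs_def])
  qed
  moreover have "D 0 t = f t" if "t \<in> I" for t using eq[OF that] by (simp add: D_def)
  ultimately show ?thesis unfolding smooth_real_on_def by blast
qed

text \<open>The generator as a curve: one entry of a symmetric matrix moves through zero. It witnesses that positive
  crossings exist, without which the normalisation of the Maslov isomorphism would be void.\<close>

definition model :: "real \<Rightarrow> phase set" where "model s = chartL 0 (s, 0, -1)"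

definition model_w0 :: phase where "model_w0 = (vec2 0 0, vec2 1 0)"
definition model_w1 :: phase where "model_w1 = (vec2 0 1, vec2 0 0)"
definition model_w2 :: phase where "model_w2 = (vec2 (-1) 0, vec2 0 1)"

lemma model_basis:
  "model s = span {model_w0 + s *\<^sub>R model_w1, model_w2}" "indep2 (model_w0 + s *\<^sub>R model_w1) model_w2" "om (model_w0 + s *\<^sub>R model_w1) model_w2 = 0"
proof -
  have "model_w0 + s *\<^sub>R model_w1 = ch.b1 0 (s, 0, -1)" "model_w2 = ch.b2 0 (s, 0, -1)"
    unfolding ch_b by (simp_all add: model_w0_def model_w1_def model_w2_def prod_eq_iff vec2_eq_iff)
  then show "model s = span {model_w0 + s *\<^sub>R model_w1, model_w2}" "indep2 (model_w0 + s *\<^sub>R model_w1) model_w2" "om (model_w0 + s *\<^sub>R model_w1) model_w2 = 0"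
    using ch.indep2_b[of 0 "(s, 0, -1)"] ch.om_b[of 0 "(s, 0, -1)"] by (simp_all only: model_def chartL_def ch.graph_def)
qed

lemma model_chart:
  assumes tr: "lag_transverse om (model s) (span {a1, a2})" and A: "indep2 a1 a2" "om a1 a2 = 0"
    and L: "lagrangian om L" "u \<in> L" "v \<in> L"
  shows "lag_chart om L (span {a1, a2}) (model s) (u, v) =
    ((om u a1 * om model_w2 a2 - om u a2 * om model_w2 a1) * om (model_w0 + s *\<^sub>R model_w1) v
      + (om (model_w0 + s *\<^sub>R model_w1) a1 * om u a2 - om (model_w0 + s *\<^sub>R model_w1) a2 * om u a1) * om model_w2 v)
    / (om (model_w0 + s *\<^sub>R model_w1) a1 * om model_w2 a2 - om (model_w0 + s *\<^sub>R model_w1) a2 * om model_w2 a1)"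
  unfolding model_basis(1)
  by (rule lag_chart_cramer[OF tr[unfolded model_basis(1)] model_basis(2,3) A L])

lemma model_transverse:
  assumes A: "indep2 a1 a2" "om a1 a2 = 0"
  shows "lag_transverse om (model s) (span {a1, a2}) \<longleftrightarrow>
    om (model_w0 + s *\<^sub>R model_w1) a1 * om model_w2 a2 - om (model_w0 + s *\<^sub>R model_w1) a2 * om model_w2 a1 \<noteq> 0"
  unfolding model_basis(1) by (rule lag_transverse_det[OF model_basis(2,3) A])

lemma lag_transverse_obtain:
  assumes "lag_transverse om W L1"
  obtains a1 a2 where "L1 = span {a1, a2}" "indep2 a1 a2" "om a1 a2 = 0"
proof -
  have "lagrangian om L1" using assms by (simp only: lag_transverse_def)
  then show ?thesis using lagrangian_obtain that by blast
qed

lemma continuous_map_model: "continuous_map (top_of_set T) Lam model"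
  unfolding model_def by (intro continuous_map_chartL continuous_intros)

lemma model_smooth: "lag_smooth_curve om (-1) 1 model"
  unfolding lag_smooth_curve_def
proof (intro conjI allI impI ballI)
  show "continuous_map (top_of_set {-1..1}) Lam model" by (rule continuous_map_model)
  fix L L1 u v assume T: "lag_transverse om L L1" and uv: "u \<in> L" "v \<in> L"
  have L: "lagrangian om L" using T by (simp only: lag_transverse_def)
  obtain a1 a2 where a: "L1 = span {a1, a2}" "indep2 a1 a2" "om a1 a2 = 0"
    using T by (rule lag_transverse_obtain)
  define P where "P w = (om u a1 * om model_w2 a2 - om u a2 * om model_w2 a1) * om w v + (om w a1 * om u a2 - om w a2 * om u a1) * om model_w2 v" for w
  define Q where "Q w = om w a1 * om model_w2 a2 - om w a2 * om model_w2 a1" for w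
  have lin: "P (model_w0 + s *\<^sub>R model_w1) = P model_w0 + P model_w1 * s" "Q (model_w0 + s *\<^sub>R model_w1) = Q model_w0 + Q model_w1 * s" for s
    by (simp_all add: P_def Q_def om_simps algebra_simps)
  show "smooth_real_on (\<lambda>t. lag_chart om L L1 (model t) (u, v)) {t \<in> {-1..1}. lag_transverse om (model t) L1}"
  proof (rule smooth_real_on_moebius)
    fix t assume "t \<in> {t \<in> {-1..1}. lag_transverse om (model t) L1}"
    then have tr: "lag_transverse om (model t) (span {a1, a2})" by (simp add: a(1))
    show "lag_chart om L L1 (model t) (u, v) = (P model_w0 + P model_w1 * t) / (Q model_w0 + Q model_w1 * t)"
      unfolding a(1) lin[symmetric] unfolding P_def Q_def by (rule model_chart[OF tr a(2,3) L uv])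
    show "Q model_w0 + Q model_w1 * t \<noteq> 0"
      using tr unfolding lin[symmetric] unfolding Q_def model_transverse[OF a(2,3)] .
  qed
qed

text \<open>Only one basis vector moves, and linearly; so on the crossing Lagrangian the chart value is the parameter times a function
  continuous at the crossing.\<close>

lemma model_tangent: "lag_tangent om (-1) 1 model 0 (\<lambda>u v. snd u$1 * snd v$1)"
  unfolding lag_tangent_def
proof (intro allI impI ballI)
  fix L1 u v assume T: "lag_transverse om (model 0) L1" and uv: "u \<in> model 0" "v \<in> model 0"
  have L: "lagrangian om (model 0)" using T by (simp only: lag_transverse_def)
  obtain a1 a2 where a: "L1 = span {a1, a2}" "indep2 a1 a2" "om a1 a2 = 0"
    using T by (rule lag_transverse_obtain)
  define Q where "Q w = om w a1 * om model_w2 a2 - om w a2 * om model_w2 a1" for w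
  have lin: "Q (model_w0 + s *\<^sub>R model_w1) = Q model_w0 + s * Q model_w1" for s
    by (simp add: Q_def om_simps algebra_simps)
  have m0: "model 0 = span {model_w0, model_w2}" using model_basis(1)[of 0] by simp
  obtain p q where u: "u = p *\<^sub>R model_w0 + q *\<^sub>R model_w2" using uv(1) unfolding m0 span2_iff by blast
  obtain p' q' where v: "v = p' *\<^sub>R model_w0 + q' *\<^sub>R model_w2" using uv(2) unfolding m0 span2_iff by blast
  have pu: "p = snd u$1" "p' = snd v$1" by (simp_all add: u v model_w0_def model_w2_def)
  have w2v: "om model_w2 v = 0" and w0v: "om model_w0 v = 0" and w1v: "om model_w1 v = p'"
    unfolding v by (simp_all add: om_eq model_w0_def model_w1_def model_w2_def)
  have num: "om u a1 * om model_w2 a2 - om u a2 * om model_w2 a1 = p * Q model_w0"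
    by (simp add: u Q_def om_simps algebra_simps)
  have chart: "lag_chart om (model 0) L1 (model s) (u, v) = p * Q model_w0 * (s * p') / (Q model_w0 + s * Q model_w1)"
    if "lag_transverse om (model s) L1" for s
  proof -
    have tr: "lag_transverse om (model s) (span {a1, a2})" using that by (simp add: a(1))
    have "om (model_w0 + s *\<^sub>R model_w1) v = s * p'" by (simp add: om_simps w0v w1v)
    then show ?thesis
      unfolding a(1) model_chart[OF tr a(2,3) L uv] num w2v lin[symmetric] unfolding Q_def[of "model_w0 + s *\<^sub>R model_w1"] by simp
  qed
  have tr0: "lag_transverse om (model 0) (span {a1, a2})" using T by (simp add: a(1))
  then have Q0: "Q model_w0 \<noteq> 0" unfolding model_transverse[OF a(2,3)] Q_def by simp
  have der: "((\<lambda>s. p * Q model_w0 * (s * p') / (Q model_w0 + s * Q model_w1)) has_real_derivative p * p') (at 0 within {-1..1})"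
    by (rule derivative_eq_intros refl | use Q0 in simp)+
  obtain d where d: "d > 0" "ball 0 d \<inter> {-1..1} \<subseteq> {s \<in> {-1..1}. lag_transverse om (model s) L1}"
  proof -
    have op: "openin (top_of_set {-1..1}) {s \<in> {-1..1::real}. Q model_w0 + s * Q model_w1 \<noteq> 0}"
    proof -
      have "continuous_on {-1..1} (\<lambda>s. Q model_w0 + s * Q model_w1)" by (intro continuous_intros)
      from continuous_openin_preimage_gen[OF this, of "- {0}"]
      have "openin (top_of_set {-1..1}) ({-1..1} \<inter> (\<lambda>s. Q model_w0 + s * Q model_w1) -` (- {0}))" by (simp add: open_Compl)
      moreover have "{-1..1} \<inter> (\<lambda>s. Q model_w0 + s * Q model_w1) -` (- {0}) = {s \<in> {-1..1}. Q model_w0 + s * Q model_w1 \<noteq> 0}" by auto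
      ultimately show ?thesis by simp
    qed
    moreover have "0 \<in> {s \<in> {-1..1::real}. Q model_w0 + s * Q model_w1 \<noteq> 0}" using Q0 by simp
    ultimately obtain d where d: "d > 0" "ball 0 d \<inter> {-1..1} \<subseteq> {s \<in> {-1..1}. Q model_w0 + s * Q model_w1 \<noteq> 0}"
      unfolding openin_contains_ball by blast
    have "lag_transverse om (model s) L1" if "Q model_w0 + s * Q model_w1 \<noteq> 0" for s
      using that unfolding a(1) lin[symmetric] unfolding model_transverse[OF a(2,3)] Q_def .
    then show ?thesis using d that by blast
  qed
  have "((\<lambda>s. lag_chart om (model 0) L1 (model s) (u, v)) has_real_derivative p * p') (at 0 within {-1..1})"
  proof (rule has_field_derivative_transform_within[OF der d(1)])
    fix s :: real assume "s \<in> {-1..1}" "dist s 0 < d"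
    then have "s \<in> ball 0 d \<inter> {-1..1}" by (simp add: dist_commute)
    then have "lag_transverse om (model s) L1" using d(2) by blast
    from chart[OF this] show "p * Q model_w0 * (s * p') / (Q model_w0 + s * Q model_w1) = lag_chart om (model 0) L1 (model s) (u, v)" ..
  qed simp
  then show "((\<lambda>s. lag_chart om (model 0) L1 (model s) (u, v)) has_real_derivative snd u$1 * snd v$1) (at 0 within {-1..1})"
    by (simp only: pu)
qed

lemma model_ge1: "model s \<in> lag_stratum_ge1 om L0 \<longleftrightarrow> s = 0"
  using ge1_iff[OF lagrangian_chartL[of 0 "(s, 0, -1)"]] chartL_Lam0_iff[of 0 "(s, 0, -1)"]
  by (simp add: model_def sym_det_def)

lemma model_inter: "u \<in> model 0 \<inter> L0 \<longleftrightarrow> (\<exists>p. u = (0, vec2 p 0))"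
proof
  assume u: "u \<in> model 0 \<inter> L0"
  then have "u \<in> model 0" by blast
  then obtain p q where "u = p *\<^sub>R model_w0 + q *\<^sub>R model_w2"
    using model_basis(1)[of 0] span2_iff[of u model_w0 model_w2] by auto
  moreover have "fst u = 0" using u by auto
  ultimately have "u = (0, vec2 p 0)" by (auto simp: model_w0_def model_w2_def prod_eq_iff vec2_eq_iff)
  then show "\<exists>p. u = (0, vec2 p 0)" ..
next
  assume "\<exists>p. u = (0, vec2 p 0)"
  then obtain p where u: "u = (0, vec2 p 0)" ..
  then have "u = p *\<^sub>R (model_w0 + 0 *\<^sub>R model_w1) + 0 *\<^sub>R model_w2"
    by (simp add: model_w0_def prod_eq_iff vec2_eq_iff)
  then have "u \<in> model 0" unfolding model_basis(1) span2_iff by blast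
  then show "u \<in> model 0 \<inter> L0" using u by simp
qed

lemma model_positive_crossing: "positive_crossing_curve om L0 (-1) 1 model"
  unfolding positive_crossing_curve_def
proof (intro conjI)
  show "model (-1) \<notin> lag_stratum_ge1 om L0" "model 1 \<notin> lag_stratum_ge1 om L0" by (simp_all add: model_ge1)
  have "model 0 \<inter> L0 = span {(0, vec2 1 0)}"
  proof -
    have eq: "p *\<^sub>R (0, vec2 1 0 :: real^2) = (0, vec2 p 0)" for p :: real by (simp add: prod_eq_iff vec2_eq_iff)
    have "u \<in> model 0 \<inter> L0 \<longleftrightarrow> u \<in> span {(0, vec2 1 0)}" for u
    proof -
      have "u \<in> span {(0, vec2 1 0)} \<longleftrightarrow> (\<exists>p. u = p *\<^sub>R (0, vec2 1 0))" unfolding span_singleton by blast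
      then show ?thesis unfolding model_inter eq by blast
    qed
    then show ?thesis by blast
  qed
  then have "dim (model 0 \<inter> L0) = dim {(0 :: real^2, vec2 1 0)}" by simp
  also have "\<dots> = 1" by (subst dim_eq_card_independent) (simp_all add: prod_eq_iff vec2_eq_iff)
  finally have "model 0 \<in> lag_stratum om L0 1"
    using lagrangian_chartL[of 0 "(0, 0, -1)"] by (simp add: lag_stratum_def model_def)
  moreover have "snd u$1 * snd u$1 > 0" if "u \<in> model 0 \<inter> L0" "u \<noteq> 0" for u
  proof -
    obtain p where p: "u = (0, vec2 p 0)" using \<open>u \<in> model 0 \<inter> L0\<close> unfolding model_inter ..
    then have "p \<noteq> 0" using that(2) by (auto simp: prod_eq_iff vec2_eq_iff)
    then have "p * p > 0" by (metis not_real_square_gt_zero)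
    then show ?thesis using p by simp
  qed
  ultimately show "\<exists>t\<in>{-1..1}. (\<forall>s\<in>{-1..1}. model s \<in> lag_stratum_ge1 om L0 \<longleftrightarrow> s = t) \<and>
      model t \<in> lag_stratum om L0 1 \<and>
      (\<exists>B. lag_tangent om (-1) 1 model t B \<and> (\<forall>u\<in>model t \<inter> L0. u \<noteq> 0 \<longrightarrow> B u u > 0))"
    using model_tangent by (intro bexI[of _ 0] conjI exI[of _ "\<lambda>u v. snd u$1 * snd v$1"]) (auto simp: model_ge1)
qed (simp_all add: model_smooth)

section \<open>The Maslov isomorphism\<close>

abbreviation cls :: "phase set chain \<Rightarrow> phase set chain set" where
  "cls z \<equiv> homologous_rel_set 1 Lam Lam0 z"

lemma cls_eq: "cls a = cls b \<longleftrightarrow> homologous a b"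
  unfolding homologous_def by (rule homologous_rel_set_eq)

lemma maslov_carrier: "carrier (maslov_homology_group om L0) = cls ` {z. singular_relcycle 1 Lam Lam0 z}"
  using carrier_relative_homology_group[of 1 Lam Lam0] by simp

lemma maslov_mult: "cls a \<otimes>\<^bsub>maslov_homology_group om L0\<^esub> cls b = cls (a + b)"
proof -
  have "cls a \<otimes>\<^bsub>maslov_homology_group om L0\<^esub> cls b = (\<Union>r\<in>cls a. \<Union>s\<in>cls b. {r + s})"
    using fun_cong[OF fun_cong[OF mult_relative_homology_group[of 1 Lam Lam0]], of "cls a" "cls b"] by simp
  also have "\<dots> = cls (a + b)"
  proof (intro equalityI subsetI)
    fix x assume "x \<in> (\<Union>r\<in>cls a. \<Union>s\<in>cls b. {r + s})"
    then show "x \<in> cls (a + b)" by (auto intro: homologous_rel_add)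
  next
    fix x assume "x \<in> cls (a + b)"
    then have "homologous_rel 1 Lam Lam0 (a + b - a) (x - a)"
      by (intro homologous_rel_diff homologous_rel_refl) simp
    then have "x - a \<in> cls b" "a \<in> cls a" "x = a + (x - a)" by simp_all
    then show "x \<in> (\<Union>r\<in>cls a. \<Union>s\<in>cls b. {r + s})" by blast
  qed
  finally show ?thesis .
qed

lemma relcycle_path:
  fixes p q :: real
  assumes cont: "continuous_map (top_of_set {p..q}) Lam \<gamma>" and pq: "p \<le> q" and ends: "\<gamma> p \<in> Lam0" "\<gamma> q \<in> Lam0"
  shows "singular_relcycle 1 Lam Lam0 (path_chain \<gamma> p q)"
proof -
  let ?\<sigma> = "simplex_path \<gamma> p q"
  have \<sigma>: "singular_simplex (Suc 0) Lam ?\<sigma>"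
    using singular_simplex_path[OF cont, of p q] pq by simp
  have e: "?\<sigma> (edge 0) = \<gamma> p" "?\<sigma> (edge 1) = \<gamma> q"
    using edge_in[of 0] edge_in[of 1] by (simp_all add: simplex_path_def) (simp_all add: edge_def)
  have face: "singular_simplex 0 (subtopology Lam Lam0) (singular_face (Suc 0) k ?\<sigma>)" if "k \<le> Suc 0" for k
  proof -
    have "singular_simplex 0 Lam (singular_face (Suc 0) k ?\<sigma>)"
      using singular_simplex_singular_face[OF \<sigma>, of k] that by simp
    moreover have "singular_face (Suc 0) k ?\<sigma> (edge 0) \<in> Lam0"
      using that ends by (cases "k = 0") (auto simp: singular_face_1 e le_Suc_eq)
    ultimately show ?thesis by (simp add: singular_simplex_subtopology standard_simplex_0_edge)
  qed
  have "chain_boundary (Suc 0) (frag_of ?\<sigma>) =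
      frag_of (singular_face (Suc 0) 0 ?\<sigma>) - frag_of (singular_face (Suc 0) (Suc 0) ?\<sigma>)"
    by (simp add: chain_boundary_of)
  then have "singular_chain 0 (subtopology Lam Lam0) (chain_boundary (Suc 0) (frag_of ?\<sigma>))"
    using face[of 0] face[of "Suc 0"] by (simp add: singular_chain_diff singular_chain_of)
  then show ?thesis using \<sigma> by (simp add: singular_relcycle singular_chain_of)
qed

lemma gen_model: "gen = path_chain model (-1) 1"
  unfolding gen_def model_def
  by (rule arg_cong[where f = frag_of], rule simplex_path_eqI) (simp add: algebra_simps)

lemma relcycle_gen: "singular_relcycle 1 Lam Lam0 (frag_cmul k gen)"
proof (rule singular_relcycle_cmul)
  show "singular_relcycle 1 Lam Lam0 gen"
    unfolding gen_model
    by (rule relcycle_path[OF continuous_map_model]) (simp_all add: model_def chartL_Lam0_iff sym_det_def)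
qed

lemma multiple_unique: "homologous (frag_cmul k gen) (frag_cmul l gen) \<Longrightarrow> k = l"
proof -
  assume "homologous (frag_cmul k gen) (frag_cmul l gen)"
  from hom_diff[OF this hom_refl[of "frag_cmul l gen"]]
  have "homologous (frag_cmul (k - l) gen) 0" by (simp add: frag_cmul_diff_distrib)
  then show "k = l" using gen_infinite_order by fastforce
qed

lemma carrier_cases:
  assumes "C \<in> carrier (maslov_homology_group om L0)"
  obtains k where "C = cls (frag_cmul k gen)"
proof -
  obtain z where z: "C = cls z" "singular_relcycle 1 Lam Lam0 z" using assms unfolding maslov_carrier by blast
  from z(2) obtain k where "homologous z (frag_cmul k gen)" by (rule relcycle_multiple_of_gen)
  then show ?thesis using that z(1) cls_eq by metis
qed

lemma cls_gen_carrier: "cls (frag_cmul k gen) \<in> carrier (maslov_homology_group om L0)"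
  unfolding maslov_carrier using relcycle_gen by blast

lemma curve_class_eq: "curve_class om L0 c d \<gamma> = cls (path_chain \<gamma> c d)"
  unfolding curve_class_def curve_simplex_eq ..

lemma additive_int:
  fixes f :: "int \<Rightarrow> int"
  assumes add: "\<And>k l. f (k + l) = f k + f l" and "f 1 = 1"
  shows "f k = k"
proof (induction k rule: int_induct[of _ 0])
  case base show ?case using add[of 0 0] by simp
next
  case (step1 i) then show ?case using add[of i 1] assms(2) by simp
next
  case (step2 i) then show ?case using add[of "i - 1" 1] assms(2) by simp
qed

lemma is_maslov_iso_value:
  assumes \<mu>: "is_maslov_iso om L0 \<mu>"
  shows "\<mu> (cls (frag_cmul k gen)) = k"
proof (rule additive_int)
  have hom: "\<mu> \<in> Group.hom (maslov_homology_group om L0) integer_group"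
    using \<mu> unfolding is_maslov_iso_def iso_def by blast
  show "\<mu> (cls (frag_cmul (k + l) gen)) = \<mu> (cls (frag_cmul k gen)) + \<mu> (cls (frag_cmul l gen))" for k l
    using hom_mult[OF hom cls_gen_carrier[of k] cls_gen_carrier[of l]]
    unfolding maslov_mult mult_integer_group frag_cmul_distrib .
  have "\<mu> (curve_class om L0 (-1) 1 model) = 1"
    using \<mu> model_positive_crossing unfolding is_maslov_iso_def by blast
  then show "\<mu> (cls (frag_cmul 1 gen)) = 1"
    unfolding curve_class_eq gen_model frag_cmul_one .
qed

lemma exists_maslov_iso: "\<exists>\<mu>. is_maslov_iso om L0 \<mu>"
proof -
  let ?G = "maslov_homology_group om L0"
  define \<mu> where "\<mu> = (\<lambda>C\<in>carrier ?G. THE k. C = cls (frag_cmul k gen))"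
  have val: "\<mu> (cls (frag_cmul k gen)) = k" for k
  proof -
    have "(THE l. cls (frag_cmul k gen) = cls (frag_cmul l gen)) = k"
    proof (rule the_equality)
      fix l assume "cls (frag_cmul k gen) = cls (frag_cmul l gen)"
      then have "homologous (frag_cmul k gen) (frag_cmul l gen)" by (simp only: cls_eq)
      from multiple_unique[OF this] show "l = k" by simp
    qed (rule refl)
    then show ?thesis using cls_gen_carrier[of k] by (simp only: \<mu>_def restrict_apply if_True)
  qed
  have "\<mu> \<in> Group.hom ?G integer_group"
  proof (rule homI)
    fix C D assume "C \<in> carrier ?G" "D \<in> carrier ?G"
    then obtain k l where "C = cls (frag_cmul k gen)" "D = cls (frag_cmul l gen)"
      using carrier_cases by metis
    then show "\<mu> (C \<otimes>\<^bsub>?G\<^esub> D) = \<mu> C \<otimes>\<^bsub>integer_group\<^esub> \<mu> D"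
      by (simp only: maslov_mult frag_cmul_distrib[symmetric] val mult_integer_group)
  qed simp
  moreover have "bij_betw \<mu> (carrier ?G) (carrier integer_group)"
    unfolding bij_betw_def
  proof
    show "inj_on \<mu> (carrier ?G)"
    proof (rule inj_onI)
      fix C D assume CD: "C \<in> carrier ?G" "D \<in> carrier ?G" "\<mu> C = \<mu> D"
      then obtain k l where "C = cls (frag_cmul k gen)" "D = cls (frag_cmul l gen)"
        using carrier_cases by metis
      then show "C = D" using CD(3) by (simp only: val)
    qed
    have "k \<in> \<mu> ` carrier ?G" for k using val[of k] cls_gen_carrier[of k] by (metis imageI)
    then show "\<mu> ` carrier ?G = carrier integer_group" by auto
  qed
  moreover have "\<mu> (curve_class om L0 c d \<gamma>) = 1" if "positive_crossing_curve om L0 c d \<gamma>" for c d \<gamma>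
  proof -
    have "curve_class om L0 c d \<gamma> = cls (frag_cmul 1 gen)"
      unfolding curve_class_eq cls_eq frag_cmul_one by (rule positive_crossing_class[OF that])
    then show ?thesis by (simp only: val)
  qed
  moreover have "\<mu> \<in> extensional (carrier ?G)" by (simp add: \<mu>_def)
  ultimately have "is_maslov_iso om L0 \<mu>" unfolding is_maslov_iso_def iso_def by blast
  then show ?thesis by blast
qed

text \<open>The group is infinite cyclic with a generator represented by a positive crossing curve, so the normalisation
  determines the isomorphism.\<close>

theorem maslov_iso_value:
  assumes z: "homologous z (frag_cmul k gen)"
  shows "maslov_iso om L0 (cls z) = k"
proof -
  obtain \<mu> where \<mu>: "is_maslov_iso om L0 \<mu>" using exists_maslov_iso ..
  have "\<nu> = \<mu>" if \<nu>: "is_maslov_iso om L0 \<nu>" for \<nu>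
  proof (rule extensionalityI)
    show "\<nu> \<in> extensional (carrier (maslov_homology_group om L0))"
      "\<mu> \<in> extensional (carrier (maslov_homology_group om L0))"
      using \<mu> \<nu> unfolding is_maslov_iso_def by blast+
    fix C assume "C \<in> carrier (maslov_homology_group om L0)"
    then obtain k where "C = cls (frag_cmul k gen)" by (rule carrier_cases)
    then show "\<nu> C = \<mu> C" by (simp only: is_maslov_iso_value[OF \<mu>] is_maslov_iso_value[OF \<nu>])
  qed
  then have "maslov_iso om L0 = \<mu>" unfolding maslov_iso_def by (intro the_equality \<mu>)
  moreover have "cls z = cls (frag_cmul k gen)" using z by (simp only: cls_eq)
  ultimately show ?thesis by (simp only: is_maslov_iso_value[OF \<mu>])
qed

section \<open>Linear second order equations\<close>

lemma vec2_decompose: "vec2 a b = a *\<^sub>R vec2 1 0 + b *\<^sub>R vec2 0 1"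
  by (simp add: vec2_eq_iff)

lemma has_vector_derivative_vec2:
  assumes "(f has_real_derivative f') (at t within I)" "(g has_real_derivative g') (at t within I)"
  shows "((\<lambda>s. vec2 (f s) (g s)) has_vector_derivative vec2 f' g') (at t within I)"
proof -
  have "((\<lambda>s. f s *\<^sub>R vec2 1 0 + g s *\<^sub>R vec2 0 1) has_vector_derivative (f' *\<^sub>R vec2 1 0 + g' *\<^sub>R vec2 0 1)) (at t within I)"
    using assms by (auto intro!: derivative_eq_intros)
  then show ?thesis by (simp only: vec2_decompose[symmetric])
qed

text \<open>The differential inequality behind Gronwall's argument for the energy of a solution.\<close>

lemma energy_bound:
  fixes x y z :: "'b::real_inner"
  assumes M: "0 \<le> M" and z: "norm z \<le> M * norm x"
  shows "2 * (x \<bullet> y) + 2 * (y \<bullet> z) \<le> (1 + M) * (x \<bullet> x + y \<bullet> y)"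
proof -
  have 1: "x \<bullet> y \<le> norm x * norm y" by (rule norm_cauchy_schwarz)
  have 2: "y \<bullet> z \<le> norm y * norm z" by (rule norm_cauchy_schwarz)
  have 3: "norm y * norm z \<le> norm y * (M * norm x)" by (rule mult_left_mono[OF z]) simp
  have "(1 + M) * (2 * norm x * norm y) \<le> (1 + M) * ((norm x)\<^sup>2 + (norm y)\<^sup>2)"
    using M sum_squares_bound[of "norm x" "norm y"] by (intro mult_left_mono) auto
  moreover have "(1 + M) * (2 * norm x * norm y) = 2 * (norm x * norm y) + 2 * (norm y * (M * norm x))"
    by (simp add: algebra_simps)
  ultimately have "2 * (x \<bullet> y) + 2 * (y \<bullet> z) \<le> (1 + M) * ((norm x)\<^sup>2 + (norm y)\<^sup>2)" using 1 2 3 by linarith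
  then show ?thesis by (simp add: power2_norm_eq_inner)
qed

text \<open>The energy times a decaying exponential is nonincreasing, nonnegative and zero at the start.\<close>

lemma ode_solution_unique_zero:
  fixes R :: "real \<Rightarrow> (real^'n) \<Rightarrow>\<^sub>L (real^'n)"
  assumes R: "continuous_on {a..b} R" and J: "ode_solution a b R J J'" and init: "J a = 0" "J' a = 0"
    and t: "t \<in> {a..b}"
  shows "J t = 0 \<and> J' t = 0"
proof -
  have "compact (R ` {a..b})" using R by (intro compact_continuous_image) auto
  then obtain M where M: "M > 0" "\<And>t. t \<in> {a..b} \<Longrightarrow> norm (R t) \<le> M"
    using compact_imp_bounded bounded_pos by (metis imageI)
  define e where "e s = J s \<bullet> J s + J' s \<bullet> J' s" for s
  define f where "f s = e s * exp (- (1 + M) * s)" for s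
  have dJ: "(J has_vector_derivative J' s) (at s within {a..b})"
    "(J' has_vector_derivative R s (J s)) (at s within {a..b})" if "s \<in> {a..b}" for s
    using J that unfolding ode_solution_def by blast+
  have dinner: "((\<lambda>s. g s \<bullet> g s) has_real_derivative 2 * (g s \<bullet> g')) (at s within {a..b})"
    if "(g has_vector_derivative g') (at s within {a..b})" for g :: "real \<Rightarrow> real^'n" and g' s
  proof -
    have "((\<lambda>s. g s \<bullet> g s) has_derivative (\<lambda>h. g s \<bullet> (h *\<^sub>R g') + (h *\<^sub>R g') \<bullet> g s)) (at s within {a..b})"
      using that unfolding has_vector_derivative_def by (intro derivative_intros)
    moreover have "(\<lambda>h. g s \<bullet> (h *\<^sub>R g') + (h *\<^sub>R g') \<bullet> g s) = (*) (2 * (g s \<bullet> g'))"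
      by (auto simp: inner_commute)
    ultimately show ?thesis unfolding has_field_derivative_def by simp
  qed
  have de: "(e has_real_derivative 2 * (J s \<bullet> J' s) + 2 * (J' s \<bullet> R s (J s))) (at s within {a..b})"
    if "s \<in> {a..b}" for s
    unfolding e_def by (intro DERIV_add dinner dJ that)
  have df: "(f has_real_derivative (2 * (J s \<bullet> J' s) + 2 * (J' s \<bullet> R s (J s)) - (1 + M) * e s) * exp (- (1 + M) * s)) (at s within {a..b})"
    if "s \<in> {a..b}" for s
    unfolding f_def by (rule derivative_eq_intros de[OF that] refl)+ (simp add: algebra_simps)
  have neg: "2 * (J s \<bullet> J' s) + 2 * (J' s \<bullet> R s (J s)) - (1 + M) * e s \<le> 0" if "s \<in> {a..b}" for s
  proof -
    have "norm (R s (J s)) \<le> M * norm (J s)"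
      using norm_blinfun[of "R s" "J s"] mult_right_mono[OF M(2)[OF that] norm_ge_zero[of "J s"]] by linarith
    from energy_bound[OF less_imp_le[OF M(1)] this, of "J' s"] show ?thesis by (simp add: e_def)
  qed
  have "f t \<le> f a"
  proof (rule DERIV_nonpos_imp_decreasing_open[of a t f])
    show "a \<le> t" using t by simp
    show "continuous_on {a..t} f"
      by (rule continuous_on_subset[OF DERIV_continuous_on[OF df]]) (use t in auto)
    fix s assume s: "a < s" "s < t"
    then have "at s within {a..b} = at s" using t by (intro at_within_interior) simp
    then show "\<exists>y. (f has_real_derivative y) (at s) \<and> y \<le> 0"
      using df[of s] neg[of s] s t by (intro exI conjI) (auto intro: mult_nonpos_nonneg)
  qed
  moreover have "f a = 0" by (simp add: f_def e_def init)
  ultimately have "e t \<le> 0" by (simp add: f_def mult_le_0_iff)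
  then have "J t \<bullet> J t = 0" "J' t \<bullet> J' t = 0"
    using inner_ge_zero[of "J t"] inner_ge_zero[of "J' t"] unfolding e_def by linarith+
  then show ?thesis by simp
qed

lemma ode_solution_diff:
  assumes "ode_solution a b R J J'" "ode_solution a b R K K'"
  shows "ode_solution a b R (\<lambda>t. J t - K t) (\<lambda>t. J' t - K' t)"
  using assms unfolding ode_solution_def
  by (auto simp: blinfun.diff_right intro!: derivative_intros)

lemma ode_solution_combination:
  assumes "ode_solution a b R J J'" "ode_solution a b R K K'"
  shows "ode_solution a b R (\<lambda>t. x *\<^sub>R J t + y *\<^sub>R K t) (\<lambda>t. x *\<^sub>R J' t + y *\<^sub>R K' t)"
  unfolding ode_solution_def
proof (intro ballI conjI)
  fix t assume "t \<in> {a..b}"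
  then have "(J has_vector_derivative J' t) (at t within {a..b})" "(K has_vector_derivative K' t) (at t within {a..b})"
    "(J' has_vector_derivative R t (J t)) (at t within {a..b})" "(K' has_vector_derivative R t (K t)) (at t within {a..b})"
    using assms unfolding ode_solution_def by blast+
  note d = this
  show "((\<lambda>t. x *\<^sub>R J t + y *\<^sub>R K t) has_vector_derivative x *\<^sub>R J' t + y *\<^sub>R K' t) (at t within {a..b})"
    by (intro derivative_intros has_vector_derivative_scaleR[OF DERIV_const, simplified] d has_vector_derivative_add
        bounded_linear.has_vector_derivative[OF bounded_linear_scaleR_right])
  have "((\<lambda>t. x *\<^sub>R J' t + y *\<^sub>R K' t) has_vector_derivative x *\<^sub>R R t (J t) + y *\<^sub>R R t (K t)) (at t within {a..b})"
    by (intro has_vector_derivative_add d bounded_linear.has_vector_derivative[OF bounded_linear_scaleR_right])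
  then show "((\<lambda>t. x *\<^sub>R J' t + y *\<^sub>R K' t) has_vector_derivative R t (x *\<^sub>R J t + y *\<^sub>R K t)) (at t within {a..b})"
    by (simp add: blinfun.add_right blinfun.scaleR_right)
qed

section \<open>The example\<close>

text \<open>The polynomials are chosen as follows. Two vector solutions with components \<open>(u, v)\<close> span a Lagrangian family if and only if
  a bracket of the components vanishes, and then the coefficients of the equation are quotients of brackets. Requiring that
  \<open>u\<close>-components have Wronskian \<open>2 * s^3 * phi s ^ 2\<close>, that the determinant vanishes
  to order two at \<open>0\<close> and to order three at \<open>1\<close>, and that the coefficients have no poles at these points
  leads to a first order linear equation for \<open>phi\<close>, which is \<open>phi_psi\<close>, as \<open>phi\<close> has the derivative \<open>- 2 * s * psi s\<close>.
  They are polymorphic because the analyticity proof uses their complex extensions.\<close>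

definition phi :: "'a::field_char_0 \<Rightarrow> 'a" where "phi s = 385 - 495 * s^2 + 315 * s^4 - 77 * s^6"
definition psi :: "'a::field_char_0 \<Rightarrow> 'a" where "psi s = 495 - 630 * s^2 + 231 * s^4"
definition coefP :: "'a::field_char_0 \<Rightarrow> 'a" where "coefP s = (psi s - 6930 * (1 - s^2)^2) / phi s"
definition coefQ :: "'a::field_char_0 \<Rightarrow> 'a" where "coefQ s = 1155 / phi s"
definition coefR :: "'a::field_char_0 \<Rightarrow> 'a" where
  "coefR s = 60 * s^2 - 36 + (48 * s^2 * (1 - s^2) * psi s + 10395 * (1 - s^2)^4) / phi s"

lemma phi_psi: "3 * phi s - 4 * s^2 * psi s = 1155 * (1 - s^2)^3"
  by (simp add: phi_def psi_def power2_eq_square power3_eq_cube power4_eq_xxxx algebra_simps eval_nat_numeral)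

lemma phi_pos:
  fixes s :: real
  assumes "s \<in> {0..5/4}" shows "phi s > 0"
proof -
  define x where "x = s^2"
  have x: "0 \<le> x" "x \<le> 25/16" using assms power_mono[of s "5/4" 2] by (simp_all add: x_def power2_eq_square)
  have eq: "phi s = 385 - 495 * x + 315 * x^2 - 77 * x^2 * x"
    by (simp add: phi_def x_def flip: power_mult power_add)
  have "x^2 * x \<le> x^2 * (25/16)" by (intro mult_left_mono x) simp
  moreover have "0 \<le> (x - 5/4)^2" by simp
  then have "0 \<le> x^2 - 5/2 * x + 25/16" by (simp add: power2_eq_square algebra_simps)
  ultimately show ?thesis using x unfolding eq by linarith
qed

definition E12 :: "(real^2) \<Rightarrow>\<^sub>L (real^2)" where "E12 = Blinfun (\<lambda>x. vec2 (x$2) 0)"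
definition E21 :: "(real^2) \<Rightarrow>\<^sub>L (real^2)" where "E21 = Blinfun (\<lambda>x. vec2 0 (x$1))"

lemma E12_apply: "E12 x = vec2 (x$2) 0"
proof -
  have "linear (\<lambda>x::real^2. vec2 (x$2) 0)" by (rule linearI) (simp_all add: vec2_eq_iff)
  then show ?thesis unfolding E12_def by (subst bounded_linear_Blinfun_apply) (simp_all add: linear_conv_bounded_linear)
qed

lemma E21_apply: "E21 x = vec2 0 (x$1)"
proof -
  have "linear (\<lambda>x::real^2. vec2 0 (x$1))" by (rule linearI) (simp_all add: vec2_eq_iff)
  then show ?thesis unfolding E21_def by (subst bounded_linear_Blinfun_apply) (simp_all add: linear_conv_bounded_linear)
qed

definition Rop :: "real \<Rightarrow> (real^2) \<Rightarrow>\<^sub>L (real^2)" where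
  "Rop s = coefP s *\<^sub>R id_blinfun + coefQ s *\<^sub>R E12 + coefR s *\<^sub>R E21"

lemma Rop_apply: "Rop s x = vec2 (coefP s * x$1 + coefQ s * x$2) (coefR s * x$1 + coefP s * x$2)"
  by (simp add: Rop_def blinfun.add_left blinfun.scaleR_left E12_apply E21_apply vec2_eq_iff)

definition ufun :: "real \<Rightarrow> real" where "ufun s = s * phi s"
definition ufun' :: "real \<Rightarrow> real" where "ufun' s = phi s - 2 * s^2 * psi s"
definition ufun'' :: "real \<Rightarrow> real" where "ufun'' s = s * psi s - 3465 * s * (1 - s^2)^2"
definition hfun :: "real \<Rightarrow> real" where "hfun s = 3 * (1 - s^2)^2"
definition wfun :: "real \<Rightarrow> real" where "wfun s = 2 - 3 * s^2 + s^6"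
definition wfun' :: "real \<Rightarrow> real" where "wfun' s = 6 * s^5 - 6 * s"

text \<open>The fundamental solutions vanishing at \<open>0\<close>; primes denote derivatives.\<close>

definition J1 :: "real \<Rightarrow> real^2" where "J1 s = vec2 (ufun s) (hfun s * ufun s)"
definition J1' :: "real \<Rightarrow> real^2" where
  "J1' s = vec2 (ufun' s) (- 12 * s * (1 - s^2) * ufun s + hfun s * ufun' s)"
definition J2 :: "real \<Rightarrow> real^2" where "J2 s = vec2 (s^2 * ufun s) (wfun s * ufun s)"
definition J2' :: "real \<Rightarrow> real^2" where
  "J2' s = vec2 (2 * s * ufun s + s^2 * ufun' s) (wfun' s * ufun s + wfun s * ufun' s)"

lemma d_ufun: "(ufun has_real_derivative ufun' s) (at s within I)"
  unfolding ufun_def[abs_def] ufun'_def phi_def psi_def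
  by (rule derivative_eq_intros refl)+ (simp add: algebra_simps eval_nat_numeral)

lemma d_ufun': "(ufun' has_real_derivative ufun'' s) (at s within I)"
  unfolding ufun'_def[abs_def] ufun''_def phi_def psi_def
  by (rule derivative_eq_intros refl)+ (simp add: algebra_simps eval_nat_numeral)

lemma d_hfun: "(hfun has_real_derivative - 12 * s * (1 - s^2)) (at s within I)"
  unfolding hfun_def[abs_def]
  by (rule derivative_eq_intros refl)+ (simp add: algebra_simps eval_nat_numeral)

lemma d_wfun: "(wfun has_real_derivative wfun' s) (at s within I)"
  unfolding wfun_def[abs_def] wfun'_def
  by (rule derivative_eq_intros refl)+ (simp add: algebra_simps eval_nat_numeral)

lemma d_wfun': "(wfun' has_real_derivative 30 * s^4 - 6) (at s within I)"
  unfolding wfun'_def[abs_def]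
  by (rule derivative_eq_intros refl)+ (simp add: algebra_simps eval_nat_numeral)

lemma d_hfun': "((\<lambda>s. - 12 * s * (1 - s^2)) has_real_derivative 36 * s^2 - 12) (at s within I)"
  by (rule derivative_eq_intros refl)+ (simp add: algebra_simps eval_nat_numeral)

lemma ode_J1_fst: "s \<in> {0..5/4} \<Longrightarrow> ufun'' s = coefP s * ufun s + coefQ s * (hfun s * ufun s)"
proof -
  assume "s \<in> {0..5/4}"
  then have nz: "phi s \<noteq> 0" using phi_pos[of s] by simp
  have p: "coefP s * ufun s = s * (psi s - 6930 * (1 - s^2)^2)" using nz by (simp add: coefP_def ufun_def)
  have q: "coefQ s * (hfun s * ufun s) = 1155 * s * hfun s" using nz by (simp add: coefQ_def ufun_def)
  show ?thesis unfolding p q unfolding ufun''_def hfun_def by (simp add: algebra_simps)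
qed

lemma ode_J1_snd:
  assumes "s \<in> {0..5/4}"
  shows "(36 * s^2 - 12) * ufun s + 2 * (- 12 * s * (1 - s^2)) * ufun' s + hfun s * ufun'' s
    = coefR s * ufun s + coefP s * (hfun s * ufun s)"
proof -
  have nz: "phi s \<noteq> 0" using phi_pos[OF assms] by simp
  have r: "coefR s * ufun s = (60 * s^2 - 36) * ufun s + s * (48 * s^2 * (1 - s^2) * psi s + 10395 * (1 - s^2)^4)"
  proof -
    have "(x + y / phi s) * (s * phi s) = x * (s * phi s) + s * y" for x y using nz by (simp add: field_simps)
    then show ?thesis unfolding coefR_def ufun_def .
  qed
  have p: "coefP s * (hfun s * ufun s) = s * hfun s * (psi s - 6930 * (1 - s^2)^2)"
    using nz by (simp add: coefP_def ufun_def)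
  show ?thesis unfolding r p unfolding ufun_def ufun'_def ufun''_def hfun_def
    by (simp add: algebra_simps eval_nat_numeral)
qed

lemma ode_J2_fst:
  assumes "s \<in> {0..5/4}"
  shows "2 * ufun s + 4 * s * ufun' s + s^2 * ufun'' s = coefP s * (s^2 * ufun s) + coefQ s * (wfun s * ufun s)"
proof -
  have nz: "phi s \<noteq> 0" using phi_pos[OF assms] by simp
  have p: "coefP s * (s^2 * ufun s) = s^3 * (psi s - 6930 * (1 - s^2)^2)"
    using nz by (simp add: coefP_def ufun_def power3_eq_cube power2_eq_square)
  have q: "coefQ s * (wfun s * ufun s) = 1155 * s * wfun s"
    using nz by (simp add: coefQ_def ufun_def)
  \<comment> \<open>the only place where the relation between \<open>phi\<close> and \<open>psi\<close> enters\<close>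
  have e: "2 * ufun s + 4 * s * ufun' s = 2 * s * (3 * phi s - 4 * s^2 * psi s)"
    by (simp add: ufun_def ufun'_def algebra_simps eval_nat_numeral)
  show ?thesis unfolding p q e phi_psi unfolding ufun''_def wfun_def
    by (simp add: algebra_simps eval_nat_numeral)
qed

lemma ode_J2_snd:
  assumes "s \<in> {0..5/4}"
  shows "(30 * s^4 - 6) * ufun s + 2 * wfun' s * ufun' s + wfun s * ufun'' s
    = coefR s * (s^2 * ufun s) + coefP s * (wfun s * ufun s)"
proof -
  have nz: "phi s \<noteq> 0" using phi_pos[OF assms] by simp
  have r: "coefR s * (s^2 * ufun s) = s^2 * ((60 * s^2 - 36) * ufun s + s * (48 * s^2 * (1 - s^2) * psi s + 10395 * (1 - s^2)^4))"
  proof -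
    have "(x + y / phi s) * (s^2 * (s * phi s)) = s^2 * (x * (s * phi s) + s * y)" for x y
      using nz by (simp add: field_simps)
    then show ?thesis unfolding coefR_def ufun_def .
  qed
  have p: "coefP s * (wfun s * ufun s) = s * wfun s * (psi s - 6930 * (1 - s^2)^2)"
    using nz by (simp add: coefP_def ufun_def)
  show ?thesis unfolding r p unfolding ufun_def ufun'_def ufun''_def wfun_def wfun'_def phi_def psi_def
    by (simp add: algebra_simps eval_nat_numeral)
qed

lemma ode_J1: "ode_solution 0 (5/4) Rop J1 J1'"
  unfolding ode_solution_def
proof (intro ballI conjI)
  fix t :: real assume t: "t \<in> {0..5/4}"
  show "(J1 has_vector_derivative J1' t) (at t within {0..5/4})"
    unfolding J1_def[abs_def] J1'_def
    by (rule has_vector_derivative_vec2) (rule d_ufun, rule DERIV_cong[OF DERIV_mult[OF d_hfun d_ufun]], simp)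
  have "(J1' has_vector_derivative vec2 (ufun'' t)
      ((36 * t^2 - 12) * ufun t + 2 * (- 12 * t * (1 - t^2)) * ufun' t + hfun t * ufun'' t)) (at t within {0..5/4})"
    unfolding J1'_def[abs_def]
    by (rule has_vector_derivative_vec2, rule d_ufun',
      rule DERIV_cong[OF DERIV_add[OF DERIV_mult[OF d_hfun' d_ufun] DERIV_mult[OF d_hfun d_ufun']]]) (simp add: algebra_simps)
  then show "(J1' has_vector_derivative Rop t (J1 t)) (at t within {0..5/4})"
    unfolding ode_J1_snd[OF t] unfolding ode_J1_fst[OF t] Rop_apply by (simp add: J1_def)
qed

lemma ode_J2: "ode_solution 0 (5/4) Rop J2 J2'"
  unfolding ode_solution_def
proof (intro ballI conjI)
  fix t :: real assume t: "t \<in> {0..5/4}"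
  have sq: "((\<lambda>s::real. s^2) has_real_derivative 2 * t) (at t within I)" for I
    by (rule derivative_eq_intros refl)+ simp
  have lin: "((\<lambda>s::real. 2 * s) has_real_derivative 2) (at t within I)" for I
    by (rule derivative_eq_intros refl)+ simp
  show "(J2 has_vector_derivative J2' t) (at t within {0..5/4})"
    unfolding J2_def[abs_def] J2'_def
    by (rule has_vector_derivative_vec2)
      (rule DERIV_cong[OF DERIV_mult[OF sq d_ufun]], simp, rule DERIV_cong[OF DERIV_mult[OF d_wfun d_ufun]], simp)
  have "(J2' has_vector_derivative vec2 (2 * ufun t + 4 * t * ufun' t + t^2 * ufun'' t)
      ((30 * t^4 - 6) * ufun t + 2 * wfun' t * ufun' t + wfun t * ufun'' t)) (at t within {0..5/4})"
    unfolding J2'_def[abs_def]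
    by (rule has_vector_derivative_vec2,
      rule DERIV_cong[OF DERIV_add[OF DERIV_mult[OF lin d_ufun] DERIV_mult[OF sq d_ufun']]], simp add: algebra_simps,
      rule DERIV_cong[OF DERIV_add[OF DERIV_mult[OF d_wfun' d_ufun] DERIV_mult[OF d_wfun d_ufun']]], simp add: algebra_simps)
  then show "(J2' has_vector_derivative Rop t (J2 t)) (at t within {0..5/4})"
    unfolding ode_J2_fst[OF t] ode_J2_snd[OF t] Rop_apply by (simp add: J2_def)
qed

lemma continuous_on_Rop: "continuous_on {0..5/4} Rop"
proof -
  have nz: "phi t \<noteq> 0" if "t \<in> {0..5/4}" for t :: real using phi_pos[OF that] by simp
  show ?thesis
    unfolding Rop_def[abs_def] coefP_def coefQ_def coefR_def phi_def psi_def
    by (intro continuous_intros) (use nz in \<open>simp_all add: phi_def\<close>)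
qed

text \<open>Real parts of the Taylor coefficients of a holomorphic extension.\<close>

lemma holomorphic_real_expansion:
  assumes f: "f holomorphic_on ball (of_real t0) r"
    and eq: "\<And>t. \<bar>t - t0\<bar> < r \<Longrightarrow> f (of_real t) = of_real (g t)"
  shows "\<exists>A::nat \<Rightarrow> real. \<forall>t. \<bar>t - t0\<bar> < r \<longrightarrow> (\<lambda>k. (t - t0) ^ k * A k) sums g t"
proof (intro exI[of _ "\<lambda>k. Re ((deriv ^^ k) f (of_real t0) / fact k)"] allI impI)
  fix t assume t: "\<bar>t - t0\<bar> < r"
  then have "complex_of_real t \<in> ball (of_real t0) r" by (simp add: dist_real_def abs_minus_commute)
  from holomorphic_power_series[OF f this]
  have "(\<lambda>k. (deriv ^^ k) f (of_real t0) / fact k * (of_real t - of_real t0) ^ k) sums of_real (g t)"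
    unfolding eq[OF t] .
  then have "(\<lambda>k. Re ((deriv ^^ k) f (of_real t0) / fact k * (of_real t - of_real t0) ^ k)) sums Re (of_real (g t))"
    by (rule sums_Re)
  moreover have "Re (z * (of_real t - of_real t0) ^ k) = (t - t0) ^ k * Re z" for z k
    unfolding of_real_diff[symmetric] of_real_power[symmetric] by simp
  ultimately show "(\<lambda>k. (t - t0) ^ k * Re ((deriv ^^ k) f (of_real t0) / fact k)) sums g t"
    by (simp only: Re_complex_of_real)
qed

lemma real_analytic_add:
  assumes "real_analytic_on f I" "real_analytic_on g I"
  shows "real_analytic_on (\<lambda>t. f t + g t) I"
  unfolding real_analytic_on_def
proof
  fix t0 assume t0: "t0 \<in> I"
  obtain r A where A: "r > 0" "\<And>t. t \<in> I \<Longrightarrow> \<bar>t - t0\<bar> < r \<Longrightarrow> (\<lambda>k. (t - t0) ^ k *\<^sub>R A k) sums f t"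
    using assms(1) t0 unfolding real_analytic_on_def by blast
  obtain r' A' where A': "r' > 0" "\<And>t. t \<in> I \<Longrightarrow> \<bar>t - t0\<bar> < r' \<Longrightarrow> (\<lambda>k. (t - t0) ^ k *\<^sub>R A' k) sums g t"
    using assms(2) t0 unfolding real_analytic_on_def by blast
  have "(\<lambda>k. (t - t0) ^ k *\<^sub>R (A k + A' k)) sums (f t + g t)" if "t \<in> I" "\<bar>t - t0\<bar> < min r r'" for t
    using sums_add[OF A(2) A'(2), of t t] that by (simp add: scaleR_add_right)
  then show "\<exists>r>0. \<exists>A. \<forall>t\<in>I. \<bar>t - t0\<bar> < r \<longrightarrow> (\<lambda>k. (t - t0) ^ k *\<^sub>R A k) sums (f t + g t)"
    using A(1) A'(1) by (intro exI[of _ "min r r'"] conjI exI[of _ "\<lambda>k. A k + A' k"]) auto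
qed

text \<open>The denominator is nonzero near every point of the interval, also for complex arguments, so the quotient has
  a holomorphic extension.\<close>

lemma real_analytic_quotient_phi:
  fixes N :: "complex \<Rightarrow> complex" and n :: "real \<Rightarrow> real"
  assumes N: "N holomorphic_on UNIV" "\<And>t. N (of_real t) = of_real (n t)"
  shows "real_analytic_on (\<lambda>t. (n t / phi t) *\<^sub>R B) {0..5/4}"
  unfolding real_analytic_on_def
proof
  fix t0 :: real assume t0: "t0 \<in> {0..5/4}"
  have phi: "phi (complex_of_real t) = of_real (phi t)" for t by (simp add: phi_def)
  have "open {z::complex. phi z \<noteq> 0}"
  proof -
    have "open (phi -` (- {0::complex}))"
      by (rule open_vimage) (auto simp: phi_def[abs_def] open_Compl intro!: continuous_intros)
    then show ?thesis by (simp add: vimage_def)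
  qed
  moreover have "complex_of_real t0 \<in> {z. phi z \<noteq> 0}" using phi_pos[OF t0] by (simp add: phi)
  ultimately obtain r where r: "r > 0" "ball (complex_of_real t0) r \<subseteq> {z. phi z \<noteq> 0}"
    unfolding open_contains_ball by blast
  have ph: "phi holomorphic_on ball (complex_of_real t0) r"
    unfolding phi_def[abs_def] by (intro holomorphic_intros)
  have "(\<lambda>z. N z / phi z) holomorphic_on ball (of_real t0) r"
    by (rule holomorphic_on_divide[OF holomorphic_on_subset[OF N(1)] ph]) (use r(2) in auto)
  from holomorphic_real_expansion[OF this, of "\<lambda>t. n t / phi t"]
  obtain A where A: "\<And>t. \<bar>t - t0\<bar> < r \<Longrightarrow> (\<lambda>k. (t - t0) ^ k * A k) sums (n t / phi t)"
    by (auto simp: N(2) phi)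
  have "(\<lambda>k. (t - t0) ^ k *\<^sub>R (A k *\<^sub>R B)) sums ((n t / phi t) *\<^sub>R B)" if "\<bar>t - t0\<bar> < r" for t
    using bounded_linear.sums[OF bounded_linear_scaleR_left A[OF that], of B] by simp
  then show "\<exists>r>0. \<exists>A. \<forall>t\<in>{0..5/4}. \<bar>t - t0\<bar> < r \<longrightarrow> (\<lambda>k. (t - t0) ^ k *\<^sub>R A k) sums ((n t / phi t) *\<^sub>R B)"
    using r(1) by (intro exI[of _ r] conjI exI[of _ "\<lambda>k. A k *\<^sub>R B"]) auto
qed

lemma real_analytic_cong:
  "real_analytic_on f I \<Longrightarrow> (\<And>t. t \<in> I \<Longrightarrow> f t = g t) \<Longrightarrow> real_analytic_on g I"
  unfolding real_analytic_on_def by simp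

lemma real_analytic_Rop: "real_analytic_on Rop {0..5/4}"
proof -
  have P: "real_analytic_on (\<lambda>t. coefP t *\<^sub>R id_blinfun) {0..5/4}"
    unfolding coefP_def
    by (rule real_analytic_quotient_phi[of "\<lambda>z. psi z - 6930 * (1 - z^2)^2"])
      (auto simp: psi_def intro!: holomorphic_intros)
  have Q: "real_analytic_on (\<lambda>t. coefQ t *\<^sub>R E12) {0..5/4}"
    unfolding coefQ_def by (rule real_analytic_quotient_phi[of "\<lambda>z. 1155"]) auto
  have eq: "coefR t = ((60 * t^2 - 36) * phi t + (48 * t^2 * (1 - t^2) * psi t + 10395 * (1 - t^2)^4)) / phi t"
    if "t \<in> {0..5/4}" for t :: real
    using phi_pos[OF that] by (simp add: coefR_def add_divide_distrib)
  have R: "real_analytic_on (\<lambda>t. (((60 * t^2 - 36) * phi t + (48 * t^2 * (1 - t^2) * psi t + 10395 * (1 - t^2)^4)) / phi t) *\<^sub>R E21) {0..5/4}"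
    by (rule real_analytic_quotient_phi[of "\<lambda>z. (60 * z^2 - 36) * phi z + (48 * z^2 * (1 - z^2) * psi z + 10395 * (1 - z^2)^4)"])
      (auto simp: psi_def phi_def intro!: holomorphic_intros)
  show ?thesis
    unfolding Rop_def[abs_def]
    by (intro real_analytic_add P Q, rule real_analytic_cong[OF R]) (simp add: eq)
qed

lemma ufun_nz: "s \<in> {0..5/4} \<Longrightarrow> s \<noteq> 0 \<Longrightarrow> ufun s \<noteq> 0"
  using phi_pos[of s] by (simp add: ufun_def)

lemma w_minus_h: "wfun s - s^2 * hfun s = 2 * (1 - s^2)^3"
  by (simp add: wfun_def hfun_def algebra_simps eval_nat_numeral)

lemma J_at_0: "J1 0 = 0" "J2 0 = 0" "J1' 0 = vec2 385 1155" "J2' 0 = vec2 0 770"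
  by (simp_all add: J1_def J2_def J1'_def J2'_def ufun_def ufun'_def phi_def psi_def hfun_def wfun_def wfun'_def vec2_eq_iff)

lemma J_combination_zero:
  assumes s: "s \<in> {0..5/4}" "s \<noteq> 0" "s \<noteq> 1" and z: "x *\<^sub>R J1 s + y *\<^sub>R J2 s = 0"
  shows "x = 0 \<and> y = 0"
proof -
  have "(x + y * s^2) * ufun s = 0" "(x * hfun s + y * wfun s) * ufun s = 0"
    using z by (simp_all add: J1_def J2_def vec2_eq_iff algebra_simps)
  then have e: "x + y * s^2 = 0" "x * hfun s + y * wfun s = 0" using ufun_nz[OF s(1,2)] by simp_all
  have "y * (wfun s - s^2 * hfun s) = (x * hfun s + y * wfun s) - (x + y * s^2) * hfun s"
    by (simp add: algebra_simps)
  then have "y * (2 * (1 - s^2)^3) = 0" unfolding w_minus_h e by simp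
  moreover have "1 - s^2 \<noteq> 0" using s by (simp add: power2_eq_1_iff)
  ultimately have "y = 0" by simp
  then show ?thesis using e(1) by simp
qed

text \<open>At time \<open>1\<close> the positions are parallel and the derivatives are needed.\<close>

lemma phase_indep:
  assumes s: "s \<in> {0..5/4}" "s \<noteq> 0"
  shows "indep2 (J1 s, J1' s) (J2 s, J2' s)"
  unfolding indep2_def
proof (intro allI impI)
  fix x y assume "x *\<^sub>R (J1 s, J1' s) + y *\<^sub>R (J2 s, J2' s) = 0"
  then have z: "x *\<^sub>R J1 s + y *\<^sub>R J2 s = 0" "x *\<^sub>R J1' s + y *\<^sub>R J2' s = 0" by (simp_all add: zero_prod_def)
  show "x = 0 \<and> y = 0"
  proof (cases "s = 1")
    case False then show ?thesis using J_combination_zero[OF s _ z(1)] by simp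
  next
    case True
    have "(x + y) * ufun 1 = 0" using z(1) by (simp add: True J1_def J2_def vec2_eq_iff algebra_simps)
    then have xy: "x + y = 0" using ufun_nz[of 1] by simp
    have "(x + y) * ufun' 1 + 2 * y * ufun 1 = 0"
      using z(2) by (simp add: True J1'_def J2'_def vec2_eq_iff algebra_simps)
    then show ?thesis using xy ufun_nz[of 1] by simp
  qed
qed

text \<open>The bracket condition on the solutions; it is what makes the coefficients symmetric for the metric.\<close>

lemma phase_isotropic: "om (J1 s, J1' s) (J2 s, J2' s) = 0"
proof -
  have "om (J1 s, J1' s) (J2 s, J2' s) = ufun s * ufun s * (wfun' s + 2 * s * hfun s + 12 * s^3 * (1 - s^2))"
    by (simp add: om_eq J1_def J2_def J1'_def J2'_def algebra_simps eval_nat_numeral)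
  also have "wfun' s + 2 * s * hfun s + 12 * s^3 * (1 - s^2) = 0"
    by (simp add: wfun'_def hfun_def algebra_simps eval_nat_numeral)
  finally show ?thesis by simp
qed

lemma initial_space_eq: "initial_space hyp {0} (\<lambda>_ _. 0) = L0"
proof -
  have "y + form_operator hyp {0} (\<lambda>_ _. 0) 0 \<in> form_perp hyp {0}" for y
    by (simp add: form_perp_def hyp_def)
  then show ?thesis unfolding initial_space_def by auto
qed

lemma ode_unique:
  assumes "ode_solution 0 (5/4) Rop J J'" "J 0 = 0" "t \<in> {0..5/4}"
  defines "x \<equiv> J' 0$1 / 385" and "y \<equiv> (J' 0$2 - 3 * J' 0$1) / 770"
  shows "J t = x *\<^sub>R J1 t + y *\<^sub>R J2 t \<and> J' t = x *\<^sub>R J1' t + y *\<^sub>R J2' t"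
proof -
  note c = ode_solution_combination[OF ode_J1 ode_J2, of x y]
  have i: "J 0 - (x *\<^sub>R J1 0 + y *\<^sub>R J2 0) = 0" "J' 0 - (x *\<^sub>R J1' 0 + y *\<^sub>R J2' 0) = 0"
    by (simp_all add: assms(2) J_at_0 x_def y_def vec2_eq_iff field_simps)
  show ?thesis
    using ode_solution_unique_zero[OF continuous_on_Rop ode_solution_diff[OF assms(1) c] i assms(3)] by simp
qed

lemma PS_solution_iff:
  "PS_solution 0 (5/4) hyp Rop {0} (\<lambda>_ _. 0) J \<longleftrightarrow> (\<exists>J'. ode_solution 0 (5/4) Rop J J' \<and> J 0 = 0)"
  unfolding PS_solution_def initial_space_eq by auto

lemma PS_solution_combination: "PS_solution 0 (5/4) hyp Rop {0} (\<lambda>_ _. 0) (\<lambda>t. x *\<^sub>R J1 t + y *\<^sub>R J2 t)"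
  unfolding PS_solution_iff
  using ode_solution_combination[OF ode_J1 ode_J2, of x y] by (auto simp: J_at_0)

lemma PS_solutionE:
  assumes "PS_solution 0 (5/4) hyp Rop {0} (\<lambda>_ _. 0) J"
  obtains x y where "\<And>t. t \<in> {0..5/4} \<Longrightarrow> J t = x *\<^sub>R J1 t + y *\<^sub>R J2 t"
proof -
  obtain J' where "ode_solution 0 (5/4) Rop J J'" "J 0 = 0" using assms unfolding PS_solution_iff by blast
  from ode_unique[OF this] show ?thesis using that by blast
qed

section \<open>Focal instants and the focal index\<close>

lemma focal_iff: "focal_instant 0 (5/4) hyp Rop {0} (\<lambda>_ _. 0) t \<longleftrightarrow> t = 1"
proof
  assume "focal_instant 0 (5/4) hyp Rop {0} (\<lambda>_ _. 0) t"
  then obtain J where t: "0 < t" "t \<le> 5/4" and J: "PS_solution 0 (5/4) hyp Rop {0} (\<lambda>_ _. 0) J"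
    "\<exists>s\<in>{0..5/4}. J s \<noteq> 0" "J t = 0"
    unfolding focal_instant_def by blast
  obtain x y where xy: "\<And>t. t \<in> {0..5/4} \<Longrightarrow> J t = x *\<^sub>R J1 t + y *\<^sub>R J2 t" by (rule PS_solutionE[OF J(1)]) blast
  show "t = 1"
  proof (rule ccontr)
    assume "t \<noteq> 1"
    then have "x = 0 \<and> y = 0" using J_combination_zero[of t x y] t J(3) xy[of t] by simp
    then show False using J(2) xy by auto
  qed
next
  assume t: "t = 1"
  \<comment> \<open>\<open>J2 - J1\<close> has the factor \<open>1 - s^2\<close> in both components\<close>
  let ?J = "\<lambda>t. (-1) *\<^sub>R J1 t + 1 *\<^sub>R J2 t"
  have "?J 1 = 0" by (simp add: J1_def J2_def vec2_eq_iff hfun_def wfun_def)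
  moreover have "?J (1/2) \<noteq> 0" using J_combination_zero[of "1/2" "-1" 1] by auto
  then have "\<exists>s\<in>{0..5/4}. ?J s \<noteq> 0" by (intro bexI[of _ "1/2"]) auto
  ultimately show "focal_instant 0 (5/4) hyp Rop {0} (\<lambda>_ _. 0) t"
    unfolding focal_instant_def t using PS_solution_combination[of "-1" 1] by (intro conjI exI[of _ ?J]) simp_all
qed

lemma solution_values_1: "solution_values 0 (5/4) hyp Rop {0} (\<lambda>_ _. 0) 1 = {v. v$2 = 0}"
proof (intro equalityI subsetI)
  fix v assume "v \<in> solution_values 0 (5/4) hyp Rop {0} (\<lambda>_ _. 0) 1"
  then obtain J where J: "PS_solution 0 (5/4) hyp Rop {0} (\<lambda>_ _. 0) J" "v = J 1" unfolding solution_values_def by blast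
  obtain x y where "\<And>t. t \<in> {0..5/4} \<Longrightarrow> J t = x *\<^sub>R J1 t + y *\<^sub>R J2 t" by (rule PS_solutionE[OF J(1)]) blast
  then have "v = x *\<^sub>R J1 1 + y *\<^sub>R J2 1" using J(2) by simp
  then show "v \<in> {v. v$2 = 0}" by (simp add: J1_def J2_def hfun_def wfun_def)
next
  fix v :: "real^2" assume "v \<in> {v. v$2 = 0}"
  then have "v = (v$1 / ufun 1) *\<^sub>R J1 1 + 0 *\<^sub>R J2 1"
    using ufun_nz[of 1] by (simp add: J1_def vec2_eq_iff hfun_def)
  then show "v \<in> solution_values 0 (5/4) hyp Rop {0} (\<lambda>_ _. 0) 1"
    unfolding solution_values_def using PS_solution_combination[of "v$1 / ufun 1" 0]
    by (intro CollectI exI[of _ "\<lambda>t. (v$1 / ufun 1) *\<^sub>R J1 t + 0 *\<^sub>R J2 t"] conjI)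
qed

text \<open>The positions at time \<open>1\<close> fill a null line, which is its own orthogonal complement.\<close>

lemma focal_signature_1: "focal_signature 0 (5/4) hyp Rop {0} (\<lambda>_ _. 0) 1 = 0"
proof -
  have perp: "form_perp hyp {v. v$2 = 0} = {v :: real^2. v$2 = 0}"
  proof (intro equalityI subsetI)
    fix w assume w: "w \<in> form_perp hyp {v. v$2 = 0}"
    have "hyp (vec2 1 0) w = 0" using w unfolding form_perp_def by simp
    then show "w \<in> {v. v$2 = 0}" by (simp add: hyp_def)
  qed (simp add: form_perp_def hyp_def)
  have z: "{dim U | U. subspace U \<and> U \<subseteq> {v :: real^2. v$2 = 0} \<and> (\<forall>x\<in>U. x \<noteq> 0 \<longrightarrow> P (hyp x x))} = {0}"
    if "\<not> P 0" for P
  proof -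
    have "dim U = 0" if U: "U \<subseteq> {v :: real^2. v$2 = 0}" "\<forall>x\<in>U. x \<noteq> 0 \<longrightarrow> P (hyp x x)" for U
    proof -
      have "x = 0" if "x \<in> U" for x
      proof (rule ccontr)
        assume "x \<noteq> 0"
        moreover have "hyp x x = 0" using U(1) that by (auto simp: hyp_def)
        ultimately show False using U(2) that \<open>\<not> P 0\<close> by auto
      qed
      then show ?thesis unfolding dim_eq_0 by blast
    qed
    moreover have "subspace {0 :: real^2}" by simp
    ultimately show ?thesis by (auto intro!: exI[of _ "{0 :: real^2}"])
  qed
  have "n_plus hyp {v :: real^2. v$2 = 0} = 0" "n_minus hyp {v :: real^2. v$2 = 0} = 0"
    unfolding n_plus_def n_minus_def using z[of "\<lambda>r. r > 0"] z[of "\<lambda>r. r < 0"] by simp_all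
  then show ?thesis unfolding focal_signature_def solution_values_1 perp form_signature_def by simp
qed

lemma n_plus_hyp: "n_plus hyp UNIV = 1"
  unfolding n_plus_def
proof (rule Max_eqI)
  let ?S = "{dim U | U. subspace U \<and> U \<subseteq> UNIV \<and> (\<forall>x\<in>U. x \<noteq> (0::real^2) \<longrightarrow> 0 < hyp x x)}"
  have "dim U \<le> 2" for U :: "(real^2) set" using dim_subset_UNIV[of U] by simp
  then have "?S \<subseteq> {..2}" by auto
  then show "finite ?S" using finite_subset by blast
  show "n \<le> 1" if n: "n \<in> ?S" for n
  proof -
    obtain U where U: "n = dim U" "subspace U" "\<forall>x\<in>U. x \<noteq> (0::real^2) \<longrightarrow> 0 < hyp x x" using n by blast
    have "dim U \<noteq> 2"
    proof
      assume "dim U = 2"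
      then have "U = UNIV" using subspace_dim_equal[of U UNIV] U(2) by simp
      then have "vec2 1 0 \<in> U" by simp
      moreover have "vec2 1 0 \<noteq> (0::real^2)" by (simp add: vec2_eq_iff)
      ultimately have "0 < hyp (vec2 1 0) (vec2 1 0)" using U(3) by blast
      then show False by (simp add: hyp_def)
    qed
    then show ?thesis using \<open>\<And>U. dim U \<le> 2\<close>[of U] U(1) by simp
  qed
  have "0 < hyp x x" if "x \<in> span {vec2 1 1 :: real^2}" "x \<noteq> 0" for x
  proof -
    obtain k where k: "x = k *\<^sub>R vec2 1 1" using \<open>x \<in> span {vec2 1 1}\<close> by (auto simp: span_singleton)
    then have "k \<noteq> 0" using that(2) by auto
    then have "k * k > 0" by (metis not_real_square_gt_zero)
    then show ?thesis by (simp add: k hyp_def)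
  qed
  moreover have "dim (span {vec2 1 1 :: real^2}) = 1"
    by (subst dim_span_eq_card_independent) (simp_all add: vec2_eq_iff)
  ultimately show "1 \<in> ?S" by (intro CollectI exI[of _ "span {vec2 1 1 :: real^2}"]) auto
qed

section \<open>The Maslov index of the example\<close>

abbreviation curve :: "real \<Rightarrow> phase set" where
  "curve \<equiv> quadruple_curve 0 (5/4) hyp Rop {0} (\<lambda>_ _. 0)"

lemma curve_eq:
  assumes t: "t \<in> {0..5/4}"
  shows "curve t = span {(J1 t, J1' t), (J2 t, J2' t)}"
proof -
  have flow: "phase_flow 0 (5/4) Rop t (0, v) = (v$1 / 385) *\<^sub>R (J1 t, J1' t) + ((v$2 - 3 * v$1) / 770) *\<^sub>R (J2 t, J2' t)" for v
    unfolding phase_flow_def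
  proof (rule the_equality)
    let ?x = "v$1 / 385" and ?y = "(v$2 - 3 * v$1) / 770"
    show "\<exists>J J'. ode_solution 0 (5/4) Rop J J' \<and> (0, v) = (J 0, J' 0) \<and>
        ?x *\<^sub>R (J1 t, J1' t) + ?y *\<^sub>R (J2 t, J2' t) = (J t, J' t)"
    proof (intro exI conjI)
      show "ode_solution 0 (5/4) Rop (\<lambda>t. ?x *\<^sub>R J1 t + ?y *\<^sub>R J2 t) (\<lambda>t. ?x *\<^sub>R J1' t + ?y *\<^sub>R J2' t)"
        by (rule ode_solution_combination[OF ode_J1 ode_J2])
      show "(0, v) = (?x *\<^sub>R J1 0 + ?y *\<^sub>R J2 0, ?x *\<^sub>R J1' 0 + ?y *\<^sub>R J2' 0)"
        by (simp add: J_at_0 vec2_eq_iff field_simps)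
    qed simp
    fix q assume "\<exists>J J'. ode_solution 0 (5/4) Rop J J' \<and> (0, v) = (J 0, J' 0) \<and> q = (J t, J' t)"
    then obtain J J' where J: "ode_solution 0 (5/4) Rop J J'" "J 0 = 0" "J' 0 = v" "q = (J t, J' t)" by auto
    show "q = ?x *\<^sub>R (J1 t, J1' t) + ?y *\<^sub>R (J2 t, J2' t)"
      using ode_unique[OF J(1,2) t] by (simp add: J(3,4))
  qed
  have "curve t = range (\<lambda>v. phase_flow 0 (5/4) Rop t (0, v))"
    unfolding quadruple_curve_def initial_space_eq by auto
  also have "\<dots> = span {(J1 t, J1' t), (J2 t, J2' t)}"
  proof (intro equalityI subsetI)
    fix p assume "p \<in> range (\<lambda>v. phase_flow 0 (5/4) Rop t (0, v))"
    then show "p \<in> span {(J1 t, J1' t), (J2 t, J2' t)}" unfolding flow span2_iff by blast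
  next
    fix p assume "p \<in> span {(J1 t, J1' t), (J2 t, J2' t)}"
    then obtain x y where p: "p = x *\<^sub>R (J1 t, J1' t) + y *\<^sub>R (J2 t, J2' t)" unfolding span2_iff by blast
    have "phase_flow 0 (5/4) Rop t (0, vec2 (385 * x) (770 * y + 1155 * x)) = p"
      unfolding flow p by simp
    then show "p \<in> range (\<lambda>v. phase_flow 0 (5/4) Rop t (0, v))" by (metis rangeI)
  qed
  finally show ?thesis .
qed

lemma continuous_on_J:
  "continuous_on T J1" "continuous_on T J2" "continuous_on T J1'" "continuous_on T J2'"
proof -
  have [continuous_intros]: "continuous_on T (\<lambda>s. vec2 (f s) (g s))"
    if "continuous_on T f" "continuous_on T g" for f g
    by (subst vec2_decompose) (intro continuous_intros that)
  show "continuous_on T J1" "continuous_on T J2" "continuous_on T J1'" "continuous_on T J2'"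
    unfolding J1_def[abs_def] J2_def[abs_def] J1'_def[abs_def] J2'_def[abs_def] ufun_def ufun'_def
      hfun_def wfun_def wfun'_def phi_def psi_def
    by (intro continuous_intros)+
qed

lemma continuous_map_curve:
  assumes "T \<subseteq> {0<..5/4}"
  shows "continuous_map (top_of_set T) Lam curve"
proof -
  have "continuous_map (top_of_set T) Lam (\<lambda>t. span {(J1 t, J1' t), (J2 t, J2' t)})"
    by (rule continuous_map_lagrangian_span)
      (use assms phase_indep phase_isotropic in \<open>auto intro!: continuous_on_J continuous_intros\<close>)
  then show ?thesis
    by (rule continuous_map_eq) (use assms curve_eq in auto)
qed

text \<open>For any two vectors of a graph the pairings with the \<open>k\<close> give their coordinates and the pairings with
  the \<open>l\<close> the images of these under the chart matrix.\<close>

lemma frame_determinants: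
  assumes u: "u1 \<in> chartL c m" "u2 \<in> chartL c m"
  shows "om u1 (0, vec2 1 0) * om u2 (0, vec2 0 1) - om u1 (0, vec2 0 1) * om u2 (0, vec2 1 0)
    = (om u1 (vec2 0 1, vec2 c 0) * om u2 (vec2 1 0, vec2 0 c) - om u1 (vec2 1 0, vec2 0 c) * om u2 (vec2 0 1, vec2 c 0)) * sym_det m"
proof -
  obtain x y z where m: "m = (x, y, z)" by (cases m)
  obtain a b where 1: "u1 = a *\<^sub>R ch.b1 c m + b *\<^sub>R ch.b2 c m"
    using u(1) unfolding chartL_def ch.graph_def span2_iff by blast
  obtain a' b' where 2: "u2 = a' *\<^sub>R ch.b1 c m + b' *\<^sub>R ch.b2 c m"
    using u(2) unfolding chartL_def ch.graph_def span2_iff by blast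
  have l: "om (a *\<^sub>R ch.b1 c m + b *\<^sub>R ch.b2 c m) (0, vec2 1 0) = a * x + b * y"
    "om (a *\<^sub>R ch.b1 c m + b *\<^sub>R ch.b2 c m) (0, vec2 0 1) = a * y + b * z"
    "om (a *\<^sub>R ch.b1 c m + b *\<^sub>R ch.b2 c m) (vec2 0 1, vec2 c 0) = - a"
    "om (a *\<^sub>R ch.b1 c m + b *\<^sub>R ch.b2 c m) (vec2 1 0, vec2 0 c) = - b" for a b
    unfolding m ch_b by (simp_all add: om_eq algebra_simps)
  show ?thesis unfolding 1 2 l by (simp add: m sym_det_def power2_eq_square algebra_simps)
qed

text \<open>The pairing determinant with the complement of the chart \<open>chartL 1\<close>; the curve is in this chart where it is nonzero.\<close>

definition Kdet :: "real \<Rightarrow> real" where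
  "Kdet s = (J1 s$2 - J1' s$1) * (J2 s$1 - J2' s$2) - (J1 s$1 - J1' s$2) * (J2 s$2 - J2' s$1)"

lemma Kdet_om:
  "om (J1 s, J1' s) (vec2 0 1, vec2 1 0) * om (J2 s, J2' s) (vec2 1 0, vec2 0 1)
    - om (J1 s, J1' s) (vec2 1 0, vec2 0 1) * om (J2 s, J2' s) (vec2 0 1, vec2 1 0) = Kdet s"
  by (simp add: Kdet_def om_eq)

lemma curve_chart:
  assumes "s \<in> {0<..5/4}"
  shows "lag_transverse om (curve s) (ch.K 1) \<longleftrightarrow> Kdet s \<noteq> 0"
proof -
  have s: "s \<in> {0..5/4}" "s \<noteq> 0" using assms by auto
  show ?thesis
    unfolding curve_eq[OF s(1)] lag_transverse_det[OF phase_indep[OF s] phase_isotropic ch.indep2_k ch.kk]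
    by (simp only: Kdet_om)
qed

lemma curve_sym_det:
  assumes "s \<in> {0<..5/4}" "Kdet s \<noteq> 0"
  shows "Kdet s * sym_det (ch.coords 1 (curve s)) = - 2 * (ufun s)^2 * (1 - s^2)^3"
proof -
  have s: "s \<in> {0..5/4}" using assms by auto
  have "chartL 1 (ch.coords 1 (curve s)) = curve s"
    unfolding chartL_def by (rule ch.graph_coords) (use assms curve_chart in blast)
  then have "(J1 s, J1' s) \<in> chartL 1 (ch.coords 1 (curve s))" "(J2 s, J2' s) \<in> chartL 1 (ch.coords 1 (curve s))"
    by (simp_all add: curve_eq[OF s] span_base)
  from frame_determinants[OF this]
  have "Kdet s * sym_det (ch.coords 1 (curve s)) = J1 s$2 * J2 s$1 - J1 s$1 * J2 s$2"
    unfolding Kdet_om by (simp add: om_eq)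
  also have "\<dots> = - ((ufun s)^2 * (wfun s - s^2 * hfun s))"
    by (simp add: J1_def J2_def power2_eq_square algebra_simps)
  finally show ?thesis unfolding w_minus_h by simp
qed

text \<open>At the focal instant both positions and both velocities lie in the null line. Consequently the tangent form of the curve vanishes on
  the intersection with \<open>L0\<close>, and the crossing is not transverse.\<close>

lemma curve_1: "curve 1 = chartL 1 (0, 0, -1)" and Kdet_1: "Kdet 1 > 0"
proof -
  have u: "ufun 1 = 128" by (simp add: ufun_def phi_def)
  have J: "J1 1 = vec2 128 0" "J2 1 = vec2 128 0" "J1' 1 = vec2 (ufun' 1) 0" "J2' 1 = vec2 (ufun' 1 + 256) 0"
    by (simp_all add: J1_def J2_def J1'_def J2'_def u hfun_def wfun_def wfun'_def vec2_eq_iff)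
  show "Kdet 1 > 0" by (simp add: Kdet_def J algebra_simps)
  have b: "ch.b1 1 (0, 0, -1) = (vec2 0 0, vec2 1 0)" "ch.b2 1 (0, 0, -1) = (vec2 (-1) 0, vec2 0 0)"
    unfolding ch_b by (simp_all add: prod_eq_iff vec2_eq_iff)
  have "curve 1 \<subseteq> chartL 1 (0, 0, -1)"
    unfolding curve_eq[of 1, simplified]
  proof (rule span_minimal)
    have "(J1 1, J1' 1) = ufun' 1 *\<^sub>R ch.b1 1 (0, 0, -1) + (-128) *\<^sub>R ch.b2 1 (0, 0, -1)"
      "(J2 1, J2' 1) = (ufun' 1 + 256) *\<^sub>R ch.b1 1 (0, 0, -1) + (-128) *\<^sub>R ch.b2 1 (0, 0, -1)"
      by (simp_all add: b J prod_eq_iff vec2_eq_iff)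
    then show "{(J1 1, J1' 1), (J2 1, J2' 1)} \<subseteq> chartL 1 (0, 0, -1)"
      unfolding chartL_def ch.graph_def using span2_iff by blast
  qed (use lagrangian_chartL[of 1 "(0, 0, -1)"] in \<open>simp add: lagrangian_def\<close>)
  moreover have lag: "lagrangian om (curve 1)"
    unfolding curve_eq[of 1, simplified] by (rule lagrangian_span[OF phase_indep phase_isotropic]) auto
  ultimately show "curve 1 = chartL 1 (0, 0, -1)"
    using lagrangian_dim[OF lag] lagrangian_dim[OF lagrangian_chartL[of 1 "(0, 0, -1)"]] lagrangian_chartL[of 1 "(0, 0, -1)"]
    unfolding lagrangian_def by (intro subspace_dim_equal) auto
qed

lemma curve_Lam0:
  assumes "s \<in> {0<..5/4}" shows "curve s \<in> Lam0 \<longleftrightarrow> s \<noteq> 1"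
proof -
  have s: "s \<in> {0..5/4}" "s \<noteq> 0" using assms by auto
  have "curve s \<in> Lam0 \<longleftrightarrow> lag_transverse om (curve s) hz.K" by (simp only: Lam0_iff hz_K)
  also have "\<dots> \<longleftrightarrow> J1 s$1 * J2 s$2 - J1 s$2 * J2 s$1 \<noteq> 0"
    unfolding curve_eq[OF s(1)] lag_transverse_det[OF phase_indep[OF s] phase_isotropic hz.indep2_k hz.kk]
    by (auto simp: om_eq algebra_simps)
  also have "J1 s$1 * J2 s$2 - J1 s$2 * J2 s$1 = (ufun s)^2 * (wfun s - s^2 * hfun s)"
    by (simp add: J1_def J2_def power2_eq_square algebra_simps)
  also have "\<dots> \<noteq> 0 \<longleftrightarrow> s \<noteq> 1"
    unfolding w_minus_h using ufun_nz[OF s] s by (auto simp: power2_eq_1_iff)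
  finally show ?thesis .
qed

lemma curve_ge1:
  assumes "s \<in> {0<..5/4}" shows "curve s \<in> lag_stratum_ge1 om L0 \<longleftrightarrow> s = 1"
proof -
  have s: "s \<in> {0..5/4}" "s \<noteq> 0" using assms by auto
  have "lagrangian om (curve s)"
    unfolding curve_eq[OF s(1)] by (rule lagrangian_span[OF phase_indep[OF s] phase_isotropic])
  then show ?thesis using ge1_iff curve_Lam0[OF assms] by blast
qed

text \<open>The determinant of the chart matrix has the sign of \<open>s - 1\<close>, having a triple zero at \<open>1\<close>, and the nonzero eigenvalue is
  \<open>-1\<close>; so the index of the matrix drops from one to zero.\<close>

lemma curve_class_value:
  assumes c: "0 < c" "c < 1" and d: "1 < d" "d < 5/4"
  shows "homologous (path_chain curve c d) (frag_cmul (-1) gen)"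
proof -
  have co: "ch.coords 1 (curve 1) = (0, 0, -1)" unfolding curve_1 chartL_def by (rule ch.coords_graph)
  have "continuous_on UNIV Kdet"
    unfolding Kdet_def[abs_def] by (intro continuous_intros continuous_on_J)
  then have "isCont Kdet 1" by (simp add: continuous_on_eq_continuous_at)
  then obtain e where e: "e > 0" "\<And>s. dist s 1 < e \<Longrightarrow> dist (Kdet s) (Kdet 1) < Kdet 1"
    using Kdet_1 unfolding continuous_at_eps_delta dist_real_def by blast
  show ?thesis
  proof (rule crossing_class_sign)
    show "continuous_map (top_of_set {c..d}) Lam curve" by (rule continuous_map_curve) (use c d in auto)
    show "lag_transverse om (curve 1) (ch.K 1)" unfolding curve_1 by (rule chartL_transverse)
    show "curve s \<in> Lam0" if "s \<in> {c..d}" "s \<noteq> 1" for s using curve_Lam0[of s] that c d by auto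
    show "sym_tr (ch.coords 1 (curve 1)) \<noteq> 0" by (simp add: co sym_tr_def)
    fix s assume s: "s \<in> {c..d}" "0 < \<bar>s - 1\<bar>" "\<bar>s - 1\<bar> < e"
    have s': "s \<in> {0<..5/4}" using s c d by auto
    have K: "Kdet s > 0" using e(2)[of s] s by (auto simp: dist_real_def abs_if split: if_splits)
    have "0 < (s - 1) * (- 2 * (ufun s)^2 * (1 - s^2)^3)"
    proof -
      have "(s - 1) * (- 2 * (ufun s)^2 * (1 - s^2)^3) = 2 * (ufun s)^2 * ((s - 1)^2)^2 * (s + 1)^3"
        by (simp add: algebra_simps eval_nat_numeral)
      moreover have "ufun s \<noteq> 0" using ufun_nz[of s] s' by auto
      then have "0 < 2 * (ufun s)^2 * ((s - 1)^2)^2 * (s + 1)^3"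
        using s s' by (intro mult_pos_pos) auto
      ultimately show ?thesis by (simp only:)
    qed
    then have "0 < Kdet s * ((s - 1) * sym_det (ch.coords 1 (curve s)))"
      using curve_sym_det[OF s'] K
      by (simp only: mult.left_commute[of "Kdet s" "s - 1" "sym_det (ch.coords 1 (curve s))"] less_imp_neq[THEN not_sym] simp_thms)
    then have "0 < (s - 1) * sym_det (ch.coords 1 (curve s))" using K by (simp add: zero_less_mult_iff)
    moreover have "of_int (-1) * (s - 1) * (sym_tr (ch.coords 1 (curve 1)) * sym_det (ch.coords 1 (curve s)))
        = (s - 1) * sym_det (ch.coords 1 (curve s))"
      by (simp add: co sym_tr_def algebra_simps)
    ultimately show "0 < of_int (-1) * (s - 1) * (sym_tr (ch.coords 1 (curve 1)) * sym_det (ch.coords 1 (curve s)))"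
      by (simp only:)
  qed (use c d e in auto)
qed

lemma maslov_index_curve: "maslov_index 0 (5/4) hyp Rop {0} (\<lambda>_ _. 0) = -1"
  unfolding maslov_index_def curve_maslov_index_def
proof (rule the_equality)
  have val: "maslov_iso om L0 (curve_class om L0 c d curve) = -1" if "0 < c" "c < 1" "1 < d" "d < 5/4" for c d
    unfolding curve_class_eq by (rule maslov_iso_value[OF curve_class_value[OF that]])
  have cr: "{t \<in> {0<..<5/4}. curve t \<in> lag_stratum_ge1 om L0} = {1}"
    using curve_ge1 by auto
  show "\<exists>c d. 0 < c \<and> c < d \<and> d < 5/4 \<and> {t \<in> {0<..<5/4}. curve t \<in> lag_stratum_ge1 om L0} \<subseteq> {c..d} \<and>
      curve c \<notin> lag_stratum_ge1 om L0 \<and> curve d \<notin> lag_stratum_ge1 om L0 \<and>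
      -1 = maslov_iso om L0 (curve_class om L0 c d curve)"
    unfolding cr
    by (intro exI[of _ "1/2"] exI[of _ "9/8"] conjI) (simp_all add: curve_ge1 val)
  fix k assume "\<exists>c d. 0 < c \<and> c < d \<and> d < 5/4 \<and> {t \<in> {0<..<5/4}. curve t \<in> lag_stratum_ge1 om L0} \<subseteq> {c..d} \<and>
      curve c \<notin> lag_stratum_ge1 om L0 \<and> curve d \<notin> lag_stratum_ge1 om L0 \<and>
      k = maslov_iso om L0 (curve_class om L0 c d curve)"
  then obtain c d where cd: "0 < c" "c < d" "d < 5/4" "{1} \<subseteq> {c..d}"
      "curve c \<notin> lag_stratum_ge1 om L0" "curve d \<notin> lag_stratum_ge1 om L0"
      "k = maslov_iso om L0 (curve_class om L0 c d curve)" unfolding cr by blast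
  have "c \<noteq> 1" "d \<noteq> 1" using cd(1,2,3,5,6) curve_ge1[of c] curve_ge1[of d] by auto
  then have "c < 1" "1 < d" using cd(4) by auto
  then show "k = -1" using val cd by simp
qed

lemma admissible_Rop: "admissible_quadruple 0 (5/4) hyp Rop {0} (\<lambda>_ _. 0)"
  unfolding admissible_quadruple_def
proof (intro conjI ballI allI)
  show "sym_bilinear_on UNIV hyp" by (simp add: sym_bilinear_on_def hyp_def algebra_simps)
  show "nondegenerate_on UNIV hyp"
    unfolding nondegenerate_on_def
  proof (intro ballI impI)
    fix x :: "real^2" assume "\<forall>y\<in>UNIV. hyp x y = 0"
    then have "hyp x (vec2 1 0) = 0" "hyp x (vec2 0 1) = 0" by blast+
    then show "x = 0" by (simp add: hyp_def vec2_eq_iff)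
  qed
  show "hyp (Rop t x) y = hyp x (Rop t y)" for t x y
    by (simp add: Rop_apply hyp_def algebra_simps)
  show "nondegenerate_on {0} hyp" by (simp add: nondegenerate_on_def)
  show "sym_bilinear_on {0} (\<lambda>_ _. 0)" by (simp add: sym_bilinear_on_def)
qed (simp_all add: continuous_on_Rop)

theorem mainTheorem6:
  shows "\<exists>(a::real) (b::real) (g :: real^2 \<Rightarrow> real^2 \<Rightarrow> real)
           (R :: real \<Rightarrow> (real^2) \<Rightarrow>\<^sub>L (real^2)) (P :: (real^2) set)
           (S :: real^2 \<Rightarrow> real^2 \<Rightarrow> real).
    a < b \<and> admissible_quadruple a b g R P S \<and>
    real_analytic_on R {a..b} \<and> n_plus g UNIV = 1 \<and> P = {0} \<and>
    (\<exists>!t. focal_instant a b g R P S t) \<and> \<not> focal_instant a b g R P S b \<and>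
    maslov_index a b g R P S = -1 \<and> focal_index a b g R P S = 0"
proof (intro exI conjI)
  show "(0::real) < 5/4" by simp
  show "admissible_quadruple 0 (5/4) hyp Rop {0} (\<lambda>_ _. 0)" by (rule admissible_Rop)
  show "real_analytic_on Rop {0..5/4}" by (rule real_analytic_Rop)
  show "n_plus hyp UNIV = 1" by (rule n_plus_hyp)
  show "\<exists>!t. focal_instant 0 (5/4) hyp Rop {0} (\<lambda>_ _. 0) t" unfolding focal_iff by blast
  show "\<not> focal_instant 0 (5/4) hyp Rop {0} (\<lambda>_ _. 0) (5/4)" unfolding focal_iff by simp
  show "maslov_index 0 (5/4) hyp Rop {0} (\<lambda>_ _. 0) = -1" by (rule maslov_index_curve)
  show "focal_index 0 (5/4) hyp Rop {0} (\<lambda>_ _. 0) = 0"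
    unfolding focal_index_def focal_iff by (simp add: focal_signature_1)
qed (rule refl)

end
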